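(* Let $m\ge1$ be an integer and let $\gamma=(\gamma_1,\gamma_2,\ldots)$ be a finitely supported real sequence defining an order $m$ multicritical Schur measure $\mathbb{P}^m_\theta$ for each $\theta>0$, with right edge, left edge and fluctuation coefficients $b,\tilde b,d$. Let $\lambda$ be a random partition under $\mathbb{P}^m_\theta$, with rescaled profile $\psi_{\lambda,\theta}$. Then, as $\theta\to\infty$, one has the convergence in probability $$\sup_{x\in\mathbb{R}}|\psi_{\lambda,\theta}(x)-\Omega(x)|\xrightarrow{p}0,$$ where $\Omega$ is the deterministic function $$\Omega(x)=\begin{cases}x+2\tilde b-\frac2\pi\int_{-\tilde b}^x\chi(v)\,dv, & x\in[-\tilde b,b],\\ |x|, & x>b\text{ or }x<-\tilde b,\end{cases}$$ with $\chi(x)\in[0,\pi]$ determined implicitly by $$2\sum_{r\ge1}r\gamma_r\cos r\chi(x)=x,\qquad x\in[-\tilde b,b].$$ Moreover, at the right edge the derivative of the limiting profile displays the critical exponent $\frac1{2m}$: $$1-\Omega'(x)\sim\frac2\pi\left(\frac{b-x}{d}\right)^{\frac1{2m}}\qquad\text{as }x\to b^-.$$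
   Context: A partition is a finite non-increasing sequence $\lambda=(\lambda_1\ge\lambda_2\ge\cdots\ge\lambda_{\ell(\lambda)})$ of positive integers, with $\lambda_i:=0$ for $i>\ell(\lambda)$. Its conjugate $\lambda'$ has parts $\lambda'_j=\#\{i:\lambda_i\ge j\}$. For a sequence $t=(t_1,t_2,\ldots)$ (Miwa times), define $h_k[t]$ by $\sum_k h_k[t]z^k=\exp\left[\sum_{r\ge1}t_rz^r\right]$ (so $h_k[t]=0$ for $k<0$, $h_0[t]=1$), and the Schur function $s_\lambda[t]=\det_{1\le i,j\le\ell(\lambda)}h_{\lambda_i-i+j}[t]$. Order $m$ multicritical Schur measure: for $\theta>0$, it is the probability measure on all partitions $\mathbb{P}^m_\theta(\lambda)=e^{-\theta^2\sum_r r\gamma_r^2}s_\lambda[\theta\gamma]^2$, where $\theta\gamma=(\theta\gamma_1,\theta\gamma_2,\ldots)$ and $\gamma$ is a finitely supported real sequence satisfying $\sum_{r\ge1}r^{2p+1}\gamma_r=0$ for $p=1,\ldots,m-1$ (no condition if $m=1$), $\sum_{r\ge1}r^{2m+1}\gamma_r\ne0$, and $\sum_{r\ge1}r^2\gamma_r\sin r\phi\ge0$ for all $\phi\in[0,\pi]$. The right edge, left edge and fluctuation coefficients are the positive constants $$b=2\sum_{r\ge1}r\gamma_r,\qquad\tilde b=2\sum_{r\ge1}(-1)^{r+1}r\gamma_r,\qquad d=\frac{2(-1)^{m+1}}{(2m)!}\sum_{r\ge1}r^{2m+1}\gamma_r.$$ (The last sign condition ensures that the equation defining $\chi(x)$ has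 a unique solution in $[0,\pi]$.) Rescaled profile: $\psi_{\lambda,\theta}:\mathbb{R}\to\mathbb{R}$ is the continuous piecewise linear curve (slopes $\pm1$) tracing the upper boundary of the Young diagram of $\lambda$ in the Russian convention, rescaled by $1/\theta$: it is the graph obtained from the boundary relations $v=\frac1\theta\lambda_{\lfloor\theta u\rfloor+1}$ $(u>0)$, $u=\frac1\theta\lambda'_{\lfloor\theta v\rfloor+1}$ $(v>0)$ by setting $x=v-u$, $\psi_{\lambda,\theta}(x)=u+v$. Equivalently, with $S(\lambda)=\{\lambda_i-i+\frac12:i\ge1\}$, $\psi_{\lambda,\theta}(x)=x+\frac2\theta\#\{k\in S(\lambda):k>\theta x\}$ for $x\in\frac1\theta\mathbb{Z}$, with linear interpolation in between. In particular $\psi_{\lambda,\theta}(x)=|x|$ for $x>\lambda_1/\theta$ and for $x<-\ell(\lambda)/\theta$. *)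

theory Defs
  imports
    "HOL-Probability.Probability"
    "HOL-Computational_Algebra.Formal_Power_Series"
    "HOL-Library.Landau_Symbols"
    "Jordan_Normal_Form.Determinant"
begin

definition partitions :: "nat list set" where
  "partitions = {\<mu>. sorted_wrt (\<ge>) \<mu> \<and> (\<forall>k\<in>set \<mu>. 0 < k)}"

text \<open>Parts are indexed from 1, and are 0 beyond the length of the partition.\<close>

definition part :: "nat list \<Rightarrow> nat \<Rightarrow> nat" where
  "part \<mu> i = (if 1 \<le> i \<and> i \<le> length \<mu> then \<mu> ! (i - 1) else 0)"

text \<open>
  A sequence of Miwa times \<open>t\<^sub>1, t\<^sub>2, \<dots>\<close> is a function on \<^typ>\<open>nat\<close> whose value at 0 is
  ignored throughout. The exponential generating series is a formal power series.
\<close>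

definition miwa_series :: "(nat \<Rightarrow> real) \<Rightarrow> real fps" where
  "miwa_series t = fps_exp 1 oo Abs_fps (\<lambda>r. if r = 0 then 0 else t r)"

definition hpoly :: "(nat \<Rightarrow> real) \<Rightarrow> int \<Rightarrow> real" where
  "hpoly t k = (if k < 0 then 0 else fps_nth (miwa_series t) (nat k))"

text \<open>Matrices have row and column indices starting at 0, hence \<open>Suc i\<close>.\<close>

definition schur :: "nat list \<Rightarrow> (nat \<Rightarrow> real) \<Rightarrow> real" where
  "schur \<mu> t =
     Determinant.det (mat (length \<mu>) (length \<mu>)
       (\<lambda>(i, j). hpoly t (int (part \<mu> (Suc i)) - int i + int j)))"

definition seq_support :: "(nat \<Rightarrow> real) \<Rightarrow> nat set" where
  "seq_support \<gamma> = {r. 1 \<le> r \<and> \<gamma> r \<noteq> 0}"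

definition multicritical :: "nat \<Rightarrow> (nat \<Rightarrow> real) \<Rightarrow> bool" where
  "multicritical m \<gamma> \<longleftrightarrow>
     finite (seq_support \<gamma>) \<and>
     (\<forall>p\<in>{1..<m}. (\<Sum>r\<in>seq_support \<gamma>. real r ^ (2 * p + 1) * \<gamma> r) = 0) \<and>
     (\<Sum>r\<in>seq_support \<gamma>. real r ^ (2 * m + 1) * \<gamma> r) \<noteq> 0 \<and>
     (\<forall>\<phi>\<in>{0..pi}. 0 \<le> (\<Sum>r\<in>seq_support \<gamma>. real r ^ 2 * \<gamma> r * sin (real r * \<phi>)))"

definition schur_weight :: "(nat \<Rightarrow> real) \<Rightarrow> real \<Rightarrow> nat list \<Rightarrow> real" where
  "schur_weight \<gamma> \<theta> \<mu> =
     exp (- (\<theta> ^ 2) * (\<Sum>r\<in>seq_support \<gamma>. real r * (\<gamma> r) ^ 2)) *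
     (schur \<mu> (\<lambda>r. \<theta> * \<gamma> r)) ^ 2"

text \<open>The total mass is 1 by the Cauchy identity for Schur functions.\<close>

definition schur_measure :: "(nat \<Rightarrow> real) \<Rightarrow> real \<Rightarrow> nat list measure" where
  "schur_measure \<gamma> \<theta> = point_measure partitions (\<lambda>\<mu>. ennreal (schur_weight \<gamma> \<theta> \<mu>))"

definition right_edge :: "(nat \<Rightarrow> real) \<Rightarrow> real" where
  "right_edge \<gamma> = 2 * (\<Sum>r\<in>seq_support \<gamma>. real r * \<gamma> r)"

definition left_edge :: "(nat \<Rightarrow> real) \<Rightarrow> real" where
  "left_edge \<gamma> = 2 * (\<Sum>r\<in>seq_support \<gamma>. (- 1) ^ (r + 1) * real r * \<gamma> r)"

definition fluct_coeff :: "nat \<Rightarrow> (nat \<Rightarrow> real) \<Rightarrow> real" where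
  "fluct_coeff m \<gamma> =
     2 * (- 1) ^ (m + 1) / fact (2 * m) * (\<Sum>r\<in>seq_support \<gamma>. real r ^ (2 * m + 1) * \<gamma> r)"

definition maya :: "nat list \<Rightarrow> real set" where
  "maya \<mu> = {real (part \<mu> i) - real i + 1 / 2 | i. 1 \<le> i}"

definition profile_node :: "nat list \<Rightarrow> real \<Rightarrow> int \<Rightarrow> real" where
  "profile_node \<mu> \<theta> n =
     of_int n / \<theta> + 2 / \<theta> * real (card {k \<in> maya \<mu>. k > of_int n})"

text \<open>
  The profile takes the value \<open>profile_node \<mu> \<theta> n\<close> at \<open>x = n / \<theta>\<close> and is interpolated
  linearly between consecutive points of this form.
\<close>

definition profile :: "nat list \<Rightarrow> real \<Rightarrow> real \<Rightarrow> real" where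
  "profile \<mu> \<theta> x =
     (1 - frac (\<theta> * x)) * profile_node \<mu> \<theta> \<lfloor>\<theta> * x\<rfloor> +
     frac (\<theta> * x) * profile_node \<mu> \<theta> (\<lfloor>\<theta> * x\<rfloor> + 1)"

text \<open>
  For multicritical \<open>\<gamma>\<close> and \<open>x\<close> between \<open>- left_edge \<gamma>\<close> and \<open>right_edge \<gamma>\<close>, the
  equation below has exactly one solution: by the last condition of \<open>multicritical\<close> its
  left-hand side is decreasing in \<open>\<phi>\<close>, strictly so as it is analytic and not constant.
\<close>

definition chi :: "(nat \<Rightarrow> real) \<Rightarrow> real \<Rightarrow> real" where
  "chi \<gamma> x =
     (THE \<phi>. \<phi> \<in> {0..pi} \<and> 2 * (\<Sum>r\<in>seq_support \<gamma>. real r * \<gamma> r * cos (real r * \<phi>)) = x)"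

definition Omega :: "(nat \<Rightarrow> real) \<Rightarrow> real \<Rightarrow> real" where
  "Omega \<gamma> x =
     (if x \<in> {- left_edge \<gamma>..right_edge \<gamma>}
      then x + 2 * left_edge \<gamma> - 2 / pi * integral {- left_edge \<gamma>..x} (chi \<gamma>)
      else \<bar>x\<bar>)"

end

theory Submission
  imports Defs "HOL-Complex_Analysis.Complex_Analysis"
begin

text \<open>
  The integers \<open>\<lambda>\<^sub>i - i + 1\<close> form a determinantal point process. Andreief's identity expresses the
  probability that a finite set of sites is avoided through rank-one changes of a Gram determinant,
  and Cauchy-Schwarz then bounds the probability that the site \<open>k\<close> is occupied by
  \<open>\<Sum>l\<ge>k. J\<^sub>l\<^sup>2\<close>, and that of two sites by the product of these bounds, where \<open>J\<close> are the Fourier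
  coefficients of \<open>exp (\<Sum>r. t\<^sub>r (z\<^sup>r - z\<^sup>-\<^sup>r))\<close>. As there are \<open>n\<close> more holes up to a level than
  particles above it, the corresponding lower bounds cost nothing: the number of
  particles above \<open>n\<close> has mean exactly \<open>E (X - n)\<^sub>+\<close>, where \<open>X\<close> has the law \<open>J\<^sub>l\<^sup>2\<close>, and its variance is
  at most its mean, which makes it concentrate.

  Parseval turns the characteristic function of \<open>X / \<theta>\<close> into the integral of a phase that converges to
  \<open>exp (i s \<xi>(U))\<close> with \<open>\<xi>(\<phi>) = 2 \<Sum>r. r \<gamma>\<^sub>r cos (r \<phi>)\<close> and \<open>U\<close> uniform on the circle, so the
  profile converges to \<open>E \<bar>\<xi>(U) - x\<bar>\<close>. As \<open>\<xi>\<close> decreases on \<open>[0, \<pi>]\<close> with inverse \<open>\<chi>\<close>, this is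
  \<open>\<Omega>(x)\<close>, and \<open>\<Omega>'(x) = 1 - 2 \<chi>(x) / \<pi>\<close>. Uniformity is automatic for 1-Lipschitz functions, and the
  multicriticality conditions say that \<open>b - \<xi>(\<phi>)\<close> behaves like \<open>d \<phi>\<^sup>2\<^sup>m\<close> at 0.
\<close>

section \<open>The coefficients of the Miwa series\<close>

text \<open>Two power series identities carry the algebra. Let H be the series of the h_k and V its
  exponent. Euler's identity z H' = (z V') H acts on determinants row by row: lowering single rows
  by r expresses the size of \<lambda> times s_\<lambda>, raising them by r multiplies s_\<lambda>
  by r t_r, and the two operations are adjoint in the sum over partitions. This gives a recursion
  for the sum of s_\<lambda>^2 over each size, hence the total mass. Secondly, the symbol is H(z) /
  H(1/z), so the sequence k \<mapsto> h_{k+j} comes from the symbol by multiplication with a shift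
  of H(1/z): it is a combination of the sequences k \<mapsto> J_{k+l}, l \<ge> 0. Cauchy-Schwarz is
  applied to this representation for every number n of rows, and its bound does not depend on n;
  thus no limit of inverse Gram matrices has to be identified. Inequalities suffice because the
  bounds for particles and for holes have sums that differ by exactly the level, as the counts
  themselves do. This equality expresses that X has mean 0, which is the mean of \<xi> over the
  circle.\<close>

lemma hpoly_neg [simp]: "k < 0 \<Longrightarrow> hpoly t k = 0"
  by (simp add: hpoly_def)

lemma hpoly_0 [simp]: "hpoly t 0 = 1"
  by (simp add: hpoly_def miwa_series_def fps_compose_nth)

lemma fps_deriv_miwa_series:
  "fps_deriv (miwa_series t) = miwa_series t * fps_deriv (Abs_fps (\<lambda>r. if r = 0 then 0 else t r))"
  unfolding miwa_series_def by (subst fps_compose_deriv) simp_all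

text \<open>This is z H' = (z V') H read off coefficientwise, H being the generating series and V
  its exponent. It is stated for every integer index, both sides vanishing below 1, so that it can
  be applied to each entry of a determinant.\<close>

lemma hpoly_euler:
  assumes "finite (seq_support t)"
  shows "of_int k * hpoly t k = (\<Sum>r\<in>seq_support t. real r * t r * hpoly t (k - int r))"
proof (cases "k \<le> 0")
  case True
  moreover have "hpoly t (k - int r) = 0" if "r \<in> seq_support t" for r
    using that True by (auto simp: seq_support_def)
  ultimately show ?thesis by (cases "k = 0") auto
next
  case False
  then obtain n where k: "k = int (Suc n)"
    by (metis nat_0_iff not_less_eq_eq zero_le_imp_eq_int linorder_not_le not0_implies_Suc nat_int less_imp_le)
  have "of_int k * hpoly t k = fps_nth (fps_deriv (miwa_series t)) n"
    unfolding k hpoly_def by (simp add: nat_add_distrib)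
  also have "\<dots> = (\<Sum>i=0..n. fps_nth (miwa_series t) i * (real (n - i + 1) * t (n - i + 1)))"
    unfolding fps_deriv_miwa_series by (simp add: fps_mult_nth)
  also have "\<dots> = (\<Sum>r\<in>{1..Suc n}. real r * t r * hpoly t (k - int r))"
    by (rule sum.reindex_bij_witness[of _ "\<lambda>r. Suc n - r" "\<lambda>i. Suc n - i"])
       (auto simp: hpoly_def k nat_diff_distrib' Suc_diff_le)
  also have "\<dots> = (\<Sum>r\<in>seq_support t \<union> {1..Suc n}. real r * t r * hpoly t (k - int r))"
    by (rule sum.mono_neutral_left) (use assms in \<open>auto simp: k seq_support_def\<close>)
  also have "\<dots> = (\<Sum>r\<in>seq_support t. real r * t r * hpoly t (k - int r))"
    by (rule sum.mono_neutral_right) (use assms in \<open>auto simp: k seq_support_def\<close>)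
  finally show ?thesis .
qed

lemma seq_support_uminus [simp]: "seq_support (\<lambda>r. - t r) = seq_support t"
  by (auto simp: seq_support_def)

lemma miwa_series_uminus: "miwa_series t * miwa_series (\<lambda>r. - t r) = 1"
proof -
  define V where "V = Abs_fps (\<lambda>r. if r = 0 then 0 else t r)"
  have V': "Abs_fps (\<lambda>r. if r = 0 then 0 else - t r) = - V"
    by (rule fps_ext) (simp add: V_def)
  have "fps_deriv (miwa_series t * miwa_series (\<lambda>r. - t r)) = 0"
    by (simp add: fps_deriv_miwa_series V' flip: V_def)
  hence "miwa_series t * miwa_series (\<lambda>r. - t r) =
      fps_const (fps_nth (miwa_series t * miwa_series (\<lambda>r. - t r)) 0)"
    by (simp only: fps_deriv_eq_0_iff)
  also have "\<dots> = 1"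
    by (simp add: miwa_series_def fps_compose_nth)
  finally show ?thesis .
qed

lemma hpoly_convolution:
  "(\<Sum>i\<le>n. hpoly t (int i) * hpoly (\<lambda>r. - t r) (int (n - i))) = (if n = 0 then 1 else 0)"
proof -
  have "fps_nth (miwa_series t * miwa_series (\<lambda>r. - t r)) n = (if n = 0 then 1 else 0)"
    by (simp add: miwa_series_uminus)
  thus ?thesis by (simp add: fps_mult_nth hpoly_def atLeast0AtMost del: of_nat_diff)
qed

text \<open>The generating function is entire, so its coefficients decay faster than any geometric
  sequence. Here this follows from the recursion alone: it expresses n h_n by earlier coefficients
  with a loss of at most the fixed factor \<open>B / \<rho> ^ R\<close>, which n eventually
  exceeds.\<close>

lemma hpoly_decay:
  assumes fin: "finite (seq_support t)" and rho: "0 < \<rho>" "\<rho> \<le> 1"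
  shows "\<exists>C\<ge>0. \<forall>n. \<bar>hpoly t (int n)\<bar> \<le> C * \<rho> ^ n"
proof -
  define R where "R = Max (insert 0 (seq_support t))"
  have R: "r \<le> R" if "r \<in> seq_support t" for r
    unfolding R_def using fin that by (intro Max_ge) auto
  define B where "B = (\<Sum>r\<in>seq_support t. real r * \<bar>t r\<bar>)"
  have B0: "B \<ge> 0" unfolding B_def by (intro sum_nonneg) auto
  obtain n0 :: nat where n0: "real n0 > B / \<rho> ^ R" using reals_Archimedean2 by blast
  define C where "C = (\<Sum>k\<le>n0. \<bar>hpoly t (int k)\<bar> / \<rho> ^ k)"
  have C0: "C \<ge> 0" unfolding C_def by (intro sum_nonneg) (use rho in auto)
  have "\<bar>hpoly t (int n)\<bar> \<le> C * \<rho> ^ n" for n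
  proof (induction n rule: less_induct)
    case (less n)
    show ?case
    proof (cases "n \<le> n0")
      case True
      have "\<bar>hpoly t (int n)\<bar> / \<rho> ^ n \<le> C"
        unfolding C_def by (rule member_le_sum) (use True rho in auto)
      thus ?thesis using rho by (simp add: divide_simps)
    next
      case False
      hence n: "n > 0" "real n \<ge> B / \<rho> ^ R" using n0 by auto
      have tm: "\<bar>hpoly t (int n - int r)\<bar> \<le> C * (\<rho> ^ n / \<rho> ^ R)" if r: "r \<in> seq_support t" for r
      proof (cases "r \<le> n")
        case True
        have "r > 0" using r by (auto simp: seq_support_def)
        have "\<bar>hpoly t (int n - int r)\<bar> = \<bar>hpoly t (int (n - r))\<bar>" using True by (simp add: of_nat_diff)
        also have "\<dots> \<le> C * \<rho> ^ (n - r)" by (rule less) (use \<open>r > 0\<close> n in auto)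
        also have "\<rho> ^ (n - r) = \<rho> ^ n / \<rho> ^ r" using True rho by (simp add: power_diff)
        also have "\<dots> \<le> \<rho> ^ n / \<rho> ^ R"
          by (intro divide_left_mono power_decreasing) (use R[OF r] rho in auto)
        finally show ?thesis using C0 by (simp add: mult_left_mono)
      next
        case False
        thus ?thesis using C0 rho by simp
      qed
      have "real n * \<bar>hpoly t (int n)\<bar> = \<bar>\<Sum>r\<in>seq_support t. real r * t r * hpoly t (int n - int r)\<bar>"
        using hpoly_euler[OF fin, of "int n"] by (metis abs_mult abs_of_nat of_int_of_nat_eq)
      also have "\<dots> \<le> (\<Sum>r\<in>seq_support t. real r * \<bar>t r\<bar> * \<bar>hpoly t (int n - int r)\<bar>)"
        by (rule order_trans[OF sum_abs]) (simp add: abs_mult)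
      also have "\<dots> \<le> (\<Sum>r\<in>seq_support t. real r * \<bar>t r\<bar> * (C * (\<rho> ^ n / \<rho> ^ R)))"
        by (intro sum_mono mult_left_mono tm) auto
      also have "\<dots> = B / \<rho> ^ R * (C * \<rho> ^ n)"
        by (simp add: B_def sum_distrib_right sum_divide_distrib)
      also have "\<dots> \<le> real n * (C * \<rho> ^ n)"
        by (intro mult_right_mono n) (use C0 rho in auto)
      finally show ?thesis using n by simp
    qed
  qed
  with C0 show ?thesis by blast
qed

text \<open>The series converges everywhere by the decay above, and the Euler recursion says that
  its sum F solves F' = V' F. Hence F exp(-V) is constant, and it is 1 at the origin.\<close>

lemma hpoly_sums_exp:
  assumes fin: "finite (seq_support t)"
  shows "(\<lambda>n. of_real (hpoly t (int n)) * z ^ n) sums exp (\<Sum>r\<in>seq_support t. of_real (t r) * z ^ r :: complex)"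
proof -
  define c :: "nat \<Rightarrow> complex" where "c n = of_real (hpoly t (int n))" for n
  define V where "V z = (\<Sum>r\<in>seq_support t. of_real (t r) * z ^ r :: complex)" for z
  define V' where "V' z = (\<Sum>r\<in>seq_support t. of_real (t r) * (of_nat r * z ^ (r - 1)) :: complex)" for z
  have summ: "summable (\<lambda>n. c n * z ^ n)" for z
  proof -
    define \<rho> where "\<rho> = 1 / (2 * (norm z + 1))"
    have nz: "norm z + 1 > 0" using norm_ge_zero[of z] by linarith
    have rho: "0 < \<rho>" "\<rho> \<le> 1" using nz by (auto simp: \<rho>_def divide_simps)
    from hpoly_decay[OF fin rho] obtain C where C: "C \<ge> 0" "\<And>n. \<bar>hpoly t (int n)\<bar> \<le> C * \<rho> ^ n" by blast
    have half: "\<rho> * norm z \<le> 1/2" using nz by (simp add: \<rho>_def divide_simps)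
    show ?thesis
    proof (rule summable_comparison_test')
      show "summable (\<lambda>n. C * (1/2) ^ n)" by (intro summable_mult summable_geometric) auto
      fix n
      have "norm (c n * z ^ n) \<le> C * \<rho> ^ n * norm z ^ n"
        using C(2)[of n] by (simp add: c_def norm_mult norm_power mult_right_mono)
      also have "\<dots> = C * (\<rho> * norm z) ^ n" by (simp add: power_mult_distrib)
      also have "\<dots> \<le> C * (1/2) ^ n"
        by (intro mult_left_mono power_mono half C) (use rho in auto)
      finally show "norm (c n * z ^ n) \<le> C * (1/2) ^ n" .
    qed
  qed
  define F where "F z = (\<Sum>n. c n * z ^ n)" for z
  have dF: "(F has_field_derivative (\<Sum>n. diffs c n * z ^ n)) (at z)" for z
    unfolding F_def by (rule termdiffs_strong_converges_everywhere) (rule summ)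
  have ode: "(\<Sum>n. diffs c n * z ^ n) = V' z * F z" for z
  proof -
    have "(\<lambda>n. of_real (t r) * of_nat r * z ^ (r - 1) * (c n * z ^ n)) sums (of_real (t r) * of_nat r * z ^ (r - 1) * F z)" for r
      unfolding F_def by (intro sums_mult summable_sums summ)
    hence 1: "(\<lambda>n. of_real (t r) * of_nat r * z ^ (n + (r - 1)) * c n) sums (of_real (t r) * of_nat r * z ^ (r - 1) * F z)" for r
      by (simp add: power_add mult_ac)
    \<comment> \<open>The coefficient belonging to z^n has index n + 1 - r, which is negative for n
      < r - 1; so the product series starts at r - 1.\<close>
    have 2: "(\<lambda>n. of_real (t r) * of_nat r * z ^ n * of_real (hpoly t (int n + 1 - int r))) sums (of_real (t r) * of_nat r * z ^ (r - 1) * F z)"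
      if "r \<in> seq_support t" for r
    proof -
      have r: "r \<ge> 1" using that by (auto simp: seq_support_def)
      show ?thesis
      proof (rule iffD1[OF sums_zero_iff_shift[where n = "r - 1"]])
        fix i assume "i < r - 1" thus "of_real (t r) * of_nat r * z ^ i * of_real (hpoly t (int i + 1 - int r)) = (0::complex)" by simp
      next
        show "(\<lambda>i. of_real (t r) * of_nat r * z ^ (i + (r - 1)) * of_real (hpoly t (int (i + (r - 1)) + 1 - int r))) sums
              (of_real (t r) * of_nat r * z ^ (r - 1) * F z)"
          using 1[of r] r by (simp add: c_def of_nat_diff)
      qed
    qed
    have "(\<lambda>n. \<Sum>r\<in>seq_support t. of_real (t r) * of_nat r * z ^ n * of_real (hpoly t (int n + 1 - int r))) sums
            (\<Sum>r\<in>seq_support t. of_real (t r) * of_nat r * z ^ (r - 1) * F z)"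
      by (intro sums_sum 2)
    also have "(\<lambda>n. \<Sum>r\<in>seq_support t. of_real (t r) * of_nat r * z ^ n * of_real (hpoly t (int n + 1 - int r))) =
       (\<lambda>n. diffs c n * z ^ n)"
    proof
      fix n
      have "complex_of_real (real (Suc n) * hpoly t (int (Suc n))) =
         (\<Sum>r\<in>seq_support t. of_real (t r) * of_nat r * of_real (hpoly t (int n + 1 - int r)))"
        using hpoly_euler[OF fin, of "int (Suc n)"] by (simp add: algebra_simps)
      thus "(\<Sum>r\<in>seq_support t. of_real (t r) * of_nat r * z ^ n * of_real (hpoly t (int n + 1 - int r))) = diffs c n * z ^ n"
        by (simp add: diffs_def c_def sum_distrib_right sum_distrib_left mult_ac)
    qed
    also have "(\<Sum>r\<in>seq_support t. of_real (t r) * of_nat r * z ^ (r - 1) * F z) = V' z * F z"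
      by (simp add: V'_def sum_distrib_right sum_distrib_left mult_ac)
    finally show ?thesis by (rule sums_unique[symmetric])
  qed
  have dV: "(V has_field_derivative V' z) (at z)" for z
    unfolding V_def V'_def by (auto intro!: derivative_eq_intros sum.cong)
  have "((\<lambda>z. F z * exp (- V z)) has_field_derivative 0) (at z within UNIV)" for z
    by (rule derivative_eq_intros dF[unfolded ode] dV refl)+ (simp add: algebra_simps)
  hence "\<exists>k. \<forall>z\<in>UNIV. F z * exp (- V z) = k"
    by (intro has_field_derivative_zero_constant) auto
  then obtain k where k: "\<And>z. F z * exp (- V z) = k" by auto
  have "V 0 = 0" unfolding V_def by (intro sum.neutral) (auto simp: seq_support_def)
  moreover have "F 0 = 1" unfolding F_def by (simp add: c_def)
  ultimately have "k = 1" using k[of 0] by simp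
  hence "F z = exp (V z)" using k[of z] by (simp add: exp_minus field_simps)
  thus ?thesis using summable_sums[OF summ[of z]] by (simp add: F_def c_def V_def)
qed

section \<open>Determinants of functions\<close>

text \<open>Entries are given by a function so that a row or a column can be replaced inside a
  lambda term, without carrier conditions.\<close>

definition fdet :: "nat \<Rightarrow> (nat \<Rightarrow> nat \<Rightarrow> real) \<Rightarrow> real" where
  "fdet n A = Determinant.det (mat n n (\<lambda>(i, j). A i j))"

definition fcofactor :: "nat \<Rightarrow> (nat \<Rightarrow> nat \<Rightarrow> real) \<Rightarrow> nat \<Rightarrow> nat \<Rightarrow> real" where
  "fcofactor n A i j = cofactor (mat n n (\<lambda>(i, j). A i j)) i j"

lemma fdet_cong: "(\<And>i j. i < n \<Longrightarrow> j < n \<Longrightarrow> A i j = B i j) \<Longrightarrow> fdet n A = fdet n B"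
  unfolding fdet_def by (intro arg_cong[where f = Determinant.det] eq_matI) auto

lemma fdet_leibniz: "fdet n A = (\<Sum>p | p permutes {0..<n}. signof p * (\<Prod>i=0..<n. A i (p i)))"
  unfolding fdet_def
  by (subst det_def'[where n = n])
     (auto intro!: sum.cong prod.cong dest: permutes_in_image[where x = i for i])

lemma fdet_transpose: "fdet n (\<lambda>i j. A j i) = fdet n A"
proof -
  have "mat n n (\<lambda>(i, j). A j i) = transpose_mat (mat n n (\<lambda>(i, j). A i j))"
    by (intro eq_matI) auto
  thus ?thesis unfolding fdet_def by (simp add: det_transpose[where n = n])
qed

lemma fdet_permute_rows:
  assumes "p permutes {0..<n}"
  shows "fdet n (\<lambda>i j. A (p i) j) = signof p * fdet n A"
proof -
  have eq: "mat n n (\<lambda>(i, j). A (p i) j) = mat n n (\<lambda>(i, j). mat n n (\<lambda>(i, j). A i j) $$ (p i, j))"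
    using permutes_in_image[OF assms] by (intro eq_matI) auto
  show ?thesis unfolding fdet_def eq by (rule det_permute_rows[OF mat_carrier assms])
qed

lemma fdet_identical_rows:
  assumes "i \<noteq> k" "i < n" "k < n" "\<And>j. j < n \<Longrightarrow> A i j = A k j"
  shows "fdet n A = 0"
  unfolding fdet_def
  by (rule det_identical_rows[OF mat_carrier assms(1-3)]) (use assms in \<open>auto intro!: eq_vecI\<close>)

lemma fdet_identical_cols:
  assumes "i \<noteq> k" "i < n" "k < n" "\<And>j. j < n \<Longrightarrow> A j i = A j k"
  shows "fdet n A = 0"
  by (subst fdet_transpose[symmetric], rule fdet_identical_rows[of i k]) (use assms in auto)

lemma fdet_replace_row:
  assumes "i < n"
  shows "fdet n (\<lambda>k j. if k = i then B j else A k j) = (\<Sum>j<n. B j * fcofactor n A i j)"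
proof -
  let ?M = "mat n n (\<lambda>(k, j). if k = i then B j else A k j)"
  have "cofactor ?M i j = fcofactor n A i j" if "j < n" for j
    unfolding cofactor_def fcofactor_def mat_delete_def
    by (intro arg_cong2[where f = "(*)"] arg_cong[where f = Determinant.det] refl eq_matI) auto
  thus ?thesis unfolding fdet_def using laplace_expansion_row[OF mat_carrier assms, of "\<lambda>(k, j). if k = i then B j else A k j"] assms
    by (auto intro!: sum.cong)
qed

lemma fdet_replace_col:
  assumes "j < n"
  shows "fdet n (\<lambda>i k. if k = j then B i else A i k) = (\<Sum>i<n. B i * fcofactor n A i j)"
proof -
  let ?M = "mat n n (\<lambda>(i, k). if k = j then B i else A i k)"
  have "cofactor ?M i j = fcofactor n A i j" if "i < n" for i
    unfolding cofactor_def fcofactor_def mat_delete_def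
    by (intro arg_cong2[where f = "(*)"] arg_cong[where f = Determinant.det] refl eq_matI) auto
  thus ?thesis unfolding fdet_def using laplace_expansion_column[OF mat_carrier assms, of "\<lambda>(i, k). if k = j then B i else A i k"] assms
    by (auto intro!: sum.cong)
qed

lemma fdet_expand_row: "i < n \<Longrightarrow> fdet n A = (\<Sum>j<n. A i j * fcofactor n A i j)"
  by (subst fdet_replace_row[symmetric], assumption) (auto intro: fdet_cong)

lemma fdet_expand_col: "j < n \<Longrightarrow> fdet n A = (\<Sum>i<n. A i j * fcofactor n A i j)"
  by (subst fdet_replace_col[symmetric, where B = "\<lambda>i. A i j"], assumption) (auto intro: fdet_cong)

lemma fdet_row_0: "i < n \<Longrightarrow> (\<And>j. j < n \<Longrightarrow> A i j = 0) \<Longrightarrow> fdet n A = 0"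
  by (simp add: fdet_expand_row)

text \<open>Both sides sum \<open>B i j\<close> times the cofactor at (i, j) over all i and j. This
  turns raising the rows one after the other into raising the columns, where determinants with two
  equal columns appear.\<close>

lemma fdet_replace_rows_eq_cols:
  "(\<Sum>i<n. fdet n (\<lambda>k j. if k = i then B i j else A k j)) =
   (\<Sum>j<n. fdet n (\<lambda>i k. if k = j then B i j else A i k))"
  by (simp add: fdet_replace_row fdet_replace_col) (rule sum.swap)

lemma fdet_block:
  assumes "l \<le> n" and zero: "\<And>i j. l \<le> i \<Longrightarrow> i < n \<Longrightarrow> j < l \<Longrightarrow> A i j = 0"
  shows "fdet n A = fdet l A * fdet (n - l) (\<lambda>i j. A (l + i) (l + j))"
proof -
  have "mat n n (\<lambda>(i, j). A i j) = four_block_mat (mat l l (\<lambda>(i, j). A i j))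
      (mat l (n - l) (\<lambda>(i, j). A i (l + j))) (0\<^sub>m (n - l) l)
      (mat (n - l) (n - l) (\<lambda>(i, j). A (l + i) (l + j)))"
    using assms by (intro eq_matI) auto
  thus ?thesis unfolding fdet_def
    by (simp add: det_four_block_mat_lower_left_zero[where n = l and m = "n - l"])
qed

lemma fdet_upper_unitriangular:
  assumes "\<And>i j. i < n \<Longrightarrow> j < i \<Longrightarrow> A i j = 0" "\<And>i. i < n \<Longrightarrow> A i i = 1"
  shows "fdet n A = 1"
proof -
  have "upper_triangular (mat n n (\<lambda>(i, j). A i j))"
    using assms by (auto simp: upper_triangular_def)
  hence "fdet n A = prod_list (diag_mat (mat n n (\<lambda>(i, j). A i j)))"
    unfolding fdet_def by (rule det_upper_triangular[OF _ mat_carrier])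
  also have "diag_mat (mat n n (\<lambda>(i, j). A i j)) = map (\<lambda>i. 1) [0..<n]"
    unfolding diag_mat_def using assms by auto
  finally show ?thesis by (simp add: prod_list_replicate map_replicate_const)
qed

text \<open>With B a right inverse of A, adj A = adj A (A B) = (adj A A) B = det A B. An explicit
  inverse thus yields the cofactors directly.\<close>

lemma fcofactor_unique:
  assumes inv: "\<And>i j. i < n \<Longrightarrow> j < n \<Longrightarrow> (\<Sum>k<n. A i k * B k j) = (if i = j then 1 else 0)"
    and "i < n" "j < n"
  shows "fcofactor n A i j = fdet n A * B j i"
proof -
  let ?A = "mat n n (\<lambda>(i, j). A i j)" and ?B = "mat n n (\<lambda>(i, j). B i j)"
  have AB: "?A * ?B = 1\<^sub>m n"
    by (intro eq_matI) (auto simp: scalar_prod_def inv atLeast0LessThan)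
  have ac: "adj_mat ?A \<in> carrier_mat n n" by (rule adj_mat(1)) auto
  have "adj_mat ?A = adj_mat ?A * (?A * ?B)"
    using ac unfolding AB by simp
  also have "\<dots> = (adj_mat ?A * ?A) * ?B"
    using ac by (intro assoc_mult_mat[symmetric]) auto
  also have "\<dots> = fdet n A \<cdot>\<^sub>m ?B"
    unfolding adj_mat(3)[OF mat_carrier] fdet_def
    by (subst mult_smult_assoc_mat[where nr = n and n = n and nc = n]) auto
  finally have "adj_mat ?A $$ (j, i) = (fdet n A \<cdot>\<^sub>m ?B) $$ (j, i)" by simp
  thus ?thesis using assms by (simp add: adj_mat_def fcofactor_def)
qed

section \<open>The Cauchy identity\<close>

text \<open>The antisymmetric extension of the Schur function from decreasing sites to arbitrary
  integer tuples. Shifting a single site may leave the set of partitions, but not the domain of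
  \<open>sdet\<close>.\<close>

definition sdet :: "nat \<Rightarrow> (nat \<Rightarrow> real) \<Rightarrow> (nat \<Rightarrow> int) \<Rightarrow> real" where
  "sdet n t x = fdet n (\<lambda>i j. hpoly t (x i + int j))"

lemma sdet_cong: "(\<And>i. i < n \<Longrightarrow> x i = y i) \<Longrightarrow> sdet n t x = sdet n t y"
  unfolding sdet_def by (intro fdet_cong) simp

lemma sdet_permute: "p permutes {0..<n} \<Longrightarrow> sdet n t (x \<circ> p) = signof p * sdet n t x"
  unfolding sdet_def comp_def by (rule fdet_permute_rows)

lemma sdet_not_inj: "\<not> inj_on x {..<n} \<Longrightarrow> sdet n t x = 0"
  unfolding sdet_def inj_on_def by (auto intro: fdet_identical_rows)

lemma sdet_zero: "i < n \<Longrightarrow> x i < 1 - int n \<Longrightarrow> sdet n t x = 0"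
  unfolding sdet_def by (rule fdet_row_0[of i]) auto

lemma sum_rotate3:
  "(\<Sum>i\<in>A. \<Sum>j\<in>B. \<Sum>r\<in>C. f i j r) = (\<Sum>r\<in>C. \<Sum>i\<in>A. \<Sum>j\<in>B. f i j r)"
proof -
  have "(\<Sum>i\<in>A. \<Sum>j\<in>B. \<Sum>r\<in>C. f i j r) = (\<Sum>i\<in>A. \<Sum>r\<in>C. \<Sum>j\<in>B. f i j r)"
    by (rule sum.cong[OF refl]) (rule sum.swap)
  also have "\<dots> = (\<Sum>r\<in>C. \<Sum>i\<in>A. \<Sum>j\<in>B. f i j r)"
    by (rule sum.swap)
  finally show ?thesis .
qed

text \<open>Euler's identity is applied to every entry: the factor x i of entry (i, j) is collected
  by expanding along row i, the factor j by expanding along column j. For the sites of a partition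
  the total factor is its size.\<close>

lemma sdet_euler:
  assumes fin: "finite (seq_support t)"
  shows "of_int ((\<Sum>i<n. x i) + (\<Sum>j<n. int j)) * sdet n t x =
    (\<Sum>r\<in>seq_support t. real r * t r * (\<Sum>i<n. sdet n t (x(i := x i - int r))))"
proof -
  let ?A = "\<lambda>i j. hpoly t (x i + int j)"
  let ?C = "fcofactor n ?A"
  have "of_int ((\<Sum>i<n. x i) + (\<Sum>j<n. int j)) * sdet n t x =
      (\<Sum>i<n. of_int (x i) * fdet n ?A) + (\<Sum>j<n. real j * fdet n ?A)"
    by (simp add: sdet_def sum_distrib_right ring_distribs)
  also have "\<dots> = (\<Sum>i<n. \<Sum>j<n. of_int (x i) * (?A i j * ?C i j)) + (\<Sum>j<n. \<Sum>i<n. real j * (?A i j * ?C i j))"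
    by (intro arg_cong2[where f = "(+)"] sum.cong refl)
       (auto simp: sum_distrib_left[symmetric] intro!: fdet_expand_row fdet_expand_col)
  also have "(\<Sum>j<n. \<Sum>i<n. real j * (?A i j * ?C i j)) = (\<Sum>i<n. \<Sum>j<n. real j * (?A i j * ?C i j))"
    by (rule sum.swap)
  also have "(\<Sum>i<n. \<Sum>j<n. of_int (x i) * (?A i j * ?C i j)) + \<dots> = (\<Sum>i<n. \<Sum>j<n. (of_int (x i + int j) * ?A i j) * ?C i j)"
    by (simp add: sum.distrib[symmetric] ring_distribs mult.assoc)
  also have "\<dots> = (\<Sum>i<n. \<Sum>j<n. \<Sum>r\<in>seq_support t. real r * t r * (hpoly t (x i + int j - int r) * ?C i j))"
    unfolding hpoly_euler[OF fin] by (simp add: sum_distrib_right mult.assoc)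
  also have "\<dots> = (\<Sum>r\<in>seq_support t. \<Sum>i<n. \<Sum>j<n. real r * t r * (hpoly t (x i + int j - int r) * ?C i j))"
    by (rule sum_rotate3)
  also have "\<dots> = (\<Sum>r\<in>seq_support t. real r * t r * (\<Sum>i<n. \<Sum>j<n. hpoly t (x i + int j - int r) * ?C i j))"
    by (simp add: sum_distrib_left)
  also have "\<dots> = (\<Sum>r\<in>seq_support t. real r * t r * (\<Sum>i<n. sdet n t (x(i := x i - int r))))"
  proof (intro sum.cong refl arg_cong2[where f = "(*)"])
    fix r i assume "i \<in> {..<n}"
    hence "(\<Sum>j<n. hpoly t (x i + int j - int r) * ?C i j) = fdet n (\<lambda>k j. if k = i then hpoly t (x i + int j - int r) else ?A k j)"
      by (simp add: fdet_replace_row)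
    also have "\<dots> = sdet n t (x(i := x i - int r))"
      unfolding sdet_def by (intro fdet_cong) (auto simp: algebra_simps)
    finally show "(\<Sum>j<n. hpoly t (x i + int j - int r) * ?C i j) = sdet n t (x(i := x i - int r))" .
  qed
  finally show ?thesis .
qed

text \<open>The elements of the Maya diagram, counted from 0 and moved up by 1/2 so that positions
  are integers. For the empty partition the sites are 0, -1, -2 and so on.\<close>

definition site :: "nat list \<Rightarrow> nat \<Rightarrow> int" where
  "site \<mu> i = int (part \<mu> (Suc i)) - int i"

lemma site_beyond: "length \<mu> \<le> i \<Longrightarrow> site \<mu> i = - int i"
  by (simp add: site_def part_def)

lemma schur_eq_sdet_length: "schur \<mu> t = sdet (length \<mu>) t (site \<mu>)"
  by (simp add: schur_def sdet_def fdet_def site_def)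

text \<open>Rows beyond the length belong to empty parts and have the entries h_{j-i}: the lower
  left block vanishes and the lower right block is unitriangular. The number of rows is therefore
  free.\<close>

lemma sdet_site:
  assumes "length \<mu> \<le> n"
  shows "sdet n t (site \<mu>) = schur \<mu> t"
proof -
  have "fdet (n - length \<mu>) (\<lambda>i j. hpoly t (site \<mu> (length \<mu> + i) + int (length \<mu> + j))) = 1"
    by (rule fdet_upper_unitriangular) (auto simp: site_beyond)
  thus ?thesis unfolding schur_eq_sdet_length
    unfolding sdet_def using assms by (subst fdet_block[of "length \<mu>"]) (auto simp: site_beyond)
qed

lemma hpoly_convolution_int:
  "(\<Sum>m\<le>r. hpoly (\<lambda>r. - t r) (int m - int q) * hpoly t (int r - int m)) = (if r = q then 1 else 0)"
proof (cases "q \<le> r")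
  case True
  have "(\<Sum>m\<le>r. hpoly (\<lambda>r. - t r) (int m - int q) * hpoly t (int r - int m)) =
        (\<Sum>m\<in>{q..r}. hpoly (\<lambda>r. - t r) (int m - int q) * hpoly t (int r - int m))"
    by (rule sum.mono_neutral_right) auto
  also have "\<dots> = (\<Sum>i\<le>r - q. hpoly t (int i) * hpoly (\<lambda>r. - t r) (int (r - q - i)))"
    by (rule sum.reindex_bij_witness[of _ "\<lambda>i. r - i" "\<lambda>m. r - m"]) (use True in \<open>auto simp: of_nat_diff mult.commute\<close>)
  also have "\<dots> = (if r = q then 1 else 0)"
    using True by (subst hpoly_convolution) auto
  finally show ?thesis .
next
  case False
  thus ?thesis by (auto intro!: sum.neutral)
qed

text \<open>The sum is a trace: by Cramer's rule it pairs the matrix of h_{j-i+r} with the inverse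
  of the unitriangular Toeplitz matrix of h_{j-i}, whose entries are the coefficients g of 1/H.
  Summing along diagonals leaves the coefficient of z^r in n H (1/H) - z (1/H)' H. The first term
  contributes nothing for r \<ge> 1; the second equals z H'/H, with coefficient r t_r.\<close>

lemma ribbon_trace:
  assumes fin: "finite (seq_support t)" and "1 \<le> r" "r \<le> n"
  shows "(\<Sum>k<n. fdet n (\<lambda>i j. if j = k then hpoly t (int j - int i + int r) else hpoly t (int j - int i))) = real r * t r"
proof -
  define g where "g = hpoly (\<lambda>r. - t r)"
  let ?U = "\<lambda>i j. hpoly t (int j - int i)"
  have U1: "fdet n ?U = 1" by (rule fdet_upper_unitriangular) auto
  have inv: "(\<Sum>k<n. ?U i k * g (int j - int k)) = (if i = j then 1 else 0)" if "i < n" "j < n" for i j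
  proof -
    have "(\<Sum>k<n. ?U i k * g (int j - int k)) = (\<Sum>k\<le>j. ?U i k * g (int j - int k))"
      using that by (intro sum.mono_neutral_right) (auto simp: g_def)
    also have "\<dots> = (if i = j then 1 else 0)"
      using hpoly_convolution_int[of "\<lambda>r. - t r" i j] by (simp add: g_def)
    finally show ?thesis .
  qed
  have "(\<Sum>k<n. fdet n (\<lambda>i j. if j = k then hpoly t (int j - int i + int r) else ?U i j)) =
        (\<Sum>k<n. fdet n (\<lambda>i j. if j = k then hpoly t (int k - int i + int r) else ?U i j))"
    by (intro sum.cong fdet_cong) auto
  also have "\<dots> = (\<Sum>k<n. \<Sum>i<n. hpoly t (int k - int i + int r) * g (int i - int k))"
    using fcofactor_unique[of n ?U "\<lambda>k j. g (int j - int k)", OF inv] U1 by (simp add: fdet_replace_col)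
  also have "\<dots> = (\<Sum>k<n. \<Sum>m\<in>{..<n-k}. hpoly t (int r - int m) * g (int m))"
  proof (rule sum.cong[OF refl])
    fix k assume "k \<in> {..<n}"
    have "(\<Sum>i<n. hpoly t (int k - int i + int r) * g (int i - int k)) =
          (\<Sum>i\<in>{k..<n}. hpoly t (int k - int i + int r) * g (int i - int k))"
      by (rule sum.mono_neutral_right) (auto simp: g_def)
    also have "\<dots> = (\<Sum>m\<in>{..<n-k}. hpoly t (int r - int m) * g (int m))"
      by (rule sum.reindex_bij_witness[of _ "\<lambda>m. m + k" "\<lambda>i. i - k"]) (auto simp: of_nat_diff algebra_simps)
    finally show "(\<Sum>i<n. hpoly t (int k - int i + int r) * g (int i - int k)) = (\<Sum>m\<in>{..<n-k}. hpoly t (int r - int m) * g (int m))" .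
  qed
  also have "\<dots> = (\<Sum>k<n. \<Sum>m<n. if m < n - k then hpoly t (int r - int m) * g (int m) else 0)"
    by (intro sum.cong refl sum.mono_neutral_cong_left) auto
  also have "\<dots> = (\<Sum>m<n. \<Sum>k<n. if m < n - k then hpoly t (int r - int m) * g (int m) else 0)"
    by (rule sum.swap)
  also have "\<dots> = (\<Sum>m<n. (real n - real m) * (hpoly t (int r - int m) * g (int m)))"
  proof (rule sum.cong[OF refl])
    fix m assume "m \<in> {..<n}"
    have "(\<Sum>k<n. if m < n - k then hpoly t (int r - int m) * g (int m) else 0) = (\<Sum>k\<in>{..<n-m}. hpoly t (int r - int m) * g (int m))"
      by (rule sum.mono_neutral_cong_right) auto
    thus "(\<Sum>k<n. if m < n - k then hpoly t (int r - int m) * g (int m) else 0) = (real n - real m) * (hpoly t (int r - int m) * g (int m))"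
      using \<open>m \<in> {..<n}\<close> by (simp add: of_nat_diff)
  qed
  \<comment> \<open>The only index this can add is m = n = r, where the factor n - m is 0. The
    indices above r, dropped next, carry h of a negative index.\<close>
  also have "\<dots> = (\<Sum>m\<in>{..<n} \<union> {..r}. (real n - real m) * (hpoly t (int r - int m) * g (int m)))"
    by (rule sum.mono_neutral_left) (use assms in auto)
  also have "\<dots> = (\<Sum>m\<le>r. (real n - real m) * (hpoly t (int r - int m) * g (int m)))"
    by (rule sum.mono_neutral_right) (use assms in auto)
  also have "\<dots> = real n * (\<Sum>m\<le>r. g (int m) * hpoly t (int r - int m)) - (\<Sum>m\<le>r. hpoly t (int r - int m) * (real m * g (int m)))"
    by (simp add: sum_distrib_left sum_subtractf[symmetric] algebra_simps)
  also have "(\<Sum>m\<le>r. g (int m) * hpoly t (int r - int m)) = 0"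
    using hpoly_convolution_int[of t 0 r] assms by (simp add: g_def)
  also have "(\<Sum>m\<le>r. hpoly t (int r - int m) * (real m * g (int m))) = 
     (\<Sum>m\<le>r. \<Sum>q\<in>seq_support t. - (real q * t q) * (g (int m - int q) * hpoly t (int r - int m)))"
  proof (rule sum.cong[OF refl])
    fix m
    have "real m * g (int m) = (\<Sum>q\<in>seq_support t. - (real q * t q) * g (int m - int q))"
      using hpoly_euler[of "\<lambda>r. - t r" "int m"] fin by (simp add: g_def)
    thus "hpoly t (int r - int m) * (real m * g (int m)) = (\<Sum>q\<in>seq_support t. - (real q * t q) * (g (int m - int q) * hpoly t (int r - int m)))"
      by (simp add: sum_distrib_left algebra_simps)
  qed
  also have "\<dots> = (\<Sum>q\<in>seq_support t. - (real q * t q) * (\<Sum>m\<le>r. g (int m - int q) * hpoly t (int r - int m)))"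
    by (subst sum.swap) (simp add: sum_distrib_left)
  also have "\<dots> = (\<Sum>q\<in>seq_support t. if q = r then - (real r * t r) else 0)"
    unfolding g_def hpoly_convolution_int by (intro sum.cong) auto
  also have "\<dots> = - (real r * t r)"
    using fin assms by (auto simp: sum.delta seq_support_def)
  finally show ?thesis by simp
qed

text \<open>Multiplication by the power sum r t_r, with all ribbon additions and their signs
  collected in determinants. In terms of columns, raising column k by r reproduces column k + r, so
  every k below the length contributes 0; the other columns only affect the unitriangular block and
  give its trace. The assumption on n leaves room for a ribbon of r rows.\<close>

lemma sdet_add_ribbon:
  assumes fin: "finite (seq_support t)" and r: "1 \<le> r" and le: "length \<mu> + r \<le> n"
  shows "(\<Sum>i<n. sdet n t ((site \<mu>)(i := site \<mu> i + int r))) = real r * t r * schur \<mu> t"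
proof -
  define l where "l = length \<mu>"
  let ?h = "\<lambda>i j. hpoly t (site \<mu> i + int j)"
  let ?N = "\<lambda>i j. hpoly t (site \<mu> i + int j + int r)"
  let ?V = "\<lambda>k i j. if j = k then hpoly t (int j - int i + int r) else hpoly t (int j - int i)"
  have "(\<Sum>i<n. sdet n t ((site \<mu>)(i := site \<mu> i + int r))) =
        (\<Sum>i<n. fdet n (\<lambda>k j. if k = i then ?N i j else ?h k j))"
    unfolding sdet_def by (intro sum.cong fdet_cong refl) (auto simp: algebra_simps)
  also have "\<dots> = (\<Sum>k<n. fdet n (\<lambda>i j. if j = k then ?N i k else ?h i j))"
    by (rule fdet_replace_rows_eq_cols)
  also have "\<dots> = (\<Sum>k\<in>{l..<n}. fdet n (\<lambda>i j. if j = k then ?N i k else ?h i j))"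
  proof (rule sum.mono_neutral_right)
    show "\<forall>k\<in>{..<n} - {l..<n}. fdet n (\<lambda>i j. if j = k then ?N i k else ?h i j) = 0"
    proof
      fix k assume k: "k \<in> {..<n} - {l..<n}"
      show "fdet n (\<lambda>i j. if j = k then ?N i k else ?h i j) = 0"
        by (rule fdet_identical_cols[of k "k + r"]) (use k r le in \<open>auto simp: l_def algebra_simps\<close>)
    qed
  qed auto
  also have "\<dots> = (\<Sum>k\<in>{l..<n}. schur \<mu> t * fdet (n - l) (?V (k - l)))"
  proof (intro sum.cong refl)
    fix k assume k: "k \<in> {l..<n}"
    have "fdet n (\<lambda>i j. if j = k then ?N i k else ?h i j) =
       fdet l (\<lambda>i j. if j = k then ?N i k else ?h i j) *
       fdet (n - l) (\<lambda>i j. if l + j = k then ?N (l + i) k else ?h (l + i) (l + j))"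
      by (rule fdet_block) (use k in \<open>auto simp: l_def site_beyond\<close>)
    also have "fdet l (\<lambda>i j. if j = k then ?N i k else ?h i j) = schur \<mu> t"
      unfolding schur_eq_sdet_length sdet_def l_def by (rule fdet_cong) (use k in \<open>auto simp: l_def\<close>)
    also have "fdet (n - l) (\<lambda>i j. if l + j = k then ?N (l + i) k else ?h (l + i) (l + j)) = fdet (n - l) (?V (k - l))"
      by (rule fdet_cong) (use k in \<open>auto simp: l_def site_beyond of_nat_diff algebra_simps\<close>)
    finally show "fdet n (\<lambda>i j. if j = k then ?N i k else ?h i j) = schur \<mu> t * fdet (n - l) (?V (k - l))" .
  qed
  also have "\<dots> = (\<Sum>k<n-l. schur \<mu> t * fdet (n - l) (?V k))"
    by (rule sum.reindex_bij_witness[of _ "\<lambda>k. k + l" "\<lambda>k. k - l"]) auto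
  also have "\<dots> = schur \<mu> t * (real r * t r)"
    unfolding sum_distrib_left[symmetric] using ribbon_trace[OF fin r, of "n - l"] le by (simp add: l_def)
  finally show ?thesis by simp
qed

section \<open>Partitions as finite sets of sites\<close>

lemma part_antimono:
  assumes "\<mu> \<in> partitions" "1 \<le> i" "i \<le> k"
  shows "part \<mu> k \<le> part \<mu> i"
proof (cases "i = k \<or> k > length \<mu>")
  case False
  hence "\<mu> ! (k - 1) \<le> \<mu> ! (i - 1)"
    using assms sorted_wrt_nth_less[of "(\<ge>)" \<mu> "i - 1" "k - 1"] by (auto simp: partitions_def)
  thus ?thesis using False assms by (auto simp: part_def)
qed (auto simp: part_def)

lemma site_strict_antimono: "\<mu> \<in> partitions \<Longrightarrow> i < k \<Longrightarrow> site \<mu> k < site \<mu> i"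
  using part_antimono[of \<mu> "Suc i" "Suc k"] by (simp add: site_def)

lemma inj_site: "\<mu> \<in> partitions \<Longrightarrow> inj_on (site \<mu>) A"
  by (metis inj_onI less_irrefl linorder_neqE_nat site_strict_antimono)

lemma part_pos_iff: "\<mu> \<in> partitions \<Longrightarrow> part \<mu> (Suc i) > 0 \<longleftrightarrow> i < length \<mu>"
  by (auto simp: part_def partitions_def)

lemma partition_eqI:
  assumes "\<mu> \<in> partitions" "\<nu> \<in> partitions" "\<And>i. part \<mu> (Suc i) = part \<nu> (Suc i)"
  shows "\<mu> = \<nu>"
proof (rule nth_equalityI)
  have "i < length \<mu> \<longleftrightarrow> i < length \<nu>" for i
    using part_pos_iff[OF assms(1), of i] part_pos_iff[OF assms(2), of i] assms(3) by simp
  thus l: "length \<mu> = length \<nu>" by (meson linorder_neqE_nat less_irrefl)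
  show "\<mu> ! i = \<nu> ! i" if "i < length \<mu>" for i
    using assms(3)[of i] that l by (simp add: part_def)
qed

lemma site_image_inj:
  assumes mu: "\<mu> \<in> partitions" "length \<mu> \<le> n" and nu: "\<nu> \<in> partitions" "length \<nu> \<le> n"
    and eq: "site \<mu> ` {..<n} = site \<nu> ` {..<n}"
  shows "\<mu> = \<nu>"
proof -
  have sorted: "sorted_wrt (<) (rev (map (site \<kappa>) [0..<n]))" if "\<kappa> \<in> partitions" for \<kappa>
    by (auto simp: sorted_wrt_iff_nth_less rev_nth intro!: site_strict_antimono[OF that])
  have "rev (map (site \<nu>) [0..<n]) = rev (map (site \<mu>) [0..<n])"
    by (rule strict_sorted_equal[OF sorted sorted]) (use mu nu eq in \<open>auto simp: atLeast0LessThan\<close>)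
  hence site: "site \<mu> i = site \<nu> i" if "i < n" for i using that by simp
  show ?thesis
  proof (rule partition_eqI[OF mu(1) nu(1)])
    fix i show "part \<mu> (Suc i) = part \<nu> (Suc i)"
    proof (cases "i < n")
      case True thus ?thesis using site[of i] by (simp add: site_def)
    next
      case False thus ?thesis using mu nu by (simp add: part_def)
    qed
  qed
qed

text \<open>Sort the set decreasingly and add i to the i-th entry. Strict decrease of integers makes
  the result weakly decreasing, and the bound 1 - n, the site of an empty n-th part, makes it
  nonnegative.\<close>

lemma exists_partition_sites:
  assumes S: "finite S" "card S = n" "S \<subseteq> {1 - int n..}"
  shows "\<exists>\<mu>\<in>partitions. length \<mu> \<le> n \<and> site \<mu> ` {..<n} = S"
proof -
  define xs where "xs = rev (sorted_list_of_set S)"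
  have len: "length xs = n" and set: "set xs = S" using S by (auto simp: xs_def)
  have dec: "xs ! k < xs ! i" if "i < k" "k < n" for i k
  proof -
    have "sorted_wrt (>) xs" unfolding xs_def sorted_wrt_rev by simp
    thus ?thesis using sorted_wrt_nth_less[of "(>)" xs i k] that len by simp
  qed
  have gap: "xs ! (i + d) + int d \<le> xs ! i" if "i + d < n" for i d
    using that
  proof (induction d)
    case (Suc d)
    have "xs ! (i + Suc d) < xs ! (i + d)" using Suc by (intro dec) auto
    with Suc show ?case by simp
  qed simp
  define f where "f i = nat (xs ! i + int i)" for i
  have nonneg: "xs ! i + int i \<ge> 0" if "i < n" for i
  proof -
    have "xs ! (n - 1) \<in> S" using that len set nth_mem[of "n - 1" xs] by auto
    hence "xs ! (n - 1) \<ge> 1 - int n" using S by auto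
    with gap[of i "n - 1 - i"] that show ?thesis by (simp add: of_nat_diff)
  qed
  have fanti: "f k \<le> f i" if "i \<le> k" "k < n" for i k
    using gap[of i "k - i"] that unfolding f_def by (intro nat_mono) (simp add: of_nat_diff)
  define l where "l = card {i. i < n \<and> f i > 0}"
  have l_le: "l \<le> n" unfolding l_def using card_mono[of "{..<n}" "{i. i < n \<and> f i > 0}"] by auto
  have pos_iff: "f i > 0 \<longleftrightarrow> i < l" if "i < n" for i
  proof
    assume "f i > 0"
    hence "{..i} \<subseteq> {i. i < n \<and> f i > 0}"
      using fanti that by (force intro: less_le_trans)
    hence "card {..i} \<le> l" unfolding l_def by (intro card_mono) auto
    thus "i < l" by simp
  next
    assume "i < l"
    show "f i > 0"
    proof (rule ccontr)
      assume "\<not> f i > 0"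
      hence "{i. i < n \<and> f i > 0} \<subseteq> {..<i}"
        using fanti that by (metis (no_types, lifting) bot_nat_0.not_eq_extremum le_zero_eq lessThan_iff linorder_not_le mem_Collect_eq subsetI)
      hence "l \<le> card {..<i}" unfolding l_def by (intro card_mono) auto
      with \<open>i < l\<close> show False by simp
    qed
  qed
  define \<mu> where "\<mu> = map f [0..<l]"
  have mu1: "\<mu> \<in> partitions"
    unfolding partitions_def \<mu>_def using pos_iff l_le fanti
    by (auto simp: sorted_wrt_iff_nth_less)
  have mu2: "length \<mu> \<le> n" using l_le by (simp add: \<mu>_def)
  have "site \<mu> i = xs ! i" if "i < n" for i
  proof (cases "i < l")
    case True
    thus ?thesis using nonneg[OF that] by (simp add: site_def part_def \<mu>_def f_def)
  next
    case False
    hence "f i = 0" using pos_iff[OF that] by simp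
    thus ?thesis using False nonneg[OF that] by (simp add: site_def part_def \<mu>_def f_def)
  qed
  hence "site \<mu> ` {..<n} = (!) xs ` {..<n}" by (intro image_cong) auto
  also have "\<dots> = S" by (auto simp: set_conv_nth len[symmetric] set[symmetric])
  finally show ?thesis using mu1 mu2 by blast
qed

text \<open>A partition with at most n parts is a set of n sites, hence n! injective tuples. Tuples
  are the convenient index set because a single coordinate can be shifted, or summed over,
  independently of the others.\<close>

lemma sum_tuples_eq_sum_partitions:
  fixes F :: "(nat \<Rightarrow> int) \<Rightarrow> real"
  assumes perm: "\<And>p x. p permutes {0..<n} \<Longrightarrow> F (x \<circ> p) = F x"
    and noninj: "\<And>x. \<not> inj_on x {..<n} \<Longrightarrow> F x = 0"
    and cong: "\<And>x y. (\<And>i. i < n \<Longrightarrow> x i = y i) \<Longrightarrow> F x = F y"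
    and A: "finite A" "A \<subseteq> {1 - int n..}"
  shows "(\<Sum>x\<in>PiE {..<n} (\<lambda>_. A). F x) =
    fact n * (\<Sum>\<mu> | \<mu> \<in> partitions \<and> length \<mu> \<le> n \<and> site \<mu> ` {..<n} \<subseteq> A. F (site \<mu>))"
proof -
  let ?P = "{\<mu>. \<mu> \<in> partitions \<and> length \<mu> \<le> n \<and> site \<mu> ` {..<n} \<subseteq> A}"
  let ?S = "{p. p permutes {0..<n}}"
  let ?T = "{x \<in> PiE {..<n} (\<lambda>_. A). inj_on x {..<n}}"
  define \<Psi> where "\<Psi> = (\<lambda>(\<mu>, p). restrict (site \<mu> \<circ> p) {..<n})"
  have pimg: "p ` {..<n} = {..<n}" if "p \<in> ?S" for p
    using permutes_image[of p "{0..<n}"] that by (simp add: atLeast0LessThan)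
  have bij: "bij_betw \<Psi> (?P \<times> ?S) ?T"
    unfolding bij_betw_def
  proof
    show "inj_on \<Psi> (?P \<times> ?S)"
    proof (rule inj_onI, clarify)
      fix \<mu> p \<nu> q
      assume h: "\<mu> \<in> partitions" "length \<mu> \<le> n" "\<nu> \<in> partitions" "length \<nu> \<le> n"
         "p permutes {0..<n}" "q permutes {0..<n}" and eq: "\<Psi> (\<mu>, p) = \<Psi> (\<nu>, q)"
      have eq': "site \<mu> (p i) = site \<nu> (q i)" if "i < n" for i
        using fun_cong[OF eq, of i] that by (simp add: \<Psi>_def)
      hence "(\<lambda>i. site \<mu> (p i)) ` {..<n} = (\<lambda>i. site \<nu> (q i)) ` {..<n}" by (intro image_cong) auto
      hence "site \<mu> ` (p ` {..<n}) = site \<nu> ` (q ` {..<n})" by (simp only: image_image)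
      hence "\<mu> = \<nu>" using h pimg by (intro site_image_inj[of \<mu> n \<nu>]) auto
      moreover have "p i = q i" for i
      proof (cases "i < n")
        case True
        thus ?thesis using eq'[OF True] \<open>\<mu> = \<nu>\<close> inj_site[OF h(1), of UNIV] by (simp add: inj_eq)
      next
        case False
        thus ?thesis using h(5,6) by (simp add: permutes_def)
      qed
      ultimately show "\<mu> = \<nu> \<and> p = q" by auto
    qed
    show "\<Psi> ` (?P \<times> ?S) = ?T"
    proof (intro equalityI subsetI)
      fix x assume "x \<in> \<Psi> ` (?P \<times> ?S)"
      then obtain \<mu> p where h: "\<mu> \<in> ?P" "p \<in> ?S" "x = restrict (site \<mu> \<circ> p) {..<n}" by (auto simp: \<Psi>_def)
      have "site \<mu> (p i) \<in> A" if "i < n" for i using h pimg[of p] that by blast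
      moreover have "inj_on x {..<n}"
        using h inj_site[of \<mu> UNIV] permutes_inj[of p "{0..<n}"] by (auto simp: inj_on_def)
      ultimately show "x \<in> ?T" using h by auto
    next
      fix x assume x: "x \<in> ?T"
      have "\<exists>\<mu>\<in>partitions. length \<mu> \<le> n \<and> site \<mu> ` {..<n} = x ` {..<n}"
        by (rule exists_partition_sites) (use x A in \<open>auto simp: card_image\<close>)
      then obtain \<mu> where mu: "\<mu> \<in> partitions" "length \<mu> \<le> n" "site \<mu> ` {..<n} = x ` {..<n}" by blast
      define p where "p i = (if i < n then inv_into {..<n} (site \<mu>) (x i) else i)" for i
      have site_p: "site \<mu> (p i) = x i" "p i < n" if "i < n" for i
      proof -
        have "x i \<in> site \<mu> ` {..<n}" using mu that by auto
        thus "site \<mu> (p i) = x i" "p i < n"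
          using that f_inv_into_f[of "x i" "site \<mu>" "{..<n}"] inv_into_into[of "x i" "site \<mu>" "{..<n}"] by (auto simp: p_def)
      qed
      have inj: "inj_on p {0..<n}"
      proof (rule inj_onI)
        fix i k assume h: "i \<in> {0..<n}" "k \<in> {0..<n}" "p i = p k"
        have "x i = x k" using site_p(1)[of i] site_p(1)[of k] h by simp
        thus "i = k" using x h by (auto simp: inj_on_def)
      qed
      have "p ` {0..<n} \<subseteq> {0..<n}" using site_p(2) by auto
      hence "p ` {0..<n} = {0..<n}" using endo_inj_surj[of "{0..<n}" p] inj by simp
      hence p: "p permutes {0..<n}"
        using inj by (intro bij_imp_permutes) (simp_all add: bij_betw_def p_def)
      have "x = \<Psi> (\<mu>, p)"
        unfolding \<Psi>_def using x site_p(1) by (auto simp: fun_eq_iff PiE_def extensional_def)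
      moreover have "(\<mu>, p) \<in> ?P \<times> ?S" using mu x p by auto
      ultimately show "x \<in> \<Psi> ` (?P \<times> ?S)" by (rule image_eqI)
    qed
  qed
  have "(\<Sum>x\<in>PiE {..<n} (\<lambda>_. A). F x) = (\<Sum>x\<in>?T. F x)"
    by (rule sum.mono_neutral_right) (use A noninj in \<open>auto intro!: finite_PiE\<close>)
  also have "\<dots> = (\<Sum>y\<in>?P \<times> ?S. F (\<Psi> y))"
    by (rule sum.reindex_bij_betw[OF bij, symmetric])
  also have "\<dots> = (\<Sum>(\<mu>, p)\<in>?P \<times> ?S. F (site \<mu>))"
  proof (intro sum.cong refl, clarify)
    fix \<mu> p assume "p permutes {0..<n}"
    have "F (\<Psi> (\<mu>, p)) = F (site \<mu> \<circ> p)" by (rule cong) (simp add: \<Psi>_def)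
    thus "F (\<Psi> (\<mu>, p)) = F (site \<mu>)" using perm[OF \<open>p permutes {0..<n}\<close>] by simp
  qed
  also have "\<dots> = (\<Sum>\<mu>\<in>?P. real (card ?S) * F (site \<mu>))"
    unfolding sum.cartesian_product[symmetric] by simp
  also have "card ?S = fact n" by (rule card_permutations) auto
  finally show ?thesis by (simp add: sum_distrib_left)
qed

section \<open>Sums graded by the size of the partition\<close>

lemma sum_part: "length \<mu> \<le> n \<Longrightarrow> (\<Sum>i<n. part \<mu> (Suc i)) = sum_list \<mu>"
proof -
  assume "length \<mu> \<le> n"
  hence "(\<Sum>i<n. part \<mu> (Suc i)) = (\<Sum>i<length \<mu>. part \<mu> (Suc i))"
    by (intro sum.mono_neutral_right) (auto simp: part_def)
  thus ?thesis by (simp add: sum_list_sum_nth part_def atLeast0LessThan)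
qed

definition tuple_degree :: "nat \<Rightarrow> (nat \<Rightarrow> int) \<Rightarrow> int" where
  "tuple_degree n x = (\<Sum>i<n. x i) + (\<Sum>j<n. int j)"

lemma tuple_degree_site: "length \<mu> \<le> n \<Longrightarrow> tuple_degree n (site \<mu>) = int (sum_list \<mu>)"
  by (simp add: tuple_degree_def site_def sum_subtractf flip: sum_part)

lemma tuple_degree_cong: "(\<And>i. i < n \<Longrightarrow> x i = y i) \<Longrightarrow> tuple_degree n x = tuple_degree n y"
  by (simp add: tuple_degree_def)

lemma tuple_degree_permute:
  assumes "p permutes {0..<n}"
  shows "tuple_degree n (x \<circ> p) = tuple_degree n x"
  using sum.permute[OF assms, of x] by (simp add: tuple_degree_def atLeast0LessThan)

lemma tuple_degree_update: "i < n \<Longrightarrow> tuple_degree n (x(i := x i + c)) = tuple_degree n x + c"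
proof -
  assume "i < n"
  hence "(\<Sum>k<n. (x(i := x i + c)) k) = (\<Sum>k<n. x k + (if k = i then c else 0))"
    by (intro sum.cong) auto
  thus ?thesis using \<open>i < n\<close> by (simp add: tuple_degree_def sum.distrib)
qed

definition degree_tuples :: "nat \<Rightarrow> int \<Rightarrow> (nat \<Rightarrow> int) set" where
  "degree_tuples n d = {x \<in> PiE {..<n} (\<lambda>_. {1 - int n..}). tuple_degree n x = d}"

text \<open>The other n - 1 coordinates are at least 1 - n and the degree is fixed, so no coordinate
  can be large. The bound is crude; its purpose is finiteness.\<close>

lemma degree_tuples_bound:
  assumes "x \<in> degree_tuples n d" "i < n"
  shows "x i \<le> d + int n * int n"
proof -
  have "(\<Sum>k\<in>{..<n} - {i}. 1 - int n) \<le> (\<Sum>k\<in>{..<n} - {i}. x k)"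
    using assms by (intro sum_mono) (auto simp: degree_tuples_def PiE_def Pi_def)
  moreover have "(\<Sum>k<n. x k) = x i + (\<Sum>k\<in>{..<n} - {i}. x k)"
    using assms by (intro sum.remove) auto
  moreover have "(\<Sum>j<n. int j) \<ge> 0" by (intro sum_nonneg) auto
  moreover have "(\<Sum>k\<in>{..<n} - {i}. 1 - int n) = (int n - 1) * (1 - int n)"
    using assms by (simp add: of_nat_diff)
  moreover have "(int n - 1) * (1 - int n) \<ge> - (int n * int n)"
    using assms by (simp add: algebra_simps)
  ultimately show ?thesis using assms by (auto simp: degree_tuples_def tuple_degree_def)
qed

lemma degree_tuples_subset:
  "degree_tuples n d \<subseteq> PiE {..<n} (\<lambda>_. {1 - int n..d + int n * int n})"
  using degree_tuples_bound[of _ n d] by (auto simp: degree_tuples_def PiE_def Pi_def)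

lemma finite_degree_tuples [simp]: "finite (degree_tuples n d)"
  by (rule finite_subset[OF degree_tuples_subset]) (auto intro!: finite_PiE)

lemma sum_degree_tuples:
  fixes F :: "(nat \<Rightarrow> int) \<Rightarrow> real"
  assumes perm: "\<And>p x. p permutes {0..<n} \<Longrightarrow> F (x \<circ> p) = F x"
    and noninj: "\<And>x. \<not> inj_on x {..<n} \<Longrightarrow> F x = 0"
    and cong: "\<And>x y. (\<And>i. i < n \<Longrightarrow> x i = y i) \<Longrightarrow> F x = F y"
  shows "(\<Sum>x\<in>degree_tuples n d. F x) =
    fact n * (\<Sum>\<mu> | \<mu> \<in> partitions \<and> length \<mu> \<le> n \<and> int (sum_list \<mu>) = d. F (site \<mu>))"
proof -
  define A where "A = {1 - int n..d + int n * int n}"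
  \<comment> \<open>Moving the degree condition into the summand keeps it invariant under
    permutations, so the version for boxes of tuples applies.\<close>
  define G where "G x = (if tuple_degree n x = d then F x else 0)" for x
  have site: "site \<mu> ` {..<n} \<subseteq> A" if "\<mu> \<in> partitions" "length \<mu> \<le> n" "int (sum_list \<mu>) = d" for \<mu>
  proof -
    have "restrict (site \<mu>) {..<n} \<in> degree_tuples n d"
      using that tuple_degree_site[of \<mu> n] tuple_degree_cong[of n "restrict (site \<mu>) {..<n}" "site \<mu>"]
      by (auto simp: degree_tuples_def site_def)
    hence "restrict (site \<mu>) {..<n} \<in> PiE {..<n} (\<lambda>_. A)" using degree_tuples_subset unfolding A_def by blast
    thus ?thesis by (auto simp: PiE_def Pi_def)
  qed
  have "(\<Sum>x\<in>degree_tuples n d. F x) = (\<Sum>x\<in>PiE {..<n} (\<lambda>_. A). G x)"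
  proof (rule sum.mono_neutral_cong_left)
    show "finite (PiE {..<n} (\<lambda>_. A))" by (intro finite_PiE) (auto simp: A_def)
    show "degree_tuples n d \<subseteq> PiE {..<n} (\<lambda>_. A)" unfolding A_def by (rule degree_tuples_subset)
  qed (auto simp: G_def degree_tuples_def A_def PiE_def Pi_def)
  also have "\<dots> = fact n * (\<Sum>\<mu> | \<mu> \<in> partitions \<and> length \<mu> \<le> n \<and> site \<mu> ` {..<n} \<subseteq> A. G (site \<mu>))"
  proof (rule sum_tuples_eq_sum_partitions)
    show "G (x \<circ> p) = G x" if "p permutes {0..<n}" for p x
      using that by (simp add: G_def tuple_degree_permute perm)
    show "G x = 0" if "\<not> inj_on x {..<n}" for x using noninj[OF that] by (simp add: G_def)
    show "G x = G y" if "\<And>i. i < n \<Longrightarrow> x i = y i" for x y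
      using cong[OF that] tuple_degree_cong[OF that] by (simp add: G_def)
  qed (auto simp: A_def)
  also have "(\<Sum>\<mu> | \<mu> \<in> partitions \<and> length \<mu> \<le> n \<and> site \<mu> ` {..<n} \<subseteq> A. G (site \<mu>)) =
     (\<Sum>\<mu> | \<mu> \<in> partitions \<and> length \<mu> \<le> n \<and> int (sum_list \<mu>) = d. F (site \<mu>))"
  proof (rule sum.mono_neutral_cong_right)
    show "finite {\<mu>. \<mu> \<in> partitions \<and> length \<mu> \<le> n \<and> site \<mu> ` {..<n} \<subseteq> A}"
    proof (rule finite_subset)
      show "{\<mu>. \<mu> \<in> partitions \<and> length \<mu> \<le> n \<and> site \<mu> ` {..<n} \<subseteq> A} \<subseteq>
        {xs. set xs \<subseteq> {..nat (d + int n * int n + int n)} \<and> length xs \<le> n}"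
      proof safe
        fix \<mu> k assume h: "length \<mu> \<le> n" "site \<mu> ` {..<n} \<subseteq> A" "k \<in> set \<mu>"
        then obtain i where i: "i < length \<mu>" "k = \<mu> ! i" by (auto simp: in_set_conv_nth)
        hence "site \<mu> i \<in> A" using h by auto
        thus "k \<le> nat (d + int n * int n + int n)" using i h by (simp add: site_def part_def A_def)
      qed
      show "finite {xs. set xs \<subseteq> {..nat (d + int n * int n + int n)} \<and> length xs \<le> n}"
        by (rule finite_lists_length_le) simp
    qed
    show "{\<mu>. \<mu> \<in> partitions \<and> length \<mu> \<le> n \<and> int (sum_list \<mu>) = d} \<subseteq> {\<mu>. \<mu> \<in> partitions \<and> length \<mu> \<le> n \<and> site \<mu> ` {..<n} \<subseteq> A}"
      using site by blast
  qed (auto simp: G_def tuple_degree_site)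
  finally show ?thesis .
qed

lemma length_le_sum_list:
  assumes "\<mu> \<in> partitions"
  shows "length \<mu> \<le> sum_list \<mu>"
proof -
  have "\<forall>k\<in>set \<mu>. 0 < k \<Longrightarrow> length \<mu> \<le> sum_list \<mu>"
    by (induction \<mu>) auto
  thus ?thesis using assms by (simp add: partitions_def)
qed

lemma finite_partitions_of: "finite {\<mu> \<in> partitions. int (sum_list \<mu>) = d}"
proof (rule finite_subset)
  show "{\<mu> \<in> partitions. int (sum_list \<mu>) = d} \<subseteq> {xs. set xs \<subseteq> {..nat d} \<and> length xs \<le> nat d}"
    using length_le_sum_list by (auto simp: elem_le_sum_list member_le_sum_list)
qed (rule finite_lists_length_le, simp)

definition schur_square_sum :: "(nat \<Rightarrow> real) \<Rightarrow> int \<Rightarrow> real" where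
  "schur_square_sum t d = (\<Sum>\<mu> | \<mu> \<in> partitions \<and> int (sum_list \<mu>) = d. (schur \<mu> t)\<^sup>2)"

lemma signof_square: "(signof p :: real) * signof p = 1"
  by (simp add: sign_def)

text \<open>Euler's identity writes d s as the sum of r t_r times the determinants with one row
  lowered by r. Taking the lowered tuple as the new variable moves the shift to the other factor,
  where it is a raise by r and sums up to r t_r s by \<open>sdet_add_ribbon\<close>. Each r thus
  contributes (r t_r)^2.\<close>

lemma schur_square_sum_rec:
  assumes fin: "finite (seq_support t)" and d: "d \<ge> 0"
  shows "of_int d * schur_square_sum t d = (\<Sum>r\<in>seq_support t. (real r * t r)\<^sup>2 * schur_square_sum t (d - int r))"
proof -
  \<comment> \<open>With d rows every partition of size at most d fits, and one of size d - r has
    length at most n - r, the room that \<open>sdet_add_ribbon\<close> asks for.\<close>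
  define n where "n = nat d"
  have n: "int n = d" using d by (simp add: n_def)
  have parts: "{\<mu>. \<mu> \<in> partitions \<and> length \<mu> \<le> n \<and> int (sum_list \<mu>) = e} = {\<mu>. \<mu> \<in> partitions \<and> int (sum_list \<mu>) = e}" if "e \<le> d" for e
    using length_le_sum_list n that by fastforce
  have "fact n * schur_square_sum t d = (\<Sum>x\<in>degree_tuples n d. (sdet n t x)\<^sup>2)"
  proof (subst sum_degree_tuples)
    show "(sdet n t (x \<circ> p))\<^sup>2 = (sdet n t x)\<^sup>2" if "p permutes {0..<n}" for p x
      using signof_square[of p] by (simp add: sdet_permute[OF that] power_mult_distrib power2_eq_square[of "signof p"])
    show "(sdet n t x)\<^sup>2 = (sdet n t y)\<^sup>2" if "\<And>i. i < n \<Longrightarrow> x i = y i" for x y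
      using sdet_cong[OF that] by simp
    show "fact n * schur_square_sum t d = fact n *
        (\<Sum>\<mu> | \<mu> \<in> partitions \<and> length \<mu> \<le> n \<and> int (sum_list \<mu>) = d. (sdet n t (site \<mu>))\<^sup>2)"
      unfolding schur_square_sum_def parts[OF order_refl, symmetric]
      by (simp add: sdet_site cong: sum.cong_simp)
  qed (auto simp: sdet_not_inj)
  hence "of_int d * (fact n * schur_square_sum t d) = of_int d * (\<Sum>x\<in>degree_tuples n d. (sdet n t x)\<^sup>2)"
    by simp
  hence "fact n * (of_int d * schur_square_sum t d) = (\<Sum>x\<in>degree_tuples n d. (of_int d * sdet n t x) * sdet n t x)"
    by (simp add: sum_distrib_left power2_eq_square mult_ac)
  also have "\<dots> = (\<Sum>x\<in>degree_tuples n d. \<Sum>r\<in>seq_support t. real r * t r * (\<Sum>i<n. sdet n t (x(i := x i - int r)) * sdet n t x))"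
  proof (rule sum.cong[OF refl])
    fix x assume "x \<in> degree_tuples n d"
    hence "of_int d * sdet n t x = (\<Sum>r\<in>seq_support t. real r * t r * (\<Sum>i<n. sdet n t (x(i := x i - int r))))"
      using sdet_euler[OF fin, of x n] by (simp add: degree_tuples_def tuple_degree_def)
    thus "of_int d * sdet n t x * sdet n t x = (\<Sum>r\<in>seq_support t. real r * t r * (\<Sum>i<n. sdet n t (x(i := x i - int r)) * sdet n t x))"
      by (simp add: sum_distrib_right mult.assoc)
  qed
  also have "\<dots> = (\<Sum>r\<in>seq_support t. real r * t r * (\<Sum>i<n. \<Sum>x\<in>degree_tuples n d. sdet n t (x(i := x i - int r)) * sdet n t x))"
    by (subst sum.swap, rule sum.cong[OF refl], subst sum.swap) (simp add: sum_distrib_left)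
  also have "\<dots> = (\<Sum>r\<in>seq_support t. real r * t r * (\<Sum>i<n. \<Sum>y\<in>degree_tuples n (d - int r). sdet n t y * sdet n t (y(i := y i + int r))))"
  proof (rule sum.cong[OF refl], rule arg_cong2[where f = "(*)"], rule refl, rule sum.cong[OF refl])
    fix r i assume i: "i \<in> {..<n}"
    have deg: "tuple_degree n (x(i := x i - int r)) = tuple_degree n x - int r"
         "tuple_degree n (x(i := x i + int r)) = tuple_degree n x + int r" for x
      using tuple_degree_update[of i n x "- int r"] tuple_degree_update[of i n x "int r"] i by auto
    \<comment> \<open>Lowering may leave the range of tuples; then a whole row of the determinant is
      zero.\<close>
    have "(\<Sum>x\<in>degree_tuples n d. sdet n t (x(i := x i - int r)) * sdet n t x) =
          (\<Sum>x\<in>{x. x \<in> degree_tuples n d \<and> x i - int r \<ge> 1 - int n}. sdet n t (x(i := x i - int r)) * sdet n t x)"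
    proof (rule sum.mono_neutral_right)
      show "\<forall>x\<in>degree_tuples n d - {x. x \<in> degree_tuples n d \<and> x i - int r \<ge> 1 - int n}.
          sdet n t (x(i := x i - int r)) * sdet n t x = 0"
      proof
        fix x assume "x \<in> degree_tuples n d - {x. x \<in> degree_tuples n d \<and> x i - int r \<ge> 1 - int n}"
        hence "sdet n t (x(i := x i - int r)) = 0" using i by (intro sdet_zero[of i]) auto
        thus "sdet n t (x(i := x i - int r)) * sdet n t x = 0" by simp
      qed
    qed auto
    also have "\<dots> = (\<Sum>y\<in>degree_tuples n (d - int r). sdet n t y * sdet n t (y(i := y i + int r)))"
      by (rule sum.reindex_bij_witness[of _ "\<lambda>y. y(i := y i + int r)" "\<lambda>x. x(i := x i - int r)"])
         (use i deg in \<open>auto simp: degree_tuples_def PiE_def Pi_def extensional_def\<close>)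
    finally show "(\<Sum>x\<in>degree_tuples n d. sdet n t (x(i := x i - int r)) * sdet n t x) =
       (\<Sum>y\<in>degree_tuples n (d - int r). sdet n t y * sdet n t (y(i := y i + int r)))" .
  qed
  also have "\<dots> = (\<Sum>r\<in>seq_support t. real r * t r * (\<Sum>y\<in>degree_tuples n (d - int r). sdet n t y * (\<Sum>i<n. sdet n t (y(i := y i + int r)))))"
    by (subst sum.swap) (simp add: sum_distrib_left)
  also have "\<dots> = (\<Sum>r\<in>seq_support t. real r * t r * (fact n * (real r * t r * schur_square_sum t (d - int r))))"
  proof (rule sum.cong[OF refl], rule arg_cong2[where f = "(*)"], rule refl)
    fix r assume "r \<in> seq_support t"
    hence r: "1 \<le> r" by (auto simp: seq_support_def)
    let ?F = "\<lambda>y. sdet n t y * (\<Sum>i<n. sdet n t (y(i := y i + int r)))"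
    have "(\<Sum>y\<in>degree_tuples n (d - int r). ?F y) =
      fact n * (\<Sum>\<mu> | \<mu> \<in> partitions \<and> length \<mu> \<le> n \<and> int (sum_list \<mu>) = d - int r. ?F (site \<mu>))"
    proof (rule sum_degree_tuples)
      show "?F (x \<circ> p) = ?F x" if p: "p permutes {0..<n}" for p x
      proof -
        \<comment> \<open>Raising coordinate i after permuting amounts to raising coordinate p i
          before. The sign of p then occurs in both factors and cancels.\<close>
        have "(x \<circ> p)(i := (x \<circ> p) i + int r) = x(p i := x (p i) + int r) \<circ> p" for i
          using permutes_inj[OF p] by (auto simp: fun_eq_iff inj_eq)
        hence "(\<Sum>i<n. sdet n t ((x \<circ> p)(i := (x \<circ> p) i + int r))) = signof p * (\<Sum>i<n. sdet n t (x(p i := x (p i) + int r)))"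
          by (simp only: sdet_permute[OF p] sum_distrib_left)
        also have "(\<Sum>i<n. sdet n t (x(p i := x (p i) + int r))) = (\<Sum>i<n. sdet n t (x(i := x i + int r)))"
          using sum.permute[OF p, of "\<lambda>i. sdet n t (x(i := x i + int r))"] by (simp add: atLeast0LessThan comp_def)
        finally have "?F (x \<circ> p) = (signof p * signof p) * ?F x"
          by (simp only: sdet_permute[OF p] mult_ac)
        thus ?thesis by (simp only: signof_square mult_1)
      qed
      show "?F x = ?F y" if "\<And>i. i < n \<Longrightarrow> x i = y i" for x y
        using that by (intro arg_cong2[where f = "(*)"] sum.cong sdet_cong refl) auto
    qed (auto simp: sdet_not_inj)
    also have "(\<Sum>\<mu> | \<mu> \<in> partitions \<and> length \<mu> \<le> n \<and> int (sum_list \<mu>) = d - int r. ?F (site \<mu>)) =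
       (\<Sum>\<mu> | \<mu> \<in> partitions \<and> length \<mu> \<le> n \<and> int (sum_list \<mu>) = d - int r. real r * t r * (schur \<mu> t)\<^sup>2)"
    proof (rule sum.cong[OF refl], clarify)
      fix \<mu> assume h: "\<mu> \<in> partitions" "length \<mu> \<le> n" "int (sum_list \<mu>) = d - int r"
      hence "length \<mu> + r \<le> n" using length_le_sum_list[of \<mu>] n by linarith
      thus "?F (site \<mu>) = real r * t r * (schur \<mu> t)\<^sup>2"
        using sdet_add_ribbon[OF fin r] h by (simp add: sdet_site power2_eq_square)
    qed
    also have "\<dots> = real r * t r * schur_square_sum t (d - int r)"
      using parts[of "d - int r"] by (simp add: schur_square_sum_def sum_distrib_left)
    finally show "(\<Sum>y\<in>degree_tuples n (d - int r). ?F y) = fact n * (real r * t r * schur_square_sum t (d - int r))" .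
  qed
  also have "\<dots> = fact n * (\<Sum>r\<in>seq_support t. (real r * t r)\<^sup>2 * schur_square_sum t (d - int r))"
    by (simp add: sum_distrib_left power2_eq_square mult_ac)
  finally show ?thesis by simp
qed

text \<open>Both sides start with 1 and satisfy the same recursion, since (r t_r)^2 = r (r t_r^2) is
  the Euler factor of the times r t_r^2. This is the Cauchy identity, size by size.\<close>

lemma schur_square_sum_eq_hpoly:
  assumes fin: "finite (seq_support t)"
  shows "schur_square_sum t d = hpoly (\<lambda>r. real r * (t r)\<^sup>2) d"
proof (cases "d \<ge> 0")
  case True
  have supp: "seq_support (\<lambda>r. real r * (t r)\<^sup>2) = seq_support t" by (auto simp: seq_support_def)
  have "schur_square_sum t (int n) = hpoly (\<lambda>r. real r * (t r)\<^sup>2) (int n)" for n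
  proof (induction n rule: less_induct)
    case (less n)
    show ?case
    proof (cases "n = 0")
      case True
      have "\<mu> = []" if "\<mu> \<in> partitions" "sum_list \<mu> = 0" for \<mu>
        using length_le_sum_list[OF that(1)] that(2) by simp
      hence "{\<mu>. \<mu> \<in> partitions \<and> int (sum_list \<mu>) = 0} = {[]}"
        by (auto simp: partitions_def simp del: sum_list_eq_0_iff)
      thus ?thesis using True by (simp add: schur_square_sum_def schur_def)
    next
      case False
      have eq: "schur_square_sum t (int n - int r) = hpoly (\<lambda>r. real r * (t r)\<^sup>2) (int n - int r)" if "r \<in> seq_support t" for r
      proof (cases "r \<le> n")
        case True
        thus ?thesis using less[of "n - r"] that False by (simp add: of_nat_diff seq_support_def)
      next
        case False
        hence "{\<mu>. \<mu> \<in> partitions \<and> int (sum_list \<mu>) = int n - int r} = {}" by auto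
        thus ?thesis using False by (simp add: schur_square_sum_def)
      qed
      have "real n * schur_square_sum t (int n) = (\<Sum>r\<in>seq_support t. (real r * t r)\<^sup>2 * schur_square_sum t (int n - int r))"
        using schur_square_sum_rec[OF fin, of "int n"] by simp
      also have "\<dots> = (\<Sum>r\<in>seq_support t. real r * (real r * (t r)\<^sup>2) * hpoly (\<lambda>r. real r * (t r)\<^sup>2) (int n - int r))"
        by (intro sum.cong) (auto simp: eq power2_eq_square)
      also have "\<dots> = real n * hpoly (\<lambda>r. real r * (t r)\<^sup>2) (int n)"
        using hpoly_euler[of "\<lambda>r. real r * (t r)\<^sup>2" "int n"] fin by (simp add: supp)
      finally show ?thesis using False by simp
    qed
  qed
  from this[of "nat d"] True show ?thesis by simp
next
  case False
  hence "{\<mu>. \<mu> \<in> partitions \<and> int (sum_list \<mu>) = d} = {}" by auto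
  thus ?thesis using False by (simp add: schur_square_sum_def)
qed

lemma schur_square_sum_sums:
  assumes fin: "finite (seq_support t)"
  shows "(\<lambda>n. schur_square_sum t (int n)) sums exp (\<Sum>r\<in>seq_support t. real r * (t r)\<^sup>2)"
proof -
  have supp: "seq_support (\<lambda>r. real r * (t r)\<^sup>2) = seq_support t" by (auto simp: seq_support_def)
  have "(\<lambda>n. complex_of_real (hpoly (\<lambda>r. real r * (t r)\<^sup>2) (int n)) * 1 ^ n) sums
     exp (\<Sum>r\<in>seq_support t. complex_of_real (real r * (t r)\<^sup>2) * 1 ^ r)"
    using hpoly_sums_exp[of "\<lambda>r. real r * (t r)\<^sup>2" 1] fin by (simp only: supp)
  also have "exp (\<Sum>r\<in>seq_support t. complex_of_real (real r * (t r)\<^sup>2) * 1 ^ r) =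
     complex_of_real (exp (\<Sum>r\<in>seq_support t. real r * (t r)\<^sup>2))"
    by (simp add: exp_of_real[symmetric])
  finally show ?thesis by (simp add: schur_square_sum_eq_hpoly[OF fin] sums_of_real_iff)
qed

section \<open>Correlation bounds\<close>

text \<open>After expanding both determinants the sum over tuples factorises for each pair of
  permutations. For fixed p the sum over q is a determinant with its rows permuted by p, so all n!
  choices of p contribute equally.\<close>

lemma andreief:
  fixes \<psi> \<phi> :: "nat \<Rightarrow> 'a \<Rightarrow> real"
  assumes "finite A"
  shows "(\<Sum>x\<in>PiE {..<n} (\<lambda>_. A). (\<Prod>i<n. w (x i)) * fdet n (\<lambda>i j. \<psi> j (x i)) * fdet n (\<lambda>i j. \<phi> j (x i))) =
    fact n * fdet n (\<lambda>j k. \<Sum>s\<in>A. w s * \<psi> j s * \<phi> k s)"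
proof -
  let ?S = "{p. p permutes {0..<n}}" and ?X = "PiE {..<n} (\<lambda>_. A)"
  define G where "G j k = (\<Sum>s\<in>A. w s * \<psi> j s * \<phi> k s)" for j k
  have "(\<Sum>x\<in>?X. (\<Prod>i<n. w (x i)) * fdet n (\<lambda>i j. \<psi> j (x i)) * fdet n (\<lambda>i j. \<phi> j (x i))) =
    (\<Sum>x\<in>?X. \<Sum>p\<in>?S. \<Sum>q\<in>?S. signof p * (signof q * (\<Prod>i<n. w (x i) * \<psi> (p i) (x i) * \<phi> (q i) (x i))))"
    unfolding fdet_leibniz atLeast0LessThan
    by (rule sum.cong[OF refl], subst mult.assoc, subst sum_product)
       (simp add: sum_distrib_left prod.distrib mult_ac)
  also have "\<dots> = (\<Sum>p\<in>?S. \<Sum>q\<in>?S. \<Sum>x\<in>?X. signof p * (signof q * (\<Prod>i<n. w (x i) * \<psi> (p i) (x i) * \<phi> (q i) (x i))))"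
    by (rule sum_rotate3[symmetric])
  also have "\<dots> = (\<Sum>p\<in>?S. \<Sum>q\<in>?S. signof p * (signof q * (\<Prod>i<n. G (p i) (q i))))"
    unfolding G_def by (subst prod_sum_PiE) (auto simp: assms sum_distrib_left)
  also have "\<dots> = (\<Sum>p\<in>?S. signof p * fdet n (\<lambda>i j. G (p i) j))"
    unfolding fdet_leibniz by (simp add: sum_distrib_left atLeast0LessThan)
  also have "\<dots> = (\<Sum>p\<in>?S. signof p * (signof p * fdet n G))"
    by (intro sum.cong refl) (simp add: fdet_permute_rows)
  also have "\<dots> = (\<Sum>p\<in>?S. fdet n G)"
    by (intro sum.cong refl) (simp add: sign_def)
  also have "\<dots> = fact n * fdet n G"
    by (simp add: card_permutations[of "{0..<n}" n])
  finally show ?thesis unfolding G_def .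
qed

text \<open>Both sides are the determinant of the block matrix with blocks 1, X, Y, 1:
  \<open>?L\<close> clears its lower left block and \<open>?U\<close> its upper right one, and both
  have determinant 1.\<close>

lemma sylvester_det:
  fixes X :: "real mat"
  assumes X: "X \<in> carrier_mat n m" and Y: "Y \<in> carrier_mat m n"
  shows "Determinant.det (1\<^sub>m n - X * Y) = Determinant.det (1\<^sub>m m - Y * X)"
proof -
  let ?M = "four_block_mat (1\<^sub>m n) X Y (1\<^sub>m m)"
  let ?L = "four_block_mat (1\<^sub>m n) (0\<^sub>m n m) (- Y) (1\<^sub>m m)"
  let ?U = "four_block_mat (1\<^sub>m n) (- X) (0\<^sub>m m n) (1\<^sub>m m)"
  have "?L * ?M = four_block_mat (1\<^sub>m n * 1\<^sub>m n + 0\<^sub>m n m * Y) (1\<^sub>m n * X + 0\<^sub>m n m * 1\<^sub>m m)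
     (- Y * 1\<^sub>m n + 1\<^sub>m m * Y) (- Y * X + 1\<^sub>m m * 1\<^sub>m m)"
    by (rule mult_four_block_mat) (use assms in auto)
  also have "\<dots> = four_block_mat (1\<^sub>m n) X (0\<^sub>m m n) (1\<^sub>m m - Y * X)"
    using assms by (intro arg_cong[where f = "\<lambda>(a, b, c, d). four_block_mat a b c d", of "(_, _, _, _)" "(_, _, _, _)", simplified split] )
      (auto intro!: eq_matI simp: scalar_prod_def sum_negf)
  finally have 1: "?L * ?M = four_block_mat (1\<^sub>m n) X (0\<^sub>m m n) (1\<^sub>m m - Y * X)" .
  have "?U * ?M = four_block_mat (1\<^sub>m n * 1\<^sub>m n + - X * Y) (1\<^sub>m n * X + - X * 1\<^sub>m m)
     (0\<^sub>m m n * 1\<^sub>m n + 1\<^sub>m m * Y) (0\<^sub>m m n * X + 1\<^sub>m m * 1\<^sub>m m)"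
    by (rule mult_four_block_mat) (use assms in auto)
  also have "\<dots> = four_block_mat (1\<^sub>m n - X * Y) (0\<^sub>m n m) Y (1\<^sub>m m)"
    using assms by (intro arg_cong[where f = "\<lambda>(a, b, c, d). four_block_mat a b c d", of "(_, _, _, _)" "(_, _, _, _)", simplified split] )
      (auto intro!: eq_matI simp: scalar_prod_def sum_negf)
  finally have 2: "?U * ?M = four_block_mat (1\<^sub>m n - X * Y) (0\<^sub>m n m) Y (1\<^sub>m m)" .
  have M: "?M \<in> carrier_mat (n + m) (n + m)" "?L \<in> carrier_mat (n + m) (n + m)" "?U \<in> carrier_mat (n + m) (n + m)"
    using assms by auto
  have "Determinant.det ?L = 1"
    using assms by (subst det_four_block_mat_upper_right_zero[where n = n and m = m]) auto
  hence "Determinant.det ?M = Determinant.det (?L * ?M)" by (simp add: det_mult[OF M(2,1)])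
  also have "\<dots> = Determinant.det (1\<^sub>m m - Y * X)"
    unfolding 1 using assms by (subst det_four_block_mat_lower_left_zero[where n = n and m = m]) auto
  finally have a: "Determinant.det ?M = Determinant.det (1\<^sub>m m - Y * X)" .
  have "Determinant.det ?U = 1"
    using assms by (subst det_four_block_mat_lower_left_zero[where n = n and m = m]) auto
  hence "Determinant.det ?M = Determinant.det (?U * ?M)" by (simp add: det_mult[OF M(3,1)])
  also have "\<dots> = Determinant.det (1\<^sub>m n - X * Y)"
    unfolding 2 using assms by (subst det_four_block_mat_upper_right_zero[where n = n and m = m]) auto
  finally show ?thesis using a by simp
qed

lemma det_2x2: "Determinant.det (mat 2 2 f) = f (0, 0) * f (1, 1) - f (0, 1) * (f (1, 0) :: real)"
proof -
  let ?t = "Transposition.transpose (0::nat) 1"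
  have p: "p permutes {0..<2::nat} \<longleftrightarrow> p \<in> {id, ?t}" for p
  proof -
    have "{0..<2::nat} = {0, 1}" by auto
    thus ?thesis using permutes_doubleton_iff[of p 0 1] by simp
  qed
  have ne: "id \<noteq> ?t" by (metis id_apply transpose_apply_first zero_neq_one)
  have S: "{p. p permutes {0..<2::nat}} = {id, ?t}" using p by blast
  have "Determinant.det (mat 2 2 f) = (\<Sum>p\<in>{id, ?t}. signof p * (\<Prod>i = 0..<2. mat 2 2 f $$ (i, p i)))"
    by (subst det_def'[OF mat_carrier], subst S) (rule refl)
  also have "\<dots> = signof id * (\<Prod>i = 0..<2. mat 2 2 f $$ (i, id i)) + signof ?t * (\<Prod>i = 0..<2. mat 2 2 f $$ (i, ?t i))"
    using ne by simp
  also have "\<dots> = f (0, 0) * f (1, 1) - f (0, 1) * f (1, 0)"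
    by (simp add: numeral_2_eq_2 sign_swap_id)
  finally show ?thesis .
qed

text \<open>With X having the columns y, z and Y the rows v, w, the matrix is G (1 - X Y), and
  Sylvester's identity reduces the second factor to a 2 by 2 determinant. Taking w = z = 0 gives the
  rank one case.\<close>

lemma fdet_minus_rank2:
  assumes y: "\<And>i. i < n \<Longrightarrow> (\<Sum>k<n. G i k * y k) = v i"
    and z: "\<And>i. i < n \<Longrightarrow> (\<Sum>k<n. G i k * z k) = w i"
  shows "fdet n (\<lambda>i j. G i j - v i * v j - w i * w j) = fdet n G *
    ((1 - (\<Sum>i<n. v i * y i)) * (1 - (\<Sum>i<n. w i * z i)) - (\<Sum>i<n. v i * z i) * (\<Sum>i<n. w i * y i))"
proof -
  let ?G = "mat n n (\<lambda>(i, j). G i j)"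
  define X where "X = mat n 2 (\<lambda>(i, k). if k = 0 then y i else z i)"
  define Y where "Y = mat 2 n (\<lambda>(k, j). if k = 0 then v j else w j)"
  have X: "X \<in> carrier_mat n 2" and Y: "Y \<in> carrier_mat 2 n" by (auto simp: X_def Y_def)
  have "mat n n (\<lambda>(i, j). G i j - v i * v j - w i * w j) = ?G - (?G * X) * Y"
    by (intro eq_matI)
       (auto simp: X_def Y_def scalar_prod_def numeral_2_eq_2 atLeast0LessThan y z lessThan_Suc)
  also have "\<dots> = ?G * (1\<^sub>m n - X * Y)"
    using X Y by (subst mult_minus_distrib_mat[where nr = n and n = n and nc = n]) (auto simp: assoc_mult_mat[of _ n n _ 2 _ n])
  finally have eq: "mat n n (\<lambda>(i, j). G i j - v i * v j - w i * w j) = ?G * (1\<^sub>m n - X * Y)" .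
  have "1\<^sub>m n - X * Y \<in> carrier_mat n n" using X Y by (intro minus_carrier_mat mult_carrier_mat)
  hence "fdet n (\<lambda>i j. G i j - v i * v j - w i * w j) = fdet n G * Determinant.det (1\<^sub>m n - X * Y)"
    unfolding fdet_def eq by (rule det_mult[OF mat_carrier])
  also have "Determinant.det (1\<^sub>m n - X * Y) = Determinant.det (1\<^sub>m 2 - Y * X)"
    by (rule sylvester_det[OF X Y])
  also have "1\<^sub>m 2 - Y * X = mat 2 2 (\<lambda>(i, j). (if i = j then 1 else 0) -
      (\<Sum>k<n. (if i = 0 then v k else w k) * (if j = 0 then y k else z k)))"
    by (intro eq_matI) (auto simp: X_def Y_def scalar_prod_def atLeast0LessThan)
  finally show ?thesis by (simp add: det_2x2)
qed

lemma fdet_solve: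
  assumes "fdet n G \<noteq> 0"
  obtains y where "\<And>i. i < n \<Longrightarrow> (\<Sum>k<n. G i k * y k) = v i"
proof -
  let ?G = "mat n n (\<lambda>(i, j). G i j)"
  define y where "y k = (\<Sum>l<n. adj_mat ?G $$ (k, l) * v l) / fdet n G" for k
  have adj: "(\<Sum>k<n. G i k * adj_mat ?G $$ (k, l)) = (if i = l then fdet n G else 0)" if "i < n" "l < n" for i l
  proof -
    have c: "adj_mat ?G \<in> carrier_mat n n" by (rule adj_mat(1)) auto
    have "(?G * adj_mat ?G) $$ (i, l) = (Determinant.det ?G \<cdot>\<^sub>m 1\<^sub>m n) $$ (i, l)"
      by (subst adj_mat(2)[of _ n]) auto
    thus ?thesis using that c by (auto simp: scalar_prod_def atLeast0LessThan fdet_def)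
  qed
  have "(\<Sum>k<n. G i k * y k) = v i" if "i < n" for i
  proof -
    have "(\<Sum>k<n. G i k * y k) = (\<Sum>k<n. \<Sum>l<n. G i k * adj_mat ?G $$ (k, l) * v l) / fdet n G"
      unfolding y_def by (simp add: sum_divide_distrib sum_distrib_left mult_ac)
    also have "(\<Sum>k<n. \<Sum>l<n. G i k * adj_mat ?G $$ (k, l) * v l) = (\<Sum>l<n. (\<Sum>k<n. G i k * adj_mat ?G $$ (k, l)) * v l)"
      by (subst sum.swap) (simp add: sum_distrib_right)
    also have "\<dots> = (\<Sum>l<n. if l = i then fdet n G * v i else 0)"
      using adj that by (intro sum.cong) auto
    also have "\<dots> / fdet n G = v i" using that assms by simp
    finally show ?thesis .
  qed
  thus ?thesis by (rule that)
qed

text \<open>The hypotheses say that the linear forms \<open>v\<close> and \<open>w\<close> have squared norms at most \<open>r\<close> and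
  \<open>q\<close> with respect to the Gram matrix \<open>G\<close>.\<close>

lemma fdet_correlation_bounds:
  assumes sym: "\<And>i j. i < n \<Longrightarrow> j < n \<Longrightarrow> G i j = G j i"
    and pos: "fdet n G > 0" and r: "r \<ge> 0" and q: "q \<ge> 0"
    and v: "\<And>c. (\<Sum>i<n. c i * v i)\<^sup>2 \<le> r * (\<Sum>i<n. \<Sum>j<n. c i * c j * G i j)"
    and w: "\<And>c. (\<Sum>i<n. c i * w i)\<^sup>2 \<le> q * (\<Sum>i<n. \<Sum>j<n. c i * c j * G i j)"
  shows "fdet n G - fdet n (\<lambda>i j. G i j - v i * v j) \<le> r * fdet n G"
    and "fdet n G - fdet n (\<lambda>i j. G i j - v i * v j) - fdet n (\<lambda>i j. G i j - w i * w j) +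
      fdet n (\<lambda>i j. G i j - v i * v j - w i * w j) \<le> r * q * fdet n G"
proof -
  obtain y where y: "\<And>i. i < n \<Longrightarrow> (\<Sum>k<n. G i k * y k) = v i" using fdet_solve pos by (metis less_irrefl)
  obtain z where z: "\<And>i. i < n \<Longrightarrow> (\<Sum>k<n. G i k * z k) = w i" using fdet_solve pos by (metis less_irrefl)
  define a where "a = (\<Sum>i<n. v i * y i)"
  define b where "b = (\<Sum>i<n. w i * z i)"
  define c where "c = (\<Sum>i<n. v i * z i)"
  have quad: "(\<Sum>i<n. \<Sum>j<n. s i * u j * G i j) = (\<Sum>i<n. s i * x i)"
    if "\<And>i. i < n \<Longrightarrow> (\<Sum>k<n. G i k * u k) = x i" for s u x
  proof (rule sum.cong[OF refl])
    fix i assume "i \<in> {..<n}"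
    hence "s i * x i = s i * (\<Sum>k<n. G i k * u k)" using that by simp
    thus "(\<Sum>j<n. s i * u j * G i j) = s i * x i" by (simp add: sum_distrib_left mult_ac)
  qed
  have c': "(\<Sum>i<n. w i * y i) = c"
  proof -
    have "(\<Sum>i<n. w i * y i) = (\<Sum>i<n. \<Sum>j<n. y i * z j * G i j)" by (subst quad[OF z]) (simp_all add: mult.commute)
    also have "\<dots> = (\<Sum>j<n. \<Sum>i<n. y i * z j * G i j)" by (rule sum.swap)
    also have "\<dots> = (\<Sum>j<n. \<Sum>i<n. z j * y i * G j i)" using sym by (intro sum.cong refl) auto
    also have "\<dots> = c" unfolding c_def by (subst quad[OF y]) (simp_all add: mult.commute)
    finally show ?thesis .
  qed
  \<comment> \<open>To be applied to the squared norms \<open>a\<close> and \<open>b\<close>: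
    testing the hypothesis on v at c = y gives a^2 \<le> r a, and that on w at c = z gives b^2 \<le>
    q b.\<close>
  have bound: "0 \<le> e \<and> e \<le> \<rho>" if "\<rho> \<ge> 0" "e\<^sup>2 \<le> \<rho> * e" for e \<rho> :: real
  proof (cases "e = 0")
    case False
    hence "\<rho> * e > 0" using that by (metis less_le_trans zero_less_power2)
    hence "e > 0" using that by (simp add: zero_less_mult_iff)
    thus ?thesis using that by (simp add: power2_eq_square)
  qed (use that in auto)
  have a: "0 \<le> a" "a \<le> r"
    using bound[OF r, of a] v[of y] quad[OF y, of y] by (auto simp: a_def mult.commute)
  have b: "0 \<le> b" "b \<le> q"
    using bound[OF q, of b] w[of z] quad[OF z, of z] by (auto simp: b_def mult.commute)
  have 1: "fdet n (\<lambda>i j. G i j - v i * v j) = fdet n G * (1 - a)"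
    using fdet_minus_rank2[OF y, where z = "\<lambda>_. 0" and w = "\<lambda>_. 0"] by (simp add: a_def)
  have 2: "fdet n (\<lambda>i j. G i j - w i * w j) = fdet n G * (1 - b)"
    using fdet_minus_rank2[OF z, where z = "\<lambda>_. 0" and w = "\<lambda>_. 0"] by (simp add: b_def)
  have 3: "fdet n (\<lambda>i j. G i j - v i * v j - w i * w j) = fdet n G * ((1 - a) * (1 - b) - c * c)"
    using fdet_minus_rank2[OF y z] by (simp add: a_def b_def c_def[symmetric] c')
  show "fdet n G - fdet n (\<lambda>i j. G i j - v i * v j) \<le> r * fdet n G"
    using mult_right_mono[OF a(2), of "fdet n G"] pos unfolding 1 by (simp add: algebra_simps)
  \<comment> \<open>The square of the inner product of v and w enters with a favourable sign and is
    discarded: distinct sites are negatively correlated.\<close>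
  have "a * b - c * c \<le> r * q"
    using mult_mono[OF a(2) b(2) r b(1)] zero_le_square[of c] by linarith
  from mult_right_mono[OF this, of "fdet n G"] pos
  show "fdet n G - fdet n (\<lambda>i j. G i j - v i * v j) - fdet n (\<lambda>i j. G i j - w i * w j) +
      fdet n (\<lambda>i j. G i j - v i * v j - w i * w j) \<le> r * q * fdet n G"
    unfolding 1 2 3 by (simp add: algebra_simps)
qed

section \<open>The symbol coefficients and the Gram matrix of the shifts of h\<close>

lemma hpoly_abs_bound:
  assumes "finite (seq_support t)" "0 < \<rho>" "\<rho> \<le> 1"
  obtains C where "C > 0" "\<And>k. \<bar>hpoly t k\<bar> \<le> C * \<rho> ^ nat k" "\<And>k. \<bar>hpoly t k\<bar> \<le> C"
proof -
  from hpoly_decay[OF assms] obtain C where C: "C \<ge> 0" "\<And>n. \<bar>hpoly t (int n)\<bar> \<le> C * \<rho> ^ n" by blast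
  have b: "\<bar>hpoly t k\<bar> \<le> (C + 1) * \<rho> ^ nat k" for k
  proof (cases "k < 0")
    case False
    have "\<bar>hpoly t k\<bar> \<le> C * \<rho> ^ nat k" using C(2)[of "nat k"] False by simp
    also have "\<dots> \<le> (C + 1) * \<rho> ^ nat k" using assms by (intro mult_right_mono) auto
    finally show ?thesis .
  qed (use C in auto)
  moreover have "\<bar>hpoly t k\<bar> \<le> C + 1" for k
    using b[of k] C assms by (rule_tac order_trans) (auto simp: mult_left_le power_le_one)
  ultimately show ?thesis using C(1) by (intro that[of "C + 1"]) auto
qed

text \<open>The Fourier coefficients of the unimodular symbol \<open>exp (\<Sum>r. t\<^sub>r (z\<^sup>r - z\<^sup>-\<^sup>r))\<close>.\<close>

definition symbol_coeff :: "(nat \<Rightarrow> real) \<Rightarrow> int \<Rightarrow> real" where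
  "symbol_coeff t n = (\<Sum>m. hpoly t (int m + n) * hpoly (\<lambda>r. - t r) (int m))"

lemma symbol_coeff_bounds:
  assumes fin: "finite (seq_support t)"
  obtains C where "C > 0" "\<And>m n. \<bar>hpoly t (int m + n) * hpoly (\<lambda>r. - t r) (int m)\<bar> \<le> C * (1/2) ^ nat \<bar>n\<bar> * (1/2) ^ m"
    "\<And>n. \<bar>symbol_coeff t n\<bar> \<le> C * (1/2) ^ nat \<bar>n\<bar>"
    "\<And>n. (\<lambda>m. hpoly t (int m + n) * hpoly (\<lambda>r. - t r) (int m)) sums symbol_coeff t n"
proof -
  \<comment> \<open>The rate 1/4 is split into two factors 1/2, one for the decay in m and one for
    that in \<bar>n\<bar>, because 2 (m + n) + 2 m \<ge> \<bar>n\<bar> + m whenever m + n \<ge>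
    0.\<close>
  obtain A where A: "A > 0" "\<And>k. \<bar>hpoly t k\<bar> \<le> A * (1/4) ^ nat k"
    by (rule hpoly_abs_bound[OF fin, of "1/4"]) (simp, simp, blast)
  obtain B where B: "B > 0" "\<And>k. \<bar>hpoly (\<lambda>r. - t r) k\<bar> \<le> B * (1/4) ^ nat k"
    by (rule hpoly_abs_bound[of "\<lambda>r. - t r" "1/4"]) (simp add: fin, simp, simp, blast)
  have b: "\<bar>hpoly t (int m + n) * hpoly (\<lambda>r. - t r) (int m)\<bar> \<le> A * B * (1/2) ^ nat \<bar>n\<bar> * (1/2) ^ m" for m n
  proof (cases "int m + n < 0")
    case False
    have "\<bar>hpoly t (int m + n) * hpoly (\<lambda>r. - t r) (int m)\<bar> \<le> (A * (1/4) ^ nat (int m + n)) * (B * (1/4) ^ m)"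
      unfolding abs_mult using A(2)[of "int m + n"] B(2)[of "int m"] A(1) by (intro mult_mono) auto
    also have "\<dots> = A * B * (1/2) ^ (2 * nat (int m + n) + 2 * m)"
      by (simp add: power_add power_mult power2_eq_square)
    also have "\<dots> \<le> A * B * (1/2) ^ (nat \<bar>n\<bar> + m)"
      using A(1) B(1) False by (intro mult_left_mono power_decreasing) auto
    finally show ?thesis by (simp add: power_add)
  qed (use A B in auto)
  have geo: "(\<lambda>m. A * B * (1/2) ^ nat \<bar>n\<bar> * (1/2) ^ m) sums (2 * A * B * (1/2) ^ nat \<bar>n\<bar>)" for n :: int
    using sums_mult[OF geometric_sums[of "1/2 :: real"], of "A * B * (1/2) ^ nat \<bar>n\<bar>"] by (simp add: mult_ac)
  have s: "summable (\<lambda>m. \<bar>hpoly t (int m + n) * hpoly (\<lambda>r. - t r) (int m)\<bar>)" for n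
    by (rule summable_comparison_test'[OF sums_summable[OF geo[of n]]]) (use b in auto)
  show ?thesis
  \<comment> \<open>The 2 is the sum of the geometric series in m; with it one constant serves both
    bounds.\<close>
  proof (rule that[of "2 * A * B"])
    show "\<bar>hpoly t (int m + n) * hpoly (\<lambda>r. - t r) (int m)\<bar> \<le> 2 * A * B * (1/2) ^ nat \<bar>n\<bar> * (1/2) ^ m" for m n
    proof -
      have "A * B * (1/2) ^ nat \<bar>n\<bar> * (1/2) ^ m \<le> 2 * (A * B * (1/2) ^ nat \<bar>n\<bar> * (1/2) ^ m)"
        using A(1) B(1) by simp
      with b[of m n] have "\<bar>hpoly t (int m + n) * hpoly (\<lambda>r. - t r) (int m)\<bar> \<le> 2 * (A * B * (1/2) ^ nat \<bar>n\<bar> * (1/2) ^ m)"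
        by (rule order_trans)
      thus ?thesis by (simp only: mult.assoc)
    qed
    show "\<bar>symbol_coeff t n\<bar> \<le> 2 * A * B * (1/2) ^ nat \<bar>n\<bar>" for n
    proof -
      have "\<bar>symbol_coeff t n\<bar> \<le> (\<Sum>m. \<bar>hpoly t (int m + n) * hpoly (\<lambda>r. - t r) (int m)\<bar>)"
        unfolding symbol_coeff_def by (rule summable_rabs[OF s])
      also have "\<dots> \<le> 2 * A * B * (1/2) ^ nat \<bar>n\<bar>"
        using suminf_le[OF b s sums_summable[OF geo]] sums_unique[OF geo[of n]] by simp
      finally show ?thesis .
    qed
    show "(\<lambda>m. hpoly t (int m + n) * hpoly (\<lambda>r. - t r) (int m)) sums symbol_coeff t n" for n
      unfolding symbol_coeff_def by (intro summable_sums summable_rabs_cancel[OF s])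
  qed (use A B in auto)
qed

lemma symbol_coeff_decay:
  assumes fin: "finite (seq_support t)"
  shows "\<exists>C>0. \<forall>n. \<bar>symbol_coeff t n\<bar> \<le> C * (1/2) ^ nat \<bar>n\<bar>"
proof (rule symbol_coeff_bounds[OF fin])
  fix C assume "C > 0" "\<And>n. \<bar>symbol_coeff t n\<bar> \<le> C * (1/2) ^ nat \<bar>n\<bar>"
  thus ?thesis by blast
qed

text \<open>Coefficientwise form of H(z) = (H(z) / H(1/z)) H(1/z), exhibiting the shifts of h as
  combinations of shifts of the symbol coefficients. The double series is regrouped by q = p + m,
  where h and the coefficients of 1/H convolve to 0 unless q = 0.\<close>

lemma hpoly_symbol_coeff_sums:
  assumes fin: "finite (seq_support t)"
  shows "(\<lambda>p. hpoly t (int p) * symbol_coeff t (n + int p)) sums hpoly t n"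
proof -
  obtain A where A: "A > 0" "\<And>k. \<bar>hpoly t k\<bar> \<le> A * (1/2) ^ nat k" "\<And>k. \<bar>hpoly t k\<bar> \<le> A"
    by (rule hpoly_abs_bound[OF fin, of "1/2"]) (simp, simp, blast)
  obtain B where B: "B > 0" "\<And>m n. \<bar>hpoly t (int m + n) * hpoly (\<lambda>r. - t r) (int m)\<bar> \<le> B * (1/2) ^ nat \<bar>n\<bar> * (1/2) ^ m"
    "\<And>n. (\<lambda>m. hpoly t (int m + n) * hpoly (\<lambda>r. - t r) (int m)) sums symbol_coeff t n"
    by (rule symbol_coeff_bounds[OF fin]) blast
  define f where "f = (\<lambda>(p, m). hpoly t (int p) * (hpoly t (int m + (n + int p)) * hpoly (\<lambda>r. - t r) (int m)))"
  have bnd: "\<bar>f (p, m)\<bar> \<le> A * (1/2) ^ p * (B * (1/2) ^ m)" for p m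
  proof -
    have "B * (1/2) ^ nat \<bar>n + int p\<bar> * (1/2) ^ m \<le> B * 1 * (1/2) ^ m"
      using B(1) by (intro mult_right_mono mult_left_mono power_le_one) auto
    with B(2)[of m "n + int p"]
    have 1: "\<bar>hpoly t (int m + (n + int p)) * hpoly (\<lambda>r. - t r) (int m)\<bar> \<le> B * (1/2) ^ m" by simp
    have "\<bar>f (p, m)\<bar> = \<bar>hpoly t (int p)\<bar> * \<bar>hpoly t (int m + (n + int p)) * hpoly (\<lambda>r. - t r) (int m)\<bar>"
      unfolding f_def prod.case by (rule abs_mult)
    also have "\<dots> \<le> A * (1/2) ^ p * (B * (1/2) ^ m)"
      by (rule mult_mono[OF _ 1]) (use A(2)[of "int p"] A(1) in auto)
    finally show ?thesis .
  qed
  have geo: "(\<lambda>m. (1/2::real) ^ m) summable_on UNIV"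
    by (rule norm_summable_imp_summable_on) (simp add: summable_geometric)
  have "(\<lambda>(p, m). A * (1/2) ^ p * (B * (1/2) ^ m)) summable_on (UNIV \<times> UNIV)"
  proof (rule summable_on_SigmaI)
    show "((\<lambda>m. case (p, m) of (p, m) \<Rightarrow> A * (1/2) ^ p * (B * (1/2) ^ m)) has_sum (A * (1/2) ^ p * (B * infsum (\<lambda>m. (1/2) ^ m) UNIV))) UNIV" for p :: nat
      unfolding prod.case by (intro has_sum_cmult_right has_sum_infsum geo)
    show "(\<lambda>p. A * (1/2) ^ p * (B * infsum (\<lambda>m. (1/2::real) ^ m) (UNIV :: nat set))) summable_on UNIV"
      by (intro summable_on_cmult_left summable_on_cmult_right geo)
  qed (use A B in auto)
  hence "(\<lambda>x. norm (f x)) summable_on (UNIV \<times> UNIV)"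
    by (rule summable_on_comparison_test) (use bnd in auto)
  hence f_summ: "f summable_on (UNIV \<times> UNIV)" by (rule abs_summable_summable)
  then obtain S where S: "(f has_sum S) (UNIV \<times> UNIV)" by (auto simp: summable_on_def)
  have "((\<lambda>p. hpoly t (int p) * symbol_coeff t (n + int p)) has_sum S) UNIV"
  proof (rule has_sum_SigmaD[OF S])
    fix p :: nat
    have "((\<lambda>m. hpoly t (int m + (n + int p)) * hpoly (\<lambda>r. - t r) (int m)) has_sum symbol_coeff t (n + int p)) UNIV"
    proof (rule norm_summable_imp_has_sum[OF _ B(3)])
      show "summable (\<lambda>m. norm (hpoly t (int m + (n + int p)) * hpoly (\<lambda>r. - t r) (int m)))"
        by (rule summable_comparison_test'[of "\<lambda>m. B * (1/2) ^ nat \<bar>n + int p\<bar> * (1/2) ^ m"])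
           (use B(2)[of _ "n + int p"] in \<open>auto intro!: summable_mult summable_geometric\<close>)
    qed
    thus "((\<lambda>y. f (p, y)) has_sum hpoly t (int p) * symbol_coeff t (n + int p)) UNIV"
      unfolding f_def prod.case by (rule has_sum_cmult_right)
  qed
  moreover have "S = hpoly t n"
  proof -
    have "((\<lambda>(q, i). f (i, q - i)) has_sum S) (SIGMA q:UNIV. {..q})"
      by (rule iffD2[OF has_sum_reindex_bij_witness[where j = "\<lambda>(q, i). (i, q - i)" and i = "\<lambda>(i, m). (i + m, i)" and T = "UNIV \<times> UNIV" and h = f] S]) auto
    hence "((\<lambda>q. \<Sum>i\<le>q. f (i, q - i)) has_sum S) UNIV"
      by (rule has_sum_SigmaD) (auto intro!: has_sum_finiteI)
    moreover have "(\<Sum>i\<le>q. f (i, q - i)) = (if q = 0 then hpoly t n else 0)" for q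
    proof -
      have "(\<Sum>i\<le>q. f (i, q - i)) = hpoly t (int q + n) * (\<Sum>i\<le>q. hpoly t (int i) * hpoly (\<lambda>r. - t r) (int (q - i)))"
        by (auto simp: f_def sum_distrib_left of_nat_diff algebra_simps intro!: sum.cong)
      thus ?thesis by (simp only: hpoly_convolution) auto
    qed
    ultimately have "((\<lambda>q::nat. if q = 0 then hpoly t n else 0) has_sum S) UNIV" by simp
    moreover have "((\<lambda>q::nat. if q = 0 then hpoly t n else 0) has_sum hpoly t n) UNIV"
      by (rule has_sum_finite_neutralI[of "{0}"]) auto
    ultimately show ?thesis by (rule has_sum_unique)
  qed
  ultimately show ?thesis by (simp add: has_sum_imp_sums)
qed

text \<open>Inner product of the sequence h with its shift by d. The Gram matrix of several shifts
  of h is the Toeplitz matrix with these entries.\<close>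

definition hpoly_gram :: "(nat \<Rightarrow> real) \<Rightarrow> int \<Rightarrow> real" where
  "hpoly_gram t d = (\<Sum>m. hpoly t (int m) * hpoly t (int m + d))"

lemma hpoly_gram_sums:
  assumes fin: "finite (seq_support t)"
  shows "(\<lambda>l. hpoly t (int l - int i) * hpoly t (int l - int j)) sums hpoly_gram t (int i - int j)"
proof -
  obtain A where A: "A > 0" "\<And>k. \<bar>hpoly t k\<bar> \<le> A * (1/2) ^ nat k" "\<And>k. \<bar>hpoly t k\<bar> \<le> A"
    by (rule hpoly_abs_bound[OF fin, of "1/2"]) (simp, simp, blast)
  have "summable (\<lambda>m. hpoly t (int m) * hpoly t (int m + d))" for d
  proof (rule summable_comparison_test'[of "\<lambda>m. A * (1/2) ^ m * A"])
    show "summable (\<lambda>m. A * (1/2) ^ m * A)" by (intro summable_mult2 summable_mult summable_geometric) auto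
    show "norm (hpoly t (int m) * hpoly t (int m + d)) \<le> A * (1/2) ^ m * A" for m
      using A(2)[of "int m"] A(3)[of "int m + d"] A(1) by (auto simp: abs_mult intro!: mult_mono)
  qed
  hence "(\<lambda>m. hpoly t (int m) * hpoly t (int m + (int i - int j))) sums hpoly_gram t (int i - int j)"
    unfolding hpoly_gram_def by (rule summable_sums)
  hence "(\<lambda>l. hpoly t (int (l + i) - int i) * hpoly t (int (l + i) - int j)) sums hpoly_gram t (int i - int j)"
    by (simp add: algebra_simps)
  thus ?thesis by (subst (asm) sums_zero_iff_shift) auto
qed

lemma hpoly_gram_minus:
  assumes "finite (seq_support t)"
  shows "hpoly_gram t (- d) = hpoly_gram t d"
proof -
  have "hpoly_gram t (int i - int j) = hpoly_gram t (int j - int i)" for i j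
  proof (rule sums_unique2[OF hpoly_gram_sums[OF assms]])
    show "(\<lambda>l. hpoly t (int l - int i) * hpoly t (int l - int j)) sums hpoly_gram t (int j - int i)"
      by (subst mult.commute) (rule hpoly_gram_sums[OF assms])
  qed
  from this[of "nat (- d)" "nat d"] have "hpoly_gram t (int (nat (- d)) - int (nat d)) = hpoly_gram t (int (nat d) - int (nat (- d)))" .
  moreover have "int (nat (- d)) - int (nat d) = - d" "int (nat d) - int (nat (- d)) = d" by auto
  ultimately show ?thesis by (simp only:)
qed

text \<open>The diagonal of the kernel of the projection onto the span of the shifts of the symbol.\<close>

definition occupation :: "(nat \<Rightarrow> real) \<Rightarrow> int \<Rightarrow> real" where
  "occupation t k = (\<Sum>l. (symbol_coeff t (k + int l))\<^sup>2)"

lemma symbol_coeff_square_bound: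
  assumes "C > 0" "\<bar>symbol_coeff t n\<bar> \<le> C * (1/2) ^ nat \<bar>n\<bar>"
  shows "(symbol_coeff t n)\<^sup>2 \<le> C\<^sup>2 * (1/2) ^ nat \<bar>n\<bar>"
proof -
  have "(symbol_coeff t n)\<^sup>2 \<le> (C * (1/2) ^ nat \<bar>n\<bar>)\<^sup>2" using power_mono[OF assms(2), of 2] by simp
  also have "\<dots> = C\<^sup>2 * (1/2) ^ (nat \<bar>n\<bar> * 2)" by (simp add: power_mult_distrib power_mult)
  also have "\<dots> \<le> C\<^sup>2 * (1/2) ^ nat \<bar>n\<bar>" by (intro mult_left_mono power_decreasing) auto
  finally show ?thesis .
qed

lemma occupation_sums:
  assumes fin: "finite (seq_support t)"
  shows "(\<lambda>l. (symbol_coeff t (k + int l))\<^sup>2) sums occupation t k"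
proof -
  obtain C where C: "C > 0" "\<And>n. \<bar>symbol_coeff t n\<bar> \<le> C * (1/2) ^ nat \<bar>n\<bar>" using symbol_coeff_decay[OF fin] by blast
  show ?thesis unfolding occupation_def
  proof (rule summable_sums, rule summable_comparison_test'[of "\<lambda>l. C\<^sup>2 * 2 ^ nat \<bar>k\<bar> * (1/2) ^ l"])
    show "summable (\<lambda>l. C\<^sup>2 * 2 ^ nat \<bar>k\<bar> * (1/2) ^ l)" by (intro summable_mult summable_geometric) auto
    fix l
    have "norm ((symbol_coeff t (k + int l))\<^sup>2) \<le> C\<^sup>2 * (1/2) ^ nat \<bar>k + int l\<bar>"
      using symbol_coeff_square_bound[OF C(1) C(2)] by simp
    also have "(1/2::real) ^ nat \<bar>k + int l\<bar> \<le> 2 ^ nat \<bar>k\<bar> * (1/2) ^ l"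
    proof -
      have "(1/2::real) ^ (nat \<bar>k + int l\<bar> + nat \<bar>k\<bar>) \<le> (1/2) ^ l" by (intro power_decreasing) auto
      thus ?thesis by (simp add: power_add power_divide divide_simps mult_ac)
    qed
    finally show "norm ((symbol_coeff t (k + int l))\<^sup>2) \<le> C\<^sup>2 * 2 ^ nat \<bar>k\<bar> * (1/2) ^ l" by (simp add: mult_left_mono mult.assoc)
  qed
qed

lemma occupation_nonneg: "occupation t k \<ge> 0" if "finite (seq_support t)"
  using occupation_sums[OF that, of k] by (metis sums_iff suminf_nonneg zero_le_power2)

lemma Cauchy_Schwarz_suminf:
  fixes a b :: "nat \<Rightarrow> real"
  assumes "(\<lambda>n. a n * b n) sums S" "(\<lambda>n. (a n)\<^sup>2) sums A" "(\<lambda>n. (b n)\<^sup>2) sums B"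
  shows "S\<^sup>2 \<le> A * B"
proof (rule LIMSEQ_le)
  show "(\<lambda>n. (\<Sum>i<n. a i * b i)\<^sup>2) \<longlonglongrightarrow> S\<^sup>2" using assms by (intro tendsto_intros) (auto simp: sums_def)
  show "(\<lambda>n. (\<Sum>i<n. (a i)\<^sup>2) * (\<Sum>i<n. (b i)\<^sup>2)) \<longlonglongrightarrow> A * B" using assms by (intro tendsto_intros) (auto simp: sums_def)
qed (use Cauchy_Schwarz_ineq_sum in blast)

text \<open>The combination of the values h_{k+j} is the pairing of J_{k+l} with d_l, the sum of c_j
  h_{l-j} over j, and Cauchy-Schwarz separates the two. The square sum of d is again the Gram form
  of the c_j, with the indices reflected, and a symmetric Toeplitz matrix is unchanged by the
  reflection.\<close>

lemma evaluation_bound: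
  assumes fin: "finite (seq_support t)"
  shows "(\<Sum>j<n. c j * hpoly t (k + int j))\<^sup>2 \<le>
    occupation t k * (\<Sum>i<n. \<Sum>j<n. c i * c j * hpoly_gram t (int j - int i))"
proof (rule Cauchy_Schwarz_suminf[OF _ occupation_sums[OF fin]])
  define d where "d l = (\<Sum>j<n. c j * hpoly t (int l - int j))" for l
  show "(\<lambda>l. symbol_coeff t (k + int l) * d l) sums (\<Sum>j<n. c j * hpoly t (k + int j))"
  proof -
    have "(\<lambda>l. c j * (hpoly t (int l - int j) * symbol_coeff t (k + int l))) sums (c j * hpoly t (k + int j))" for j
    proof -
      have "(\<lambda>p. hpoly t (int (p + j) - int j) * symbol_coeff t (k + int (p + j))) sums hpoly t (k + int j)"
        using hpoly_symbol_coeff_sums[OF fin, of "k + int j"] by (simp add: algebra_simps)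
      hence "(\<lambda>l. hpoly t (int l - int j) * symbol_coeff t (k + int l)) sums hpoly t (k + int j)"
        by (subst (asm) sums_zero_iff_shift) auto
      thus ?thesis by (rule sums_mult)
    qed
    hence "(\<lambda>l. \<Sum>j<n. c j * (hpoly t (int l - int j) * symbol_coeff t (k + int l))) sums (\<Sum>j<n. c j * hpoly t (k + int j))"
      by (intro sums_sum)
    thus ?thesis by (simp add: d_def sum_distrib_left mult_ac)
  qed
  have "(\<lambda>l. \<Sum>i<n. \<Sum>j<n. c i * c j * (hpoly t (int l - int i) * hpoly t (int l - int j))) sums
     (\<Sum>i<n. \<Sum>j<n. c i * c j * hpoly_gram t (int i - int j))"
    by (intro sums_sum sums_mult hpoly_gram_sums fin)
  moreover have "hpoly_gram t (int i - int j) = hpoly_gram t (int j - int i)" for i j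
    using hpoly_gram_minus[OF fin, of "int i - int j"] by simp
  ultimately show "(\<lambda>l. (d l)\<^sup>2) sums (\<Sum>i<n. \<Sum>j<n. c i * c j * hpoly_gram t (int j - int i))"
    by (simp add: d_def power2_eq_square sum_product mult_ac)
qed

section \<open>Sums over finite boxes of partitions and their limits\<close>

lemma tendsto_fdet:
  assumes "\<And>i j. i < n \<Longrightarrow> j < n \<Longrightarrow> ((\<lambda>M. G M i j) \<longlongrightarrow> H i j) F"
  shows "((\<lambda>M. fdet n (G M)) \<longlongrightarrow> fdet n H) F"
  unfolding fdet_leibniz
proof (intro tendsto_sum tendsto_mult tendsto_const tendsto_prod assms)
  fix p i assume "p \<in> {p. p permutes {0..<n}}" "i \<in> {0..<n}"
  thus "i < n" "p i < n" using permutes_in_image[of p "{0..<n}" i] by auto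
qed

lemma sum_schur_square_le:
  assumes fin: "finite (seq_support t)" and L: "finite \<Lambda>" "\<Lambda> \<subseteq> partitions"
  shows "(\<Sum>\<mu>\<in>\<Lambda>. (schur \<mu> t)\<^sup>2) \<le> exp (\<Sum>r\<in>seq_support t. real r * (t r)\<^sup>2)"
proof -
  define D where "D = Suc (Max (insert 0 (sum_list ` \<Lambda>)))"
  have D: "sum_list \<mu> < D" if "\<mu> \<in> \<Lambda>" for \<mu>
    unfolding D_def using L that by (simp add: less_Suc_eq_le)
  have "(\<Sum>\<mu>\<in>\<Lambda>. (schur \<mu> t)\<^sup>2) = (\<Sum>d<D. \<Sum>\<mu> | \<mu> \<in> \<Lambda> \<and> sum_list \<mu> = d. (schur \<mu> t)\<^sup>2)"
    by (rule sum.group[symmetric]) (use L D in auto)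
  also have "\<dots> \<le> (\<Sum>d<D. schur_square_sum t (int d))"
    unfolding schur_square_sum_def by (intro sum_mono sum_mono2 finite_partitions_of[simplified]) (use L in auto)
  also have "\<dots> \<le> (\<Sum>d. schur_square_sum t (int d))"
    by (rule sum_le_suminf[OF sums_summable[OF schur_square_sum_sums[OF fin]]])
       (auto simp: schur_square_sum_def intro!: sum_nonneg)
  also have "\<dots> = exp (\<Sum>r\<in>seq_support t. real r * (t r)\<^sup>2)"
    using schur_square_sum_sums[OF fin] by (simp add: sums_iff)
  finally show ?thesis .
qed

text \<open>Two truncations: at most n parts, so that determinants have n rows, and a window of M
  sites, so that sums are finite. M tends to infinity with n fixed, and the bounds obtained do not
  depend on n.\<close>

definition part_box :: "nat \<Rightarrow> nat \<Rightarrow> nat list set" where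
  "part_box n M = {\<mu> \<in> partitions. length \<mu> \<le> n \<and> site \<mu> ` {..<n} \<subseteq> {1 - int n..<1 - int n + int M}}"

lemma finite_part_box [simp]: "finite (part_box n M)"
proof (rule finite_subset)
  show "part_box n M \<subseteq> {xs. set xs \<subseteq> {..n + M} \<and> length xs \<le> n}"
  proof safe
    fix \<mu> k assume h: "\<mu> \<in> part_box n M" "k \<in> set \<mu>"
    then obtain i where i: "i < length \<mu>" "k = \<mu> ! i" by (auto simp: in_set_conv_nth)
    have "i < n" using h i by (auto simp: part_box_def)
    moreover have "site \<mu> ` {..<n} \<subseteq> {1 - int n..<1 - int n + int M}" using h by (simp add: part_box_def)
    ultimately have "site \<mu> i \<in> {1 - int n..<1 - int n + int M}" by blast
    thus "k \<le> n + M" using i \<open>i < n\<close> by (simp add: site_def part_def)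
  qed (auto simp: part_box_def)
qed (rule finite_lists_length_le, simp)

lemma part_box_mono: "M \<le> M' \<Longrightarrow> part_box n M \<subseteq> part_box n M'"
  unfolding part_box_def by fastforce

text \<open>Andreief's identity with a multiplicative weight on the sites. A weight with values 0
  and 1 selects partitions by their sites.\<close>

lemma part_box_weighted_sum:
  "(\<Sum>\<mu>\<in>part_box n M. (\<Prod>i<n. w (site \<mu> i)) * (schur \<mu> t)\<^sup>2) =
   fdet n (\<lambda>i j. \<Sum>s\<in>{1 - int n..<1 - int n + int M}. w s * hpoly t (s + int i) * hpoly t (s + int j))"
proof -
  let ?A = "{1 - int n..<1 - int n + int M}"
  let ?F = "\<lambda>x. (\<Prod>i<n. w (x i)) * (sdet n t x)\<^sup>2"
  have "fact n * fdet n (\<lambda>i j. \<Sum>s\<in>?A. w s * hpoly t (s + int i) * hpoly t (s + int j)) = (\<Sum>x\<in>PiE {..<n} (\<lambda>_. ?A). ?F x)"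
    using andreief[of ?A w n "\<lambda>j s. hpoly t (s + int j)" "\<lambda>j s. hpoly t (s + int j)"]
    by (simp add: sdet_def power2_eq_square mult.assoc)
  also have "\<dots> = fact n * (\<Sum>\<mu> | \<mu> \<in> partitions \<and> length \<mu> \<le> n \<and> site \<mu> ` {..<n} \<subseteq> ?A. ?F (site \<mu>))"
  proof (rule sum_tuples_eq_sum_partitions)
    fix p and x :: "nat \<Rightarrow> int" assume p: "p permutes {0..<n}"
    have "(\<Prod>i<n. w ((x \<circ> p) i)) = (\<Prod>i<n. w (x i))"
      using prod.permute[OF p, of "\<lambda>i. w (x i)"] by (simp add: atLeast0LessThan comp_def)
    moreover have "(sdet n t (x \<circ> p))\<^sup>2 = (sdet n t x)\<^sup>2"
      using signof_square[of p] by (simp add: sdet_permute[OF p] power_mult_distrib power2_eq_square[of "signof p"])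
    ultimately show "?F (x \<circ> p) = ?F x" by simp
  next
    fix x y :: "nat \<Rightarrow> int" assume "\<And>i. i < n \<Longrightarrow> x i = y i"
    thus "?F x = ?F y" using sdet_cong[of n x y t] by (auto intro!: arg_cong2[where f = "(*)"] prod.cong)
  qed (auto simp: sdet_not_inj)
  also have "(\<Sum>\<mu> | \<mu> \<in> partitions \<and> length \<mu> \<le> n \<and> site \<mu> ` {..<n} \<subseteq> ?A. ?F (site \<mu>)) =
     (\<Sum>\<mu>\<in>part_box n M. (\<Prod>i<n. w (site \<mu> i)) * (schur \<mu> t)\<^sup>2)"
    unfolding part_box_def by (rule sum.cong) (auto simp: sdet_site)
  finally show ?thesis by simp
qed

lemma gram_tendsto:
  assumes fin: "finite (seq_support t)" and ij: "i < n" "j < n"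
  shows "(\<lambda>M. \<Sum>s\<in>{1 - int n..<1 - int n + int M}. hpoly t (s + int i) * hpoly t (s + int j))
     \<longlonglongrightarrow> hpoly_gram t (int j - int i)"
proof -
  \<comment> \<open>Counting from the bottom of the window by l = s + n - 1 turns s + i into l - (n
    - 1 - i), the form of \<open>hpoly_gram_sums\<close>.\<close>
  have eq: "(\<Sum>s\<in>{1 - int n..<1 - int n + int M}. hpoly t (s + int i) * hpoly t (s + int j)) =
     (\<Sum>l<M. hpoly t (int l - int (n - 1 - i)) * hpoly t (int l - int (n - 1 - j)))" for M
    by (rule sum.reindex_bij_witness[of _ "\<lambda>l. int l + 1 - int n" "\<lambda>s. nat (s + int n - 1)"])
       (use ij in \<open>auto simp: of_nat_diff algebra_simps\<close>)
  have "int (n - 1 - i) - int (n - 1 - j) = int j - int i" using ij by (simp add: of_nat_diff)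
  thus ?thesis unfolding eq using hpoly_gram_sums[OF fin, of "n - 1 - i" "n - 1 - j"] by (simp add: sums_def)
qed

text \<open>Andreief's identity with a weight vanishing on \<open>K\<close>.\<close>

lemma part_box_avoiding_tendsto:
  assumes fin: "finite (seq_support t)" and K: "finite K" "K \<subseteq> {1 - int n..}"
  shows "(\<lambda>M. \<Sum>\<mu>\<in>part_box n M. (if site \<mu> ` {..<n} \<inter> K = {} then 1 else 0) * (schur \<mu> t)\<^sup>2) \<longlonglongrightarrow>
    fdet n (\<lambda>i j. hpoly_gram t (int j - int i) - (\<Sum>k\<in>K. hpoly t (k + int i) * hpoly t (k + int j)))"
proof -
  define w where "w s = (if s \<in> K then 0 else 1 :: real)" for s
  have w: "(\<Prod>i<n. w (site \<mu> i)) = (if site \<mu> ` {..<n} \<inter> K = {} then 1 else 0)" for \<mu>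
  proof (cases "site \<mu> ` {..<n} \<inter> K = {}")
    case True
    hence "(\<Prod>i<n. w (site \<mu> i)) = (\<Prod>i<n. 1)" by (intro prod.cong) (auto simp: w_def)
    thus ?thesis using True by simp
  next
    case False
    then obtain i where i: "i < n" "site \<mu> i \<in> K" by auto
    hence "w (site \<mu> i) = 0" by (simp add: w_def)
    thus ?thesis using False i by (auto simp: prod_zero_iff)
  qed
  have "(\<lambda>M. \<Sum>s\<in>{1 - int n..<1 - int n + int M}. w s * hpoly t (s + int i) * hpoly t (s + int j)) \<longlonglongrightarrow>
      hpoly_gram t (int j - int i) - (\<Sum>k\<in>K. hpoly t (k + int i) * hpoly t (k + int j))" if "i < n" "j < n" for i j
  proof (rule Lim_transform_eventually)
    show "(\<lambda>M. (\<Sum>s\<in>{1 - int n..<1 - int n + int M}. hpoly t (s + int i) * hpoly t (s + int j)) - (\<Sum>k\<in>K. hpoly t (k + int i) * hpoly t (k + int j)))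
       \<longlonglongrightarrow> hpoly_gram t (int j - int i) - (\<Sum>k\<in>K. hpoly t (k + int i) * hpoly t (k + int j))"
      by (intro tendsto_diff gram_tendsto fin that tendsto_const)
    \<comment> \<open>Once the window contains K, the weight 0 on K removes exactly the terms of K
      from each Gram entry.\<close>
    define B where "B = Max (insert 0 K)"
    have B: "k \<le> B" if "k \<in> K" for k unfolding B_def using K that by simp
    show "\<forall>\<^sub>F M in sequentially. (\<Sum>s\<in>{1 - int n..<1 - int n + int M}. hpoly t (s + int i) * hpoly t (s + int j)) - (\<Sum>k\<in>K. hpoly t (k + int i) * hpoly t (k + int j)) =
       (\<Sum>s\<in>{1 - int n..<1 - int n + int M}. w s * hpoly t (s + int i) * hpoly t (s + int j))"
      using eventually_ge_at_top[of "nat (B + int n)"]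
    proof eventually_elim
      case (elim M)
      let ?A = "{1 - int n..<1 - int n + int M}"
      have sub: "K \<subseteq> ?A" using K B elim by force
      have "(\<Sum>s\<in>?A. w s * hpoly t (s + int i) * hpoly t (s + int j)) = (\<Sum>s\<in>?A - K. hpoly t (s + int i) * hpoly t (s + int j))"
        by (rule sum.mono_neutral_cong_right) (auto simp: w_def)
      also have "\<dots> = (\<Sum>s\<in>?A. hpoly t (s + int i) * hpoly t (s + int j)) - (\<Sum>k\<in>K. hpoly t (k + int i) * hpoly t (k + int j))"
        by (rule sum_diff) (use sub in auto)
      finally show ?case by simp
    qed
  qed
  thus ?thesis unfolding w[symmetric] part_box_weighted_sum by (intro tendsto_fdet)
qed

text \<open>Inclusion-exclusion: k is occupied with weight total minus avoidance of k; for two sites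
  one subtracts the avoidance of each and adds that of both. These sums increase with M, so each
  lies below its limit, a combination of determinants. The total mass \<open>fdet n G\<close> is at
  most Z and at least the weight 1 of the empty partition.\<close>

lemma part_box_correlation_bounds:
  assumes fin: "finite (seq_support t)" and k: "1 - int n \<le> k" and l: "1 - int n \<le> l" and "k \<noteq> l"
  defines "Z \<equiv> exp (\<Sum>r\<in>seq_support t. real r * (t r)\<^sup>2)"
  shows "(\<Sum>\<mu>\<in>part_box n M. (if k \<in> site \<mu> ` {..<n} then 1 else 0) * (schur \<mu> t)\<^sup>2) \<le> occupation t k * Z"
    and "(\<Sum>\<mu>\<in>part_box n M. (if k \<in> site \<mu> ` {..<n} \<and> l \<in> site \<mu> ` {..<n} then 1 else 0) * (schur \<mu> t)\<^sup>2)
      \<le> occupation t k * occupation t l * Z"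
proof -
  define G where "G i j = hpoly_gram t (int j - int i)" for i j :: nat
  define v where "v k i = hpoly t (k + int i)" for k and i :: nat
  define S where "S K M = (\<Sum>\<mu>\<in>part_box n M. (if site \<mu> ` {..<n} \<inter> K = {} then 1 else 0) * (schur \<mu> t)\<^sup>2)" for K M
  have S0: "S {} \<longlonglongrightarrow> fdet n G"
    using part_box_avoiding_tendsto[OF fin, of "{}" n] by (simp add: S_def[abs_def] G_def[abs_def])
  have Sk: "S {k} \<longlonglongrightarrow> fdet n (\<lambda>i j. G i j - v k i * v k j)" if "1 - int n \<le> k" for k
    using part_box_avoiding_tendsto[OF fin, of "{k}" n] that by (simp add: S_def[abs_def] G_def v_def)
  have Skl: "S {k, l} \<longlonglongrightarrow> fdet n (\<lambda>i j. G i j - v k i * v k j - v l i * v l j)"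
    using part_box_avoiding_tendsto[OF fin, of "{k, l}" n] k l \<open>k \<noteq> l\<close> by (simp add: S_def[abs_def] G_def v_def diff_diff_eq)
  have le_Z: "fdet n G \<le> Z"
  proof (rule LIMSEQ_le_const2[OF S0])
    show "\<exists>N. \<forall>M\<ge>N. S {} M \<le> Z"
    proof (intro exI allI impI)
      fix M
      have "part_box n M \<subseteq> partitions" by (auto simp: part_box_def)
      thus "S {} M \<le> Z" using sum_schur_square_le[OF fin, of "part_box n M"] by (simp add: S_def Z_def)
    qed
  qed
  have "1 \<le> fdet n G"
  proof (rule LIMSEQ_le_const[OF S0])
    have "1 \<le> S {} M" if "M \<ge> n" for M
    proof -
      \<comment> \<open>The sites of the empty partition, from 0 down to 1 - n, fill the first n
        places of the window.\<close>
      have "[] \<in> part_box n M" using that by (auto simp: part_box_def partitions_def site_beyond)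
      hence "(schur [] t)\<^sup>2 \<le> (\<Sum>\<mu>\<in>part_box n M. (schur \<mu> t)\<^sup>2)" by (intro member_le_sum) auto
      thus ?thesis by (simp add: S_def schur_def)
    qed
    thus "\<exists>N. \<forall>M\<ge>N. 1 \<le> S {} M" by blast
  qed
  hence pos: "fdet n G > 0" by simp
  have sym: "G i j = G j i" for i j
    using hpoly_gram_minus[OF fin, of "int j - int i"] by (simp add: G_def)
  have evaluation: "(\<Sum>i<n. c i * v k i)\<^sup>2 \<le> occupation t k * (\<Sum>i<n. \<Sum>j<n. c i * c j * G i j)" for k c
    unfolding v_def G_def by (rule evaluation_bound[OF fin])
  note occupation0 = occupation_nonneg[OF fin]
  note bounds = fdet_correlation_bounds[OF sym pos occupation0 occupation0 evaluation[where k = k] evaluation[where k = l]]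
  let ?f = "\<lambda>M. \<Sum>\<mu>\<in>part_box n M. (if k \<in> site \<mu> ` {..<n} then 1 else 0) * (schur \<mu> t)\<^sup>2"
  let ?g = "\<lambda>M. \<Sum>\<mu>\<in>part_box n M. (if k \<in> site \<mu> ` {..<n} \<and> l \<in> site \<mu> ` {..<n} then 1 else 0) * (schur \<mu> t)\<^sup>2"
  have "incseq ?f" "incseq ?g"
    by (auto simp: incseq_def intro!: sum_mono2 part_box_mono)
  have f: "?f = (\<lambda>M. S {} M - S {k} M)"
    by (auto simp: S_def sum_subtractf[symmetric] fun_eq_iff intro!: sum.cong)
  have "?f \<longlonglongrightarrow> fdet n G - fdet n (\<lambda>i j. G i j - v k i * v k j)"
    unfolding f by (intro tendsto_diff S0 Sk k)
  hence "?f M \<le> fdet n G - fdet n (\<lambda>i j. G i j - v k i * v k j)"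
    by (rule incseq_le[OF \<open>incseq ?f\<close>])
  also have "\<dots> \<le> occupation t k * fdet n G" by (rule bounds(1))
  also have "\<dots> \<le> occupation t k * Z" by (intro mult_left_mono le_Z occupation0)
  finally show "?f M \<le> occupation t k * Z" .
  have g: "?g = (\<lambda>M. S {} M - S {k} M - S {l} M + S {k, l} M)"
    by (auto simp: S_def sum_subtractf[symmetric] sum.distrib[symmetric] fun_eq_iff intro!: sum.cong)
  have "?g \<longlonglongrightarrow> fdet n G - fdet n (\<lambda>i j. G i j - v k i * v k j) - fdet n (\<lambda>i j. G i j - v l i * v l j)
      + fdet n (\<lambda>i j. G i j - v k i * v k j - v l i * v l j)"
    unfolding g by (intro tendsto_diff tendsto_add S0 Sk Skl k l)
  hence "?g M \<le> fdet n G - fdet n (\<lambda>i j. G i j - v k i * v k j) - fdet n (\<lambda>i j. G i j - v l i * v l j)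
      + fdet n (\<lambda>i j. G i j - v k i * v k j - v l i * v l j)"
    by (rule incseq_le[OF \<open>incseq ?g\<close>])
  also have "\<dots> \<le> occupation t k * occupation t l * fdet n G" by (rule bounds(2))
  also have "\<dots> \<le> occupation t k * occupation t l * Z" by (intro mult_left_mono le_Z mult_nonneg_nonneg occupation0)
  finally show "?g M \<le> occupation t k * occupation t l * Z" .
qed

lemma range_site_iff:
  assumes "length \<mu> \<le> n" "1 - int n \<le> k"
  shows "k \<in> range (site \<mu>) \<longleftrightarrow> k \<in> site \<mu> ` {..<n}"
proof
  assume "k \<in> range (site \<mu>)"
  then obtain i where i: "k = site \<mu> i" by auto
  have "i < n"
  proof (rule ccontr)
    assume "\<not> i < n"
    hence "site \<mu> i = - int i" using assms by (intro site_beyond) auto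
    thus False using i assms \<open>\<not> i < n\<close> by simp
  qed
  thus "k \<in> site \<mu> ` {..<n}" using i by auto
qed auto

lemma finite_partitions_in_box:
  assumes "finite \<Lambda>" "\<Lambda> \<subseteq> partitions"
  obtains n M where "\<Lambda> \<subseteq> part_box n M" "1 - int n \<le> k" "1 - int n \<le> l"
proof -
  define n where "n = Max (insert 0 (length ` \<Lambda>)) + nat (- k) + nat (- l) + 1"
  define M where "M = n + Max (insert 0 (sum_list ` \<Lambda>)) + 1"
  have len: "length \<mu> \<le> n" if "\<mu> \<in> \<Lambda>" for \<mu>
  proof -
    have "length \<mu> \<le> Max (insert 0 (length ` \<Lambda>))" using assms that by (intro Max_ge) auto
    thus ?thesis by (simp add: n_def)
  qed
  have "\<Lambda> \<subseteq> part_box n M"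
  proof
    fix \<mu> assume mu: "\<mu> \<in> \<Lambda>"
    have "sum_list \<mu> \<le> Max (insert 0 (sum_list ` \<Lambda>))" using assms mu by (intro Max_ge) auto
    hence M: "n + sum_list \<mu> < M" by (simp add: M_def)
    have "site \<mu> i \<in> {1 - int n..<1 - int n + int M}" if "i < n" for i
    proof -
      have "part \<mu> (Suc i) \<le> sum_list \<mu>" by (auto simp: part_def intro: elem_le_sum_list)
      thus ?thesis using M that by (simp add: site_def)
    qed
    thus "\<mu> \<in> part_box n M" using len[OF mu] assms mu by (auto simp: part_box_def)
  qed
  thus ?thesis by (rule that) (auto simp: n_def)
qed

text \<open>For finitely many partitions, n can be so large that all of them have at most n parts
  and that k and l are at least 1 - n. The sites left out by the box, those below 1 - n, are
  occupied in all these partitions.\<close>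

lemma correlation_bounds:
  assumes fin: "finite (seq_support t)" and L: "finite \<Lambda>" "\<Lambda> \<subseteq> partitions"
  defines "Z \<equiv> exp (\<Sum>r\<in>seq_support t. real r * (t r)\<^sup>2)"
  shows "(\<Sum>\<mu> | \<mu> \<in> \<Lambda> \<and> k \<in> range (site \<mu>). (schur \<mu> t)\<^sup>2) \<le> occupation t k * Z"
    and "k \<noteq> l \<Longrightarrow> (\<Sum>\<mu> | \<mu> \<in> \<Lambda> \<and> k \<in> range (site \<mu>) \<and> l \<in> range (site \<mu>). (schur \<mu> t)\<^sup>2) \<le> occupation t k * occupation t l * Z"
proof -
  \<comment> \<open>The box lemma wants two distinct sites; k + 1 stands in for l when k = l, a case
    in which only the bound for k is claimed.\<close>
  obtain n M where nM: "\<Lambda> \<subseteq> part_box n M" "1 - int n \<le> k" "1 - int n \<le> (if k = l then k + 1 else l)"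
    by (rule finite_partitions_in_box[OF L])
  have iff: "k' \<in> range (site \<mu>) \<longleftrightarrow> k' \<in> site \<mu> ` {..<n}" if "\<mu> \<in> \<Lambda>" "1 - int n \<le> k'" for \<mu> k'
    using that nM by (intro range_site_iff) (auto simp: part_box_def)
  have le: "(\<Sum>\<mu> | \<mu> \<in> \<Lambda> \<and> P \<mu>. (schur \<mu> t)\<^sup>2) \<le> (\<Sum>\<mu>\<in>part_box n M. (if Q \<mu> then 1 else 0) * (schur \<mu> t)\<^sup>2)"
    if "\<And>\<mu>. \<mu> \<in> \<Lambda> \<Longrightarrow> P \<mu> \<Longrightarrow> Q \<mu>" for P Q
  proof -
    have "(\<Sum>\<mu> | \<mu> \<in> \<Lambda> \<and> P \<mu>. (schur \<mu> t)\<^sup>2) = (\<Sum>\<mu> | \<mu> \<in> \<Lambda> \<and> P \<mu>. (if Q \<mu> then 1 else 0) * (schur \<mu> t)\<^sup>2)"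
      using that by (intro sum.cong) auto
    also have "\<dots> \<le> (\<Sum>\<mu>\<in>part_box n M. (if Q \<mu> then 1 else 0) * (schur \<mu> t)\<^sup>2)"
      by (rule sum_mono2) (use nM in auto)
    finally show ?thesis .
  qed
  have "k \<noteq> (if k = l then k + 1 else l)" by auto
  note b = part_box_correlation_bounds[OF fin nM(2,3) this, folded Z_def, of M]
  show "(\<Sum>\<mu> | \<mu> \<in> \<Lambda> \<and> k \<in> range (site \<mu>). (schur \<mu> t)\<^sup>2) \<le> occupation t k * Z"
    by (rule order_trans[OF le b(1)]) (use iff nM in auto)
  assume "k \<noteq> l"
  show "(\<Sum>\<mu> | \<mu> \<in> \<Lambda> \<and> k \<in> range (site \<mu>) \<and> l \<in> range (site \<mu>). (schur \<mu> t)\<^sup>2) \<le> occupation t k * occupation t l * Z"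
    by (rule order_trans[OF le b(2)[unfolded if_not_P[OF \<open>k \<noteq> l\<close>]]])
       (use iff nM \<open>k \<noteq> l\<close> in auto)
qed

section \<open>The limiting law of the symbol coefficients\<close>

definition circle_measure :: "real measure" where
  "circle_measure = density lborel (\<lambda>\<phi>. ennreal (indicator {-pi..pi} \<phi> / (2 * pi)))"

lemma sets_circle_measure [measurable_cong, simp]: "sets circle_measure = sets borel"
  by (simp add: circle_measure_def)

lemma space_circle_measure [simp]: "space circle_measure = UNIV"
  by (simp add: circle_measure_def)

lemma prob_space_circle_measure: "prob_space circle_measure"
proof
  have "emeasure circle_measure (space circle_measure) = (\<integral>\<^sup>+\<phi>. ennreal (1 / (2 * pi)) * indicator {-pi..pi} \<phi> \<partial>lborel)"
    unfolding circle_measure_def by (subst emeasure_density) (auto intro!: nn_integral_cong simp: indicator_def)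
  also have "\<dots> = ennreal (1 / (2 * pi)) * ennreal (2 * pi)"
    by (subst nn_integral_cmult_indicator) auto
  also have "\<dots> = 1" by (simp flip: ennreal_mult'')
  finally show "emeasure circle_measure (space circle_measure) = 1" .
qed

interpretation circle: prob_space circle_measure by (rule prob_space_circle_measure)

lemma integral_circle_measure:
  fixes f :: "real \<Rightarrow> 'a :: {banach, second_countable_topology}"
  assumes "continuous_on UNIV f"
  shows "(\<integral>\<phi>. f \<phi> \<partial>circle_measure) = (\<integral>\<phi>. indicator {-pi..pi} \<phi> *\<^sub>R f \<phi> \<partial>lborel) /\<^sub>R (2 * pi)"
proof -
  have [measurable]: "f \<in> borel_measurable borel" by (rule borel_measurable_continuous_onI[OF assms])
  have "continuous_on {-pi..pi} f" using assms by (rule continuous_on_subset) simp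
  hence int: "integrable lborel (\<lambda>\<phi>. indicator {-pi..pi} \<phi> *\<^sub>R f \<phi>)"
    using borel_integrable_atLeastAtMost'[of "-pi" pi f] by (simp add: set_integrable_def)
  have "(\<integral>\<phi>. f \<phi> \<partial>circle_measure) = (\<integral>\<phi>. (indicator {-pi..pi} \<phi> / (2 * pi)) *\<^sub>R f \<phi> \<partial>lborel)"
    unfolding circle_measure_def by (rule integral_density) auto
  also have "\<dots> = (\<integral>\<phi>. inverse (2 * pi) *\<^sub>R (indicator {-pi..pi} \<phi> *\<^sub>R f \<phi>) \<partial>lborel)"
    by (intro Bochner_Integration.integral_cong) (auto simp: field_simps)
  also have "\<dots> = (\<integral>\<phi>. indicator {-pi..pi} \<phi> *\<^sub>R f \<phi> \<partial>lborel) /\<^sub>R (2 * pi)"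
    using int by (intro integral_scaleR_right)
  finally show ?thesis .
qed

lemma circle_integrable:
  fixes f :: "real \<Rightarrow> 'a :: {banach, second_countable_topology}"
  assumes "continuous_on UNIV f" "\<And>x. norm (f x) \<le> C"
  shows "integrable circle_measure f"
proof (rule circle.integrable_const_bound[of _ C])
  have "f \<in> borel_measurable borel" by (rule borel_measurable_continuous_onI[OF assms(1)])
  thus "f \<in> borel_measurable circle_measure" by measurable
qed (use assms in auto)

lemma circle_integral_cis:
  fixes k :: int
  shows "(\<integral>\<phi>. cis (of_int k * \<phi>) \<partial>circle_measure) = (if k = 0 then 1 else 0)"
proof (cases "k = 0")
  case True
  thus ?thesis by (simp add: circle.prob_space[simplified])
next
  case False
  define F where "F = (\<lambda>\<phi>. cis (of_int k * \<phi>) / (\<i> * of_int k))"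
  have cont: "continuous_on UNIV (\<lambda>\<phi>. cis (of_int k * \<phi>))"
    by (intro continuous_intros)
  have "(F has_vector_derivative cis (of_int k * x)) (at x within {-pi..pi})" for x
  proof -
    have "((\<lambda>z. exp (\<i> * of_int k * z) / (\<i> * of_int k)) has_field_derivative exp (\<i> * of_int k * of_real x)) (at (of_real x))"
      using False by (auto intro!: derivative_eq_intros)
    from has_vector_derivative_real_field[OF this, of "{-pi..pi}"]
    show ?thesis unfolding F_def by (simp add: cis_conv_exp mult_ac)
  qed
  hence "(\<integral>\<phi>. indicator {-pi..pi} \<phi> *\<^sub>R cis (of_int k * \<phi>) \<partial>lborel) = F pi - F (- pi)"
    by (intro integral_FTC_atLeastAtMost continuous_intros) auto
  also have "cis (of_int k * pi) = cis (of_int k * (- pi))"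
    by (simp add: cis.ctr sin_times_pi_eq_0)
  hence "F pi - F (- pi) = 0" by (simp add: F_def)
  finally show ?thesis using False by (simp add: integral_circle_measure[OF cont])
qed

section \<open>Fourier series with absolutely summable coefficients\<close>

definition fourier :: "(int \<Rightarrow> complex) \<Rightarrow> real \<Rightarrow> complex" where
  "fourier a \<phi> = (\<Sum>\<^sub>\<infinity>j. a j * cis (of_int j * \<phi>))"

lemma has_sum_int_tendsto:
  fixes f :: "int \<Rightarrow> 'a :: {comm_monoid_add, topological_space}"
  assumes "(f has_sum S) UNIV"
  shows "(\<lambda>N. \<Sum>j\<in>{- int N..int N}. f j) \<longlonglongrightarrow> S"
proof -
  have "filterlim (\<lambda>N. {- int N..int N}) (finite_subsets_at_top UNIV) sequentially"
    unfolding filterlim_def le_filter_def eventually_filtermap eventually_finite_subsets_at_top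
  proof (intro allI impI, elim exE conjE)
    fix P and X :: "int set"
    assume X: "finite X" and P: "\<forall>Y. finite Y \<and> X \<subseteq> Y \<and> Y \<subseteq> UNIV \<longrightarrow> P Y"
    define B where "B = Max (insert 0 ((\<lambda>x. nat \<bar>x\<bar>) ` X))"
    have B: "nat \<bar>x\<bar> \<le> B" if "x \<in> X" for x unfolding B_def using X that by (intro Max_ge) auto
    show "\<forall>\<^sub>F N in sequentially. P {- int N..int N}"
      using eventually_ge_at_top[of B]
    proof eventually_elim
      case (elim N)
      have "X \<subseteq> {- int N..int N}"
      proof
        fix x assume "x \<in> X"
        from B[OF this] elim show "x \<in> {- int N..int N}" by auto
      qed
      thus ?case using P by auto
    qed
  qed
  from filterlim_compose[OF assms[unfolded has_sum_def] this] show ?thesis .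
qed

lemma fourier_has_sum:
  assumes "(\<lambda>j. norm (a j)) summable_on UNIV"
  shows "((\<lambda>j. a j * cis (of_int j * \<phi>)) has_sum fourier a \<phi>) UNIV"
  unfolding fourier_def
  by (rule has_sum_infsum, rule abs_summable_summable) (use assms in \<open>simp add: norm_mult\<close>)

text \<open>Orthogonality of the exponentials gives the identity for symmetric partial sums, which
  converge pointwise and whose products are dominated by the product of the l1 norms of a and
  b.\<close>

lemma parseval:
  assumes a: "(\<lambda>j. norm (a j)) summable_on UNIV" and b: "(\<lambda>j. norm (b j)) summable_on UNIV"
  shows "((\<lambda>j. a j * cnj (b j)) has_sum (\<integral>\<phi>. fourier a \<phi> * cnj (fourier b \<phi>) \<partial>circle_measure)) UNIV"
proof -
  define P where "P a N \<phi> = (\<Sum>j\<in>{- int N..int N}. a j * cis (of_int j * \<phi>))" for a :: "int \<Rightarrow> complex" and N \<phi>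
  have P_lim: "(\<lambda>N. P a N \<phi>) \<longlonglongrightarrow> fourier a \<phi>" if "(\<lambda>j. norm (a j)) summable_on UNIV" for a \<phi>
    unfolding P_def by (rule has_sum_int_tendsto[OF fourier_has_sum[OF that]])
  have P_bd: "norm (P a N \<phi>) \<le> infsum (\<lambda>j. norm (a j)) UNIV" if "(\<lambda>j. norm (a j)) summable_on UNIV" for a N \<phi>
  proof -
    have "norm (P a N \<phi>) \<le> (\<Sum>j\<in>{- int N..int N}. norm (a j))"
      unfolding P_def by (rule sum_norm_le) (simp add: norm_mult)
    also have "\<dots> \<le> infsum (\<lambda>j. norm (a j)) UNIV"
      using that by (intro finite_sum_le_infsum) auto
    finally show ?thesis .
  qed
  have P_meas [measurable]: "P a N \<in> borel_measurable borel" for a N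
    unfolding P_def by (intro borel_measurable_continuous_onI continuous_intros)
  have [measurable]: "cnj \<in> borel_measurable borel"
    by (intro borel_measurable_continuous_onI continuous_on_cnj continuous_on_id)
  have P_int: "(\<integral>\<phi>. P a N \<phi> * cnj (P b N \<phi>) \<partial>circle_measure) = (\<Sum>j\<in>{- int N..int N}. a j * cnj (b j))" for N
  proof -
    have "P a N \<phi> * cnj (P b N \<phi>) = (\<Sum>j\<in>{- int N..int N}. \<Sum>k\<in>{- int N..int N}. a j * cnj (b k) * cis (of_int (j - k) * \<phi>))" for \<phi>
    proof -
      have "a j * cis (of_int j * \<phi>) * cnj (b k * cis (of_int k * \<phi>)) = a j * cnj (b k) * cis (of_int (j - k) * \<phi>)" for j k
      proof -
        have "cis (of_int (j - k) * \<phi>) = cis (of_int j * \<phi>) * cnj (cis (of_int k * \<phi>))"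
          by (simp add: cis_cnj cis_mult left_diff_distrib)
        thus ?thesis by (simp only: complex_cnj_mult mult_ac)
      qed
      thus ?thesis unfolding P_def cnj_sum sum_product by (simp only:)
    qed
    hence "(\<integral>\<phi>. P a N \<phi> * cnj (P b N \<phi>) \<partial>circle_measure) =
      (\<integral>\<phi>. (\<Sum>j\<in>{- int N..int N}. \<Sum>k\<in>{- int N..int N}. a j * cnj (b k) * cis (of_int (j - k) * \<phi>)) \<partial>circle_measure)"
      by simp
    also have "\<dots> = (\<Sum>j\<in>{- int N..int N}. \<Sum>k\<in>{- int N..int N}. \<integral>\<phi>. a j * cnj (b k) * cis (of_int (j - k) * \<phi>) \<partial>circle_measure)"
    proof -
      have I: "integrable circle_measure (\<lambda>\<phi>. a j * cnj (b k) * cis (of_int (j - k) * \<phi>))" for j k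
        by (rule circle_integrable[of _ "norm (a j * cnj (b k))"]) (auto intro!: continuous_intros simp: norm_mult)
      show ?thesis by (simp only: I Bochner_Integration.integral_sum Bochner_Integration.integrable_sum)
    qed
    also have "\<dots> = (\<Sum>j\<in>{- int N..int N}. \<Sum>k\<in>{- int N..int N}. if k = j then a j * cnj (b j) else 0)"
      by (intro sum.cong refl) (simp add: circle_integral_cis del: of_int_diff)
    also have "\<dots> = (\<Sum>j\<in>{- int N..int N}. a j * cnj (b j))"
      by (intro sum.cong refl) (simp add: sum.delta)
    finally show ?thesis .
  qed
  have lim: "(\<lambda>N. \<integral>\<phi>. P a N \<phi> * cnj (P b N \<phi>) \<partial>circle_measure) \<longlonglongrightarrow> (\<integral>\<phi>. fourier a \<phi> * cnj (fourier b \<phi>) \<partial>circle_measure)"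
  proof (rule integral_dominated_convergence[where w = "\<lambda>_. infsum (\<lambda>j. norm (a j)) UNIV * infsum (\<lambda>j. norm (b j)) UNIV"])
    show "AE x in circle_measure. (\<lambda>i. P a i x * cnj (P b i x)) \<longlonglongrightarrow> fourier a x * cnj (fourier b x)"
      by (intro AE_I2 tendsto_mult tendsto_cnj P_lim a b)
    show "AE x in circle_measure. norm (P a i x * cnj (P b i x)) \<le> infsum (\<lambda>j. norm (a j)) UNIV * infsum (\<lambda>j. norm (b j)) UNIV" for i
      unfolding norm_mult complex_mod_cnj by (intro AE_I2 mult_mono P_bd a b infsum_nonneg) auto
    have "fourier a \<in> borel_measurable borel" if "(\<lambda>j. norm (a j)) summable_on UNIV" for a
      by (rule borel_measurable_LIMSEQ_metric[OF P_meas P_lim[OF that]])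
    from this[OF a] this[OF b] have [measurable]: "fourier a \<in> borel_measurable borel" "fourier b \<in> borel_measurable borel" .
    show "(\<lambda>\<phi>. fourier a \<phi> * cnj (fourier b \<phi>)) \<in> borel_measurable circle_measure"
      by measurable
    show "(\<lambda>\<phi>. P a i \<phi> * cnj (P b i \<phi>)) \<in> borel_measurable circle_measure" for i
      by measurable
    show "integrable circle_measure (\<lambda>_. infsum (\<lambda>j. norm (a j)) UNIV * infsum (\<lambda>j. norm (b j)) UNIV)"
      by (rule circle.integrable_const)
  qed
  have "(\<lambda>j. a j * cnj (b j)) summable_on UNIV"
  proof (rule abs_summable_summable, rule summable_on_comparison_test)
    show "(\<lambda>j. norm (a j) * infsum (\<lambda>j. norm (b j)) UNIV) summable_on UNIV"
      by (rule summable_on_cmult_left[OF a])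
    have "norm (b j) \<le> infsum (\<lambda>j. norm (b j)) UNIV" for j
      using finite_sum_le_infsum[OF b, of "{j}"] by simp
    thus "norm (a j * cnj (b j)) \<le> norm (a j) * infsum (\<lambda>j. norm (b j)) UNIV" for j
      by (simp add: norm_mult mult_left_mono)
  qed simp
  then obtain S where S: "((\<lambda>j. a j * cnj (b j)) has_sum S) UNIV" by (auto simp: summable_on_def)
  moreover have "S = (\<integral>\<phi>. fourier a \<phi> * cnj (fourier b \<phi>) \<partial>circle_measure)"
    by (rule LIMSEQ_unique[OF has_sum_int_tendsto[OF S]]) (use lim in \<open>simp only: P_int\<close>)
  ultimately show ?thesis by simp
qed

lemma geometric_int_summable: "(\<lambda>j::int. C * (1/2::real) ^ nat \<bar>j\<bar>) summable_on UNIV"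
proof (rule summable_on_cmult_right)
  have geo: "(\<lambda>m. (1/2::real) ^ m) summable_on (UNIV :: nat set)"
    by (rule norm_summable_imp_summable_on) (simp add: summable_geometric)
  have "(\<lambda>j::int. (1/2::real) ^ nat \<bar>j\<bar>) summable_on (range int)"
    by (subst summable_on_reindex) (auto simp: comp_def geo)
  moreover have "(\<lambda>j::int. (1/2::real) ^ nat \<bar>j\<bar>) summable_on (range (\<lambda>n. - int n))"
    by (subst summable_on_reindex) (auto simp: comp_def geo inj_def)
  ultimately have "(\<lambda>j::int. (1/2::real) ^ nat \<bar>j\<bar>) summable_on (range int \<union> range (\<lambda>n. - int n))"
    by (rule summable_on_union)
  also have "range int \<union> range (\<lambda>n. - int n) = UNIV"
    by (auto intro: int_cases2)
  finally show "(\<lambda>j::int. (1/2::real) ^ nat \<bar>j\<bar>) summable_on UNIV" .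
qed

lemma has_sum_finite_sum:
  fixes f :: "'a \<Rightarrow> 'b \<Rightarrow> 'c :: topological_comm_monoid_add"
  assumes "\<And>r. r \<in> R \<Longrightarrow> (f r has_sum S r) A"
  shows "((\<lambda>x. \<Sum>r\<in>R. f r x) has_sum (\<Sum>r\<in>R. S r)) A"
  using assms by (induction R rule: infinite_finite_induct) (auto intro!: has_sum_add has_sum_0)

section \<open>The symbol on the unit circle\<close>

definition phase :: "(nat \<Rightarrow> real) \<Rightarrow> real \<Rightarrow> real" where
  "phase t \<phi> = 2 * (\<Sum>r\<in>seq_support t. t r * sin (real r * \<phi>))"

text \<open>The derivative of \<open>phase t\<close>, and the function \<xi> of the overview when t
  is \<gamma>. Multiplying the symbol coefficients by their index multiplies the symbol by this
  function.\<close>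

definition slope :: "(nat \<Rightarrow> real) \<Rightarrow> real \<Rightarrow> real" where
  "slope t \<phi> = 2 * (\<Sum>r\<in>seq_support t. real r * t r * cos (real r * \<phi>))"

lemma symbol_coeff_abs_summable:
  assumes fin: "finite (seq_support t)"
  shows "(\<lambda>j. norm (complex_of_real (symbol_coeff t (j + c)))) summable_on UNIV"
proof -
  obtain C where C: "C > 0" "\<And>n. \<bar>symbol_coeff t n\<bar> \<le> C * (1/2) ^ nat \<bar>n\<bar>" using symbol_coeff_decay[OF fin] by blast
  have "(\<lambda>j. norm (complex_of_real (symbol_coeff t j))) summable_on UNIV"
    by (rule summable_on_comparison_test[OF geometric_int_summable[of C]]) (use C in auto)
  hence "((\<lambda>j. norm (complex_of_real (symbol_coeff t j))) \<circ> (\<lambda>j. j + c)) summable_on UNIV"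
    by (subst summable_on_reindex[symmetric]) auto
  thus ?thesis by (simp add: comp_def)
qed

text \<open>The double series over n and m is summed in both orders. Over m first it gives the
  Fourier series of the coefficients; over n first it gives exp(V(z)) exp(-V(1/z)) at the point z
  with argument \<phi>. As z^r - z^{-r} is 2 i sin(r \<phi>), the exponent is purely
  imaginary.\<close>

lemma fourier_symbol_coeff:
  assumes fin: "finite (seq_support t)"
  shows "fourier (\<lambda>j. complex_of_real (symbol_coeff t j)) \<phi> = cis (phase t \<phi>)"
proof -
  define h where "h = hpoly t"
  define g where "g = hpoly (\<lambda>r. - t r)"
  define H where "H = exp (\<Sum>r\<in>seq_support t. of_real (t r) * cis \<phi> ^ r)"
  define G where "G = exp (\<Sum>r\<in>seq_support t. of_real (- t r) * cis (- \<phi>) ^ r)"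
  define F where "F = (\<lambda>(n::int, m::nat). complex_of_real (h (int m + n) * g (int m)) * cis (of_int n * \<phi>))"
  obtain C where C: "C > 0" "\<And>m n. \<bar>h (int m + n) * g (int m)\<bar> \<le> C * (1/2) ^ nat \<bar>n\<bar> * (1/2) ^ m"
    "\<And>n. \<bar>symbol_coeff t n\<bar> \<le> C * (1/2) ^ nat \<bar>n\<bar>"
    "\<And>n. (\<lambda>m. h (int m + n) * g (int m)) sums symbol_coeff t n"
    unfolding h_def g_def by (rule symbol_coeff_bounds[OF fin]) blast
  have geo: "(\<lambda>m. (1/2::real) ^ m) summable_on UNIV"
    by (rule norm_summable_imp_summable_on) (simp add: summable_geometric)
  have "(\<lambda>(n::int, m). C * (1/2) ^ nat \<bar>n\<bar> * (1/2) ^ m) summable_on (UNIV \<times> UNIV)"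
  proof (rule summable_on_SigmaI)
    show "((\<lambda>m. case (n, m) of (n::int, m) \<Rightarrow> C * (1/2) ^ nat \<bar>n\<bar> * (1/2) ^ m) has_sum (C * (1/2) ^ nat \<bar>n\<bar> * infsum (\<lambda>m. (1/2) ^ m) UNIV)) UNIV" for n
      unfolding prod.case by (intro has_sum_cmult_right has_sum_infsum geo)
    show "(\<lambda>n::int. C * (1/2) ^ nat \<bar>n\<bar> * infsum (\<lambda>m. (1/2::real) ^ m) (UNIV :: nat set)) summable_on UNIV"
      by (intro summable_on_cmult_left geometric_int_summable)
  qed (use C in auto)
  hence "(\<lambda>x. norm (F x)) summable_on (UNIV \<times> UNIV)"
    by (rule summable_on_comparison_test) (use C(2) in \<open>auto simp: F_def norm_mult simp flip: abs_mult of_real_mult\<close>)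
  hence "F summable_on (UNIV \<times> UNIV)" by (rule abs_summable_summable)
  then obtain S where S: "(F has_sum S) (UNIV \<times> UNIV)" by (auto simp: summable_on_def)
  have "((\<lambda>n. complex_of_real (symbol_coeff t n) * cis (of_int n * \<phi>)) has_sum S) UNIV"
  proof (rule has_sum_SigmaD[OF S])
    fix n :: int
    have "((\<lambda>m. h (int m + n) * g (int m)) has_sum symbol_coeff t n) UNIV"
    proof (rule norm_summable_imp_has_sum[OF _ C(4)])
      show "summable (\<lambda>m. norm (h (int m + n) * g (int m)))"
        by (rule summable_comparison_test'[of "\<lambda>m. C * (1/2) ^ nat \<bar>n\<bar> * (1/2) ^ m"])
           (use C(2)[of _ n] in \<open>auto intro!: summable_mult summable_geometric\<close>)
    qed
    from has_sum_cmult_left[OF has_sum_of_real[OF this], of "cis (of_int n * \<phi>)"]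
    show "((\<lambda>m. F (n, m)) has_sum complex_of_real (symbol_coeff t n) * cis (of_int n * \<phi>)) UNIV"
      by (simp add: F_def)
  qed
  moreover have "((\<lambda>n. complex_of_real (symbol_coeff t n) * cis (of_int n * \<phi>)) has_sum fourier (\<lambda>j. complex_of_real (symbol_coeff t j)) \<phi>) UNIV"
    using symbol_coeff_abs_summable[OF fin, of 0] by (intro fourier_has_sum) simp
  ultimately have 1: "fourier (\<lambda>j. complex_of_real (symbol_coeff t j)) \<phi> = S" by (rule has_sum_unique[symmetric])
  have pow: "((\<lambda>n::nat. of_real (hpoly u (int n)) * z ^ n) has_sum exp (\<Sum>r\<in>seq_support u. of_real (u r) * z ^ r)) UNIV"
    if fin: "finite (seq_support u)" and z: "norm z = 1" for u and z :: complex
  proof (rule norm_summable_imp_has_sum[OF _ hpoly_sums_exp[OF fin]])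
    obtain A where A: "A > 0" "\<And>k. \<bar>hpoly u k\<bar> \<le> A * (1/2) ^ nat k"
      by (rule hpoly_abs_bound[OF fin, of "1/2"]) (simp, simp, blast)
    show "summable (\<lambda>n. norm (of_real (hpoly u (int n)) * z ^ n))"
      by (rule summable_comparison_test'[of "\<lambda>n. A * (1/2) ^ n"])
         (use A(2)[of "int n" for n] z in \<open>auto simp: norm_mult norm_power intro!: summable_mult summable_geometric\<close>)
  qed
  have "(\<lambda>n::nat. complex_of_real (hpoly t (int n)) * cis \<phi> ^ n) = (\<lambda>k::int. of_real (h k) * cis (of_int k * \<phi>)) \<circ> int"
    by (simp add: fun_eq_iff h_def Complex.DeMoivre)
  hence "(((\<lambda>k::int. of_real (h k) * cis (of_int k * \<phi>)) \<circ> int) has_sum H) UNIV"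
    using pow[OF fin, of "cis \<phi>"] by (simp add: H_def)
  hence "((\<lambda>k::int. of_real (h k) * cis (of_int k * \<phi>)) has_sum H) (range int)"
    by (subst has_sum_reindex) auto
  moreover have "((\<lambda>k::int. of_real (h k) * cis (of_int k * \<phi>)) has_sum H) (range int) \<longleftrightarrow>
      ((\<lambda>k::int. of_real (h k) * cis (of_int k * \<phi>)) has_sum H) UNIV"
  proof (rule has_sum_cong_neutral)
    fix k :: int assume "k \<in> UNIV - range int"
    hence "k < 0" by (metis DiffD2 nonneg_int_cases not_le rangeI)
    thus "complex_of_real (h k) * cis (of_int k * \<phi>) = 0" by (simp add: h_def)
  qed auto
  ultimately have hH: "((\<lambda>k::int. of_real (h k) * cis (of_int k * \<phi>)) has_sum H) UNIV" by simp
  have "((\<lambda>(m, n). F (n, m)) has_sum S) (UNIV \<times> UNIV)"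
    using S by (subst (asm) has_sum_swap)
  hence "((\<lambda>m. of_real (g (int m)) * cis (- \<phi>) ^ m * H) has_sum S) UNIV"
  proof (rule has_sum_SigmaD)
    fix m :: nat
    have "((\<lambda>n. of_real (h (int m + n)) * cis (of_int (int m + n) * \<phi>)) has_sum H) UNIV"
      by (subst has_sum_reindex_bij_witness[where i = "\<lambda>k. k - int m" and j = "\<lambda>n. int m + n" and T = UNIV
          and h = "\<lambda>k. of_real (h k) * cis (of_int k * \<phi>)"]) (use hH in auto)
    from has_sum_cmult_right[OF this, of "of_real (g (int m)) * cis (- \<phi>) ^ m"]
    have "((\<lambda>n. of_real (g (int m)) * cis (- \<phi>) ^ m * (of_real (h (int m + n)) * cis (of_int (int m + n) * \<phi>))) has_sum
       of_real (g (int m)) * cis (- \<phi>) ^ m * H) UNIV" .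
    also have "(\<lambda>n. of_real (g (int m)) * cis (- \<phi>) ^ m * (of_real (h (int m + n)) * cis (of_int (int m + n) * \<phi>))) = (\<lambda>n. F (n, m))"
    proof
      fix n
      have "cis (- \<phi>) ^ m * cis (of_int (int m + n) * \<phi>) = cis (of_int n * \<phi>)"
        by (simp add: Complex.DeMoivre cis_mult algebra_simps)
      thus "of_real (g (int m)) * cis (- \<phi>) ^ m * (of_real (h (int m + n)) * cis (of_int (int m + n) * \<phi>)) = F (n, m)"
        by (simp add: F_def mult_ac)
    qed
    finally show "((\<lambda>n. case (m, n) of (m, n) \<Rightarrow> F (n, m)) has_sum of_real (g (int m)) * cis (- \<phi>) ^ m * H) UNIV"
      by simp
  qed
  moreover have "((\<lambda>m. of_real (g (int m)) * cis (- \<phi>) ^ m * H) has_sum G * H) UNIV"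
    unfolding g_def G_def using pow[of "\<lambda>r. - t r" "cis (- \<phi>)"] fin by (intro has_sum_cmult_left) simp
  ultimately have "S = G * H" by (rule has_sum_unique)
  also have "\<dots> = exp (\<i> * of_real (phase t \<phi>))"
    unfolding G_def H_def exp_add[symmetric]
  proof (rule arg_cong[where f = exp])
    show "(\<Sum>r\<in>seq_support t. of_real (- t r) * cis (- \<phi>) ^ r) + (\<Sum>r\<in>seq_support t. of_real (t r) * cis \<phi> ^ r) = \<i> * of_real (phase t \<phi>)"
      unfolding sum.distrib[symmetric] phase_def of_real_mult of_real_sum sum_distrib_left
      by (intro sum.cong refl) (simp add: Complex.DeMoivre complex_eq_iff)
  qed
  finally show ?thesis using 1 by (simp add: cis_conv_exp)
qed

lemma symbol_coeff_sums:
  assumes fin: "finite (seq_support t)"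
  shows "(\<lambda>m. hpoly t (int m + n) * hpoly (\<lambda>r. - t r) (int m)) sums symbol_coeff t n"
  by (rule symbol_coeff_bounds[OF fin])

text \<open>Coefficientwise form of z d/dz applied to the symbol, whose logarithmic derivative in
  this sense is the sum of r t_r (z^r + z^{-r}). One writes n = (m + n) - m and uses Euler's
  identity in each factor. When t_1 is the only time it is the three-term recurrence of the Bessel
  functions.\<close>

lemma symbol_coeff_rec:
  assumes fin: "finite (seq_support t)"
  shows "of_int n * symbol_coeff t n = (\<Sum>r\<in>seq_support t. real r * t r * (symbol_coeff t (n - int r) + symbol_coeff t (n + int r)))"
proof -
  let ?h = "hpoly t" and ?g = "hpoly (\<lambda>r. - t r)"
  have "(\<lambda>m. \<Sum>r\<in>seq_support t. real r * t r * (?h (int m + (n - int r)) * ?g (int m))) sums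
      (\<Sum>r\<in>seq_support t. real r * t r * symbol_coeff t (n - int r))"
    by (intro sums_sum sums_mult symbol_coeff_sums fin)
  also have "(\<lambda>m. \<Sum>r\<in>seq_support t. real r * t r * (?h (int m + (n - int r)) * ?g (int m))) =
      (\<lambda>m. (of_int (int m + n) * ?h (int m + n)) * ?g (int m))"
    unfolding hpoly_euler[OF fin] sum_distrib_right by (simp add: algebra_simps)
  finally have 1: "(\<lambda>m. (of_int (int m + n) * ?h (int m + n)) * ?g (int m)) sums
      (\<Sum>r\<in>seq_support t. real r * t r * symbol_coeff t (n - int r))" .
  have "(\<lambda>m. ?h (int m + n) * ?g (int m - int r)) sums symbol_coeff t (n + int r)" for r
  proof -
    have "(\<lambda>m. ?h (int (m + r) + n) * ?g (int (m + r) - int r)) sums symbol_coeff t (n + int r)"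
      using symbol_coeff_sums[OF fin, of "n + int r"] by (simp add: algebra_simps)
    thus ?thesis by (subst (asm) sums_zero_iff_shift) auto
  qed
  hence "(\<lambda>m. \<Sum>r\<in>seq_support t. (- (real r * t r)) * (?h (int m + n) * ?g (int m - int r))) sums
      (\<Sum>r\<in>seq_support t. (- (real r * t r)) * symbol_coeff t (n + int r))"
    by (intro sums_sum sums_mult)
  also have "(\<lambda>m. \<Sum>r\<in>seq_support t. (- (real r * t r)) * (?h (int m + n) * ?g (int m - int r))) =
      (\<lambda>m. ?h (int m + n) * (of_int (int m) * ?g (int m)))"
  proof
    fix m
    have "of_int (int m) * ?g (int m) = (\<Sum>r\<in>seq_support t. (- (real r * t r)) * ?g (int m - int r))"
      using hpoly_euler[of "\<lambda>r. - t r" "int m"] fin by simp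
    thus "(\<Sum>r\<in>seq_support t. (- (real r * t r)) * (?h (int m + n) * ?g (int m - int r))) = ?h (int m + n) * (of_int (int m) * ?g (int m))"
      by (simp only: sum_distrib_left mult.left_commute)
  qed
  finally have 2: "(\<lambda>m. ?h (int m + n) * (of_int (int m) * ?g (int m))) sums
      (\<Sum>r\<in>seq_support t. (- (real r * t r)) * symbol_coeff t (n + int r))" .
  have "(\<lambda>m. of_int n * (?h (int m + n) * ?g (int m))) sums
      ((\<Sum>r\<in>seq_support t. real r * t r * symbol_coeff t (n - int r)) - (\<Sum>r\<in>seq_support t. (- (real r * t r)) * symbol_coeff t (n + int r)))"
    using sums_diff[OF 1 2] by (simp add: algebra_simps)
  moreover have "(\<lambda>m. of_int n * (?h (int m + n) * ?g (int m))) sums (of_int n * symbol_coeff t n)"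
    by (intro sums_mult symbol_coeff_sums fin)
  ultimately have "of_int n * symbol_coeff t n = (\<Sum>r\<in>seq_support t. real r * t r * symbol_coeff t (n - int r)) - (\<Sum>r\<in>seq_support t. (- (real r * t r)) * symbol_coeff t (n + int r))"
    by (rule sums_unique2[symmetric])
  thus ?thesis by (simp add: sum.distrib[symmetric] sum_negf ring_distribs)
qed

lemma symbol_coeff_shift_has_sum:
  assumes fin: "finite (seq_support t)"
  shows "((\<lambda>j. complex_of_real (symbol_coeff t (j + c)) * cis (of_int j * \<phi>)) has_sum cis (- (of_int c * \<phi>)) * cis (phase t \<phi>)) UNIV"
proof -
  have "((\<lambda>j. complex_of_real (symbol_coeff t j) * cis (of_int j * \<phi>)) has_sum cis (phase t \<phi>)) UNIV"
    using fourier_has_sum[OF symbol_coeff_abs_summable[OF fin, of 0], of \<phi>] fourier_symbol_coeff[OF fin, of \<phi>] by simp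
  hence "((\<lambda>j. complex_of_real (symbol_coeff t (j + c)) * cis (of_int (j + c) * \<phi>)) has_sum cis (phase t \<phi>)) UNIV"
    by (subst has_sum_reindex_bij_witness[where i = "\<lambda>k. k - c" and j = "\<lambda>n. n + c" and T = UNIV
          and h = "\<lambda>j. complex_of_real (symbol_coeff t j) * cis (of_int j * \<phi>)"]) auto
  from has_sum_cmult_right[OF this, of "cis (- (of_int c * \<phi>))"]
  have "((\<lambda>j. cis (- (of_int c * \<phi>)) * (complex_of_real (symbol_coeff t (j + c)) * cis (of_int (j + c) * \<phi>))) has_sum cis (- (of_int c * \<phi>)) * cis (phase t \<phi>)) UNIV" .
  also have "(\<lambda>j. cis (- (of_int c * \<phi>)) * (complex_of_real (symbol_coeff t (j + c)) * cis (of_int (j + c) * \<phi>))) = (\<lambda>j. complex_of_real (symbol_coeff t (j + c)) * cis (of_int j * \<phi>))"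
  proof
    fix j
    have "cis (- (of_int c * \<phi>)) * cis (of_int (j + c) * \<phi>) = cis (of_int j * \<phi>)"
      by (simp add: cis_mult algebra_simps)
    thus "cis (- (of_int c * \<phi>)) * (complex_of_real (symbol_coeff t (j + c)) * cis (of_int (j + c) * \<phi>)) = complex_of_real (symbol_coeff t (j + c)) * cis (of_int j * \<phi>)"
      by (subst mult.left_commute) (simp only:)
  qed
  finally show ?thesis .
qed

text \<open>The recurrence dominates j J_j by finitely many shifts of J, each absolutely
  summable.\<close>

lemma weighted_symbol_coeff_abs_summable:
  assumes fin: "finite (seq_support t)"
  shows "(\<lambda>j. norm (complex_of_real (of_int j * symbol_coeff t j))) summable_on UNIV"
proof (rule summable_on_comparison_test)
  show "(\<lambda>j. \<Sum>r\<in>seq_support t. real r * \<bar>t r\<bar> * (norm (complex_of_real (symbol_coeff t (j + (- int r)))) + norm (complex_of_real (symbol_coeff t (j + int r))))) summable_on UNIV"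
    unfolding summable_on_def
    by (rule exI, rule has_sum_finite_sum, rule has_sum_infsum)
       (intro summable_on_cmult_right summable_on_add symbol_coeff_abs_summable fin)
  show "norm (complex_of_real (of_int j * symbol_coeff t j)) \<le> (\<Sum>r\<in>seq_support t. real r * \<bar>t r\<bar> * (norm (complex_of_real (symbol_coeff t (j + (- int r)))) + norm (complex_of_real (symbol_coeff t (j + int r)))))" for j
  proof -
    have "norm (complex_of_real (of_int j * symbol_coeff t j)) = \<bar>\<Sum>r\<in>seq_support t. real r * t r * (symbol_coeff t (j - int r) + symbol_coeff t (j + int r))\<bar>"
      unfolding symbol_coeff_rec[OF fin, symmetric] by (simp only: norm_of_real)
    also have "\<dots> \<le> (\<Sum>r\<in>seq_support t. \<bar>real r * t r * (symbol_coeff t (j - int r) + symbol_coeff t (j + int r))\<bar>)"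
      by (rule sum_abs)
    also have "\<dots> \<le> (\<Sum>r\<in>seq_support t. real r * \<bar>t r\<bar> * (norm (complex_of_real (symbol_coeff t (j + (- int r)))) + norm (complex_of_real (symbol_coeff t (j + int r)))))"
      by (intro sum_mono) (auto simp: abs_mult intro!: mult_left_mono abs_triangle_ineq)
    finally show ?thesis .
  qed
qed simp

lemma fourier_weighted_symbol_coeff:
  assumes fin: "finite (seq_support t)"
  shows "fourier (\<lambda>j. complex_of_real (of_int j * symbol_coeff t j)) \<phi> = of_real (slope t \<phi>) * cis (phase t \<phi>)"
proof -
  have "((\<lambda>j. \<Sum>r\<in>seq_support t. complex_of_real (real r * t r) * (complex_of_real (symbol_coeff t (j + (- int r))) * cis (of_int j * \<phi>) + complex_of_real (symbol_coeff t (j + int r)) * cis (of_int j * \<phi>)))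
    has_sum (\<Sum>r\<in>seq_support t. complex_of_real (real r * t r) * (cis (- (of_int (- int r) * \<phi>)) * cis (phase t \<phi>) + cis (- (of_int (int r) * \<phi>)) * cis (phase t \<phi>)))) UNIV"
    by (intro has_sum_finite_sum has_sum_cmult_right has_sum_add symbol_coeff_shift_has_sum fin)
  also have "(\<lambda>j. \<Sum>r\<in>seq_support t. complex_of_real (real r * t r) * (complex_of_real (symbol_coeff t (j + (- int r))) * cis (of_int j * \<phi>) + complex_of_real (symbol_coeff t (j + int r)) * cis (of_int j * \<phi>)))
     = (\<lambda>j. complex_of_real (of_int j * symbol_coeff t j) * cis (of_int j * \<phi>))"
    unfolding symbol_coeff_rec[OF fin] of_real_sum sum_distrib_right
    by (intro ext sum.cong refl) (simp add: algebra_simps)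
  also have "(\<Sum>r\<in>seq_support t. complex_of_real (real r * t r) * (cis (- (of_int (- int r) * \<phi>)) * cis (phase t \<phi>) + cis (- (of_int (int r) * \<phi>)) * cis (phase t \<phi>))) = of_real (slope t \<phi>) * cis (phase t \<phi>)"
  proof -
    have "cis (real r * \<phi>) + cis (- (real r * \<phi>)) = of_real (2 * cos (real r * \<phi>))" for r
      by (simp add: complex_eq_iff)
    hence "complex_of_real (real r * t r) * (cis (- (of_int (- int r) * \<phi>)) * cis (phase t \<phi>) + cis (- (of_int (int r) * \<phi>)) * cis (phase t \<phi>))
      = complex_of_real (2 * (real r * t r * cos (real r * \<phi>))) * cis (phase t \<phi>)" for r
    proof -
      have "complex_of_real (real r * t r) * (cis (- (of_int (- int r) * \<phi>)) * cis (phase t \<phi>) + cis (- (of_int (int r) * \<phi>)) * cis (phase t \<phi>))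
         = complex_of_real (real r * t r) * ((cis (real r * \<phi>) + cis (- (real r * \<phi>))) * cis (phase t \<phi>))"
        by (simp add: distrib_right)
      also have "\<dots> = complex_of_real (real r * t r) * (of_real (2 * cos (real r * \<phi>)) * cis (phase t \<phi>))"
        by (simp only: \<open>\<And>r. cis (real r * \<phi>) + cis (- (real r * \<phi>)) = of_real (2 * cos (real r * \<phi>))\<close>)
      finally show ?thesis by (simp add: mult_ac)
    qed
    thus ?thesis unfolding slope_def sum_distrib_left of_real_sum sum_distrib_right by (simp only:)
  qed
  finally show ?thesis
    using fourier_has_sum[OF weighted_symbol_coeff_abs_summable[OF fin]] by (rule has_sum_unique[symmetric])
qed

lemma continuous_on_slope [continuous_intros]: "continuous_on A (slope t)"
  unfolding slope_def by (intro continuous_intros)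

lemma continuous_on_phase [continuous_intros]: "continuous_on A (phase t)"
  unfolding phase_def by (intro continuous_intros)

lemma slope_bound: "\<bar>slope t \<phi>\<bar> \<le> 2 * (\<Sum>r\<in>seq_support t. real r * \<bar>t r\<bar>)"
proof -
  have "\<bar>\<Sum>r\<in>seq_support t. real r * t r * cos (real r * \<phi>)\<bar> \<le> (\<Sum>r\<in>seq_support t. \<bar>real r * t r * cos (real r * \<phi>)\<bar>)"
    by (rule sum_abs)
  also have "\<dots> \<le> (\<Sum>r\<in>seq_support t. real r * \<bar>t r\<bar>)"
    by (intro sum_mono) (simp add: abs_mult mult_left_le)
  finally show ?thesis by (simp add: slope_def abs_mult)
qed

lemma circle_integral_slope:
  assumes fin: "finite (seq_support t)"
  shows "(\<integral>\<phi>. slope t \<phi> \<partial>circle_measure) = 0"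
proof -
  have int: "integrable circle_measure (\<lambda>\<phi>. cis (of_int k * \<phi>))" for k :: int
    by (rule circle_integrable[of _ 1]) (auto intro!: continuous_intros)
  have 0: "(\<integral>\<phi>. cos (real r * \<phi>) \<partial>circle_measure) = 0" if "r \<in> seq_support t" for r
  proof -
    have "(\<integral>\<phi>. cos (real r * \<phi>) \<partial>circle_measure) = (\<integral>\<phi>. Re (cis (of_int (int r) * \<phi>)) \<partial>circle_measure)" by simp
    also have "\<dots> = Re (\<integral>\<phi>. cis (of_int (int r) * \<phi>) \<partial>circle_measure)" by (rule integral_Re[OF int])
    also have "\<dots> = 0" using that by (subst circle_integral_cis) (simp add: seq_support_def)
    finally show ?thesis .
  qed
  have int': "integrable circle_measure (\<lambda>\<phi>. cos (real r * \<phi>))" for r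
    by (rule circle_integrable[of _ 1]) (auto intro!: continuous_intros)
  show ?thesis unfolding slope_def
    using 0 int' by simp
qed

section \<open>The law with weights J_l^2 and its moments\<close>

definition law :: "(nat \<Rightarrow> real) \<Rightarrow> int pmf" where
  "law t = embed_pmf (\<lambda>j. (symbol_coeff t j)\<^sup>2)"

text \<open>Parseval for J_j and for J_j multiplied by the exponential of frequency \<xi>: their
  Fourier series are one unimodular function at \<phi> and at \<phi> + \<xi>. The result is the
  characteristic function of the law, and \<xi> = 0 shows that the mass is 1.\<close>

lemma symbol_coeff_square_has_sum:
  assumes fin: "finite (seq_support t)"
  shows "((\<lambda>j. (symbol_coeff t j)\<^sup>2 *\<^sub>R cis (of_int j * \<xi>)) has_sum (\<integral>\<phi>. cis (phase t (\<phi> + \<xi>) - phase t \<phi>) \<partial>circle_measure)) UNIV"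
proof -
  have a: "(\<lambda>j. norm (complex_of_real (symbol_coeff t j) * cis (of_int j * \<xi>))) summable_on UNIV"
    using symbol_coeff_abs_summable[OF fin, of 0] by (simp add: norm_mult)
  have b: "(\<lambda>j. norm (complex_of_real (symbol_coeff t j))) summable_on UNIV"
    using symbol_coeff_abs_summable[OF fin, of 0] by simp
  have "fourier (\<lambda>j. complex_of_real (symbol_coeff t j) * cis (of_int j * \<xi>)) \<phi> = fourier (\<lambda>j. complex_of_real (symbol_coeff t j)) (\<phi> + \<xi>)" for \<phi>
    unfolding fourier_def by (simp add: mult.assoc cis_mult ring_distribs add.commute)
  hence "fourier (\<lambda>j. complex_of_real (symbol_coeff t j) * cis (of_int j * \<xi>)) \<phi> * cnj (fourier (\<lambda>j. complex_of_real (symbol_coeff t j)) \<phi>) = cis (phase t (\<phi> + \<xi>) - phase t \<phi>)" for \<phi>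
    by (simp add: fourier_symbol_coeff[OF fin] cis_cnj cis_mult)
  with parseval[OF a b] show ?thesis
    by (simp add: power2_eq_square scaleR_conv_of_real mult_ac)
qed

lemma symbol_coeff_square_has_sum_1:
  assumes fin: "finite (seq_support t)"
  shows "((\<lambda>j. (symbol_coeff t j)\<^sup>2) has_sum 1) UNIV"
  using has_sum_Re[OF symbol_coeff_square_has_sum[OF fin, of 0]] by (simp add: circle.prob_space[simplified])

text \<open>The mean of the law is that of \<open>slope t\<close> over the circle, and
  \<open>slope t\<close> has no constant term. Consequently E (n - X)_+ and E (X - n)_+ differ by
  exactly n, as the numbers of holes and particles do.\<close>

lemma symbol_coeff_first_moment:
  assumes fin: "finite (seq_support t)"
  shows "((\<lambda>j. (symbol_coeff t j)\<^sup>2 * of_int j) has_sum 0) UNIV"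
proof -
  have b: "(\<lambda>j. norm (complex_of_real (symbol_coeff t j))) summable_on UNIV"
    using symbol_coeff_abs_summable[OF fin, of 0] by simp
  have "of_real (slope t \<phi>) * cis (phase t \<phi>) * cnj (cis (phase t \<phi>)) = complex_of_real (slope t \<phi>)" for \<phi>
    by (simp add: cis_cnj cis_mult mult.assoc)
  with parseval[OF weighted_symbol_coeff_abs_summable[OF fin] b]
  have "((\<lambda>j. complex_of_real (of_int j * symbol_coeff t j) * cnj (complex_of_real (symbol_coeff t j))) has_sum (\<integral>\<phi>. complex_of_real (slope t \<phi>) \<partial>circle_measure)) UNIV"
    by (simp only: fourier_weighted_symbol_coeff[OF fin] fourier_symbol_coeff[OF fin])
  from has_sum_Re[OF this] show ?thesis
    by (simp add: circle_integral_slope[OF fin] power2_eq_square mult_ac)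
qed

lemma symbol_coeff_second_moment:
  assumes fin: "finite (seq_support t)"
  shows "((\<lambda>j. (symbol_coeff t j)\<^sup>2 * (of_int j)\<^sup>2) has_sum (\<integral>\<phi>. (slope t \<phi>)\<^sup>2 \<partial>circle_measure)) UNIV"
proof -
  have "of_real (slope t \<phi>) * cis (phase t \<phi>) * cnj (of_real (slope t \<phi>) * cis (phase t \<phi>)) = complex_of_real ((slope t \<phi>)\<^sup>2)" for \<phi>
    by (simp add: cis_cnj cis_mult power2_eq_square)
  with parseval[OF weighted_symbol_coeff_abs_summable[OF fin] weighted_symbol_coeff_abs_summable[OF fin]]
  have "((\<lambda>j. complex_of_real (of_int j * symbol_coeff t j) * cnj (complex_of_real (of_int j * symbol_coeff t j))) has_sum (\<integral>\<phi>. complex_of_real ((slope t \<phi>)\<^sup>2) \<partial>circle_measure)) UNIV"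
    by (simp only: fourier_weighted_symbol_coeff[OF fin])
  from has_sum_Re[OF this] show ?thesis
    by (simp add: power2_eq_square mult_ac del: of_real_power of_real_mult)
qed

lemma pmf_law:
  assumes fin: "finite (seq_support t)"
  shows "pmf (law t) j = (symbol_coeff t j)\<^sup>2"
  unfolding law_def
proof (rule pmf_embed_pmf)
  have s: "Infinite_Set_Sum.abs_summable_on (\<lambda>j. (symbol_coeff t j)\<^sup>2) UNIV"
    using symbol_coeff_square_has_sum_1[OF fin] unfolding abs_summable_equivalent[symmetric]
    by (auto simp: summable_on_def)
  have "(\<integral>\<^sup>+j. ennreal ((symbol_coeff t j)\<^sup>2) \<partial>count_space UNIV) = ennreal (infsetsum (\<lambda>j. (symbol_coeff t j)\<^sup>2) UNIV)"
    by (rule nn_integral_conv_infsetsum[OF s]) auto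
  also have "infsetsum (\<lambda>j. (symbol_coeff t j)\<^sup>2) UNIV = 1"
    using infsetsum_infsum[OF s] infsumI[OF symbol_coeff_square_has_sum_1[OF fin]] by simp
  finally show "(\<integral>\<^sup>+j. ennreal ((symbol_coeff t j)\<^sup>2) \<partial>count_space UNIV) = 1" by simp
qed simp

lemma law_has_sum:
  fixes f :: "int \<Rightarrow> 'a :: {banach, second_countable_topology}"
  assumes fin: "finite (seq_support t)"
    and abs: "(\<lambda>j. norm ((symbol_coeff t j)\<^sup>2 *\<^sub>R f j)) summable_on UNIV"
    and S: "((\<lambda>j. (symbol_coeff t j)\<^sup>2 *\<^sub>R f j) has_sum S) UNIV"
  shows "integrable (measure_pmf (law t)) f" "measure_pmf.expectation (law t) f = S"
proof -
  have s: "Infinite_Set_Sum.abs_summable_on (\<lambda>j. (symbol_coeff t j)\<^sup>2 *\<^sub>R f j) UNIV"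
    using abs unfolding abs_summable_equivalent[symmetric] .
  hence "integrable (count_space UNIV) (\<lambda>j. (symbol_coeff t j)\<^sup>2 *\<^sub>R f j)"
    by (simp add: Infinite_Set_Sum.abs_summable_on_def)
  thus "integrable (measure_pmf (law t)) f"
    unfolding measure_pmf_eq_density by (subst integrable_density) (auto simp: pmf_law[OF fin])
  have "measure_pmf.expectation (law t) f = (\<integral>j. (symbol_coeff t j)\<^sup>2 *\<^sub>R f j \<partial>count_space UNIV)"
    unfolding measure_pmf_eq_density by (subst integral_density) (auto simp: pmf_law[OF fin])
  also have "\<dots> = S"
    using infsetsum_infsum[OF s] infsumI[OF S] by (simp add: infsetsum_def)
  finally show "measure_pmf.expectation (law t) f = S" .
qed

text \<open>The scaling is what matters: for the times \<theta> \<gamma> the bound is of order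
  \<theta>^2, so the law of X / \<theta> has second moments bounded in \<theta>.\<close>

lemma law_second_moment:
  assumes fin: "finite (seq_support t)"
  shows "integrable (measure_pmf (law t)) (\<lambda>j. (real_of_int j)\<^sup>2)"
    and "measure_pmf.expectation (law t) (\<lambda>j. (real_of_int j)\<^sup>2) \<le> (2 * (\<Sum>r\<in>seq_support t. real r * \<bar>t r\<bar>))\<^sup>2"
proof -
  have abs: "(\<lambda>j. norm ((symbol_coeff t j)\<^sup>2 *\<^sub>R (real_of_int j)\<^sup>2)) summable_on UNIV"
    using symbol_coeff_second_moment[OF fin] by (auto simp: summable_on_def)
  note h = law_has_sum[OF fin abs, unfolded real_scaleR_def, OF symbol_coeff_second_moment[OF fin]]
  show "integrable (measure_pmf (law t)) (\<lambda>j. (real_of_int j)\<^sup>2)" by (rule h(1))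
  let ?B = "2 * (\<Sum>r\<in>seq_support t. real r * \<bar>t r\<bar>)"
  have "(\<integral>\<phi>. (slope t \<phi>)\<^sup>2 \<partial>circle_measure) \<le> (\<integral>\<phi>. ?B\<^sup>2 \<partial>circle_measure)"
  proof (rule integral_mono)
    have sq: "(slope t \<phi>)\<^sup>2 \<le> ?B\<^sup>2" for \<phi> using power_mono[OF slope_bound[of t \<phi>], of 2] by simp
    thus "(slope t \<phi>)\<^sup>2 \<le> ?B\<^sup>2" for \<phi> .
    show "integrable circle_measure (\<lambda>\<phi>. (slope t \<phi>)\<^sup>2)"
      by (rule circle_integrable[of _ "?B\<^sup>2"]) (use sq in \<open>auto intro!: continuous_intros\<close>)
    show "integrable circle_measure (\<lambda>\<phi>. ?B\<^sup>2)" by (rule circle.integrable_const)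
  qed
  thus "measure_pmf.expectation (law t) (\<lambda>j. (real_of_int j)\<^sup>2) \<le> ?B\<^sup>2"
    unfolding h(2) by (simp add: circle.prob_space[simplified])
qed

lemma law_first_moment:
  assumes fin: "finite (seq_support t)"
  shows "integrable (measure_pmf (law t)) real_of_int" "measure_pmf.expectation (law t) real_of_int = 0"
proof -
  have "(\<lambda>j. norm ((symbol_coeff t j)\<^sup>2 *\<^sub>R real_of_int j)) summable_on UNIV"
  proof (rule summable_on_comparison_test)
    show "(\<lambda>j. (symbol_coeff t j)\<^sup>2 * (of_int j)\<^sup>2) summable_on UNIV"
      using symbol_coeff_second_moment[OF fin] by (auto simp: summable_on_def)
    show "norm ((symbol_coeff t j)\<^sup>2 *\<^sub>R real_of_int j) \<le> (symbol_coeff t j)\<^sup>2 * (of_int j)\<^sup>2" for j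
    proof -
      have "\<bar>j\<bar> \<le> j\<^sup>2" by (simp add: power2_eq_square) (metis abs_mult_self_eq abs_ge_zero mult_left_mono mult_1 int_one_le_iff_zero_less zero_less_abs_iff mult_eq_0_iff abs_0 order_refl mult.commute)
      hence "\<bar>real_of_int j\<bar> \<le> (real_of_int j)\<^sup>2" by (metis of_int_abs of_int_le_iff of_int_power)
      thus ?thesis by (simp add: abs_mult mult_left_mono)
    qed
  qed simp
  from law_has_sum[OF fin this, unfolded real_scaleR_def, OF symbol_coeff_first_moment[OF fin]]
  show "integrable (measure_pmf (law t)) real_of_int" "measure_pmf.expectation (law t) real_of_int = 0" .
qed

lemma law_cis:
  assumes fin: "finite (seq_support t)"
  shows "measure_pmf.expectation (law t) (\<lambda>j. cis (of_int j * \<xi>)) = (\<integral>\<phi>. cis (phase t (\<phi> + \<xi>) - phase t \<phi>) \<partial>circle_measure)"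
proof -
  have "(\<lambda>j. norm ((symbol_coeff t j)\<^sup>2 *\<^sub>R cis (of_int j * \<xi>))) summable_on UNIV"
    using symbol_coeff_square_has_sum_1[OF fin] by (auto simp: summable_on_def)
  from law_has_sum(2)[OF fin this symbol_coeff_square_has_sum[OF fin]] show ?thesis .
qed

lemma range_add_int: "range (\<lambda>i. b + int i) = {b..}"
  by (auto simp: image_iff) (metis add.commute diff_add_cancel diff_ge_0_iff_ge zero_le_imp_eq_int)

text \<open>The correlation bound of a site is a tail probability of the law, so sums of these
  bounds become expectations of positive parts.\<close>

lemma law_tail:
  assumes fin: "finite (seq_support t)"
  shows "measure_pmf.prob (law t) {k..} = occupation t k"
proof -
  have "((\<lambda>l. (symbol_coeff t (k + int l))\<^sup>2) has_sum occupation t k) UNIV"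
    by (rule sums_nonneg_imp_has_sum[OF occupation_sums[OF fin]]) auto
  hence "((\<lambda>j. (symbol_coeff t j)\<^sup>2) has_sum occupation t k) (range (\<lambda>l. k + int l))"
    by (subst has_sum_reindex) (auto simp: comp_def inj_def)
  also have "range (\<lambda>l. k + int l) = {k..}" by (rule range_add_int)
  finally have 1: "((\<lambda>j. (symbol_coeff t j)\<^sup>2) has_sum occupation t k) {k..}" .
  have 2: "((\<lambda>j. (symbol_coeff t j)\<^sup>2 *\<^sub>R (indicator {k..} j :: real)) has_sum occupation t k) UNIV"
    by (rule iffD1[OF has_sum_cong_neutral 1]) (auto simp: indicator_def)
  have "(\<lambda>j. norm ((symbol_coeff t j)\<^sup>2 *\<^sub>R (indicator {k..} j :: real))) summable_on UNIV"
    using 2 by (auto simp: summable_on_def)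
  from law_has_sum(2)[OF fin this 2] show ?thesis by simp
qed

section \<open>Convergence of the rescaled law\<close>

lemma seq_support_scale: "\<theta> \<noteq> 0 \<Longrightarrow> seq_support (\<lambda>r. \<theta> * \<gamma> r) = seq_support \<gamma>"
  by (auto simp: seq_support_def)

lemma phase_scale: "\<theta> \<noteq> 0 \<Longrightarrow> phase (\<lambda>r. \<theta> * \<gamma> r) \<phi> = \<theta> * phase \<gamma> \<phi>"
  by (simp add: phase_def seq_support_scale sum_distrib_left mult_ac)

lemma phase_has_derivative: "(phase \<gamma> has_real_derivative slope \<gamma> \<phi>) (at \<phi> within A)"
  unfolding phase_def slope_def
  by (auto intro!: derivative_eq_intros sum.cong simp: sum_distrib_left)

definition scaled_law :: "(nat \<Rightarrow> real) \<Rightarrow> real \<Rightarrow> real measure" where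
  "scaled_law \<gamma> \<theta> = distr (measure_pmf (law (\<lambda>r. \<theta> * \<gamma> r))) borel (\<lambda>j. of_int j / \<theta>)"

definition slope_law :: "(nat \<Rightarrow> real) \<Rightarrow> real measure" where
  "slope_law \<gamma> = distr circle_measure borel (slope \<gamma>)"

lemma slope_measurable [measurable]: "slope \<gamma> \<in> borel_measurable borel"
  by (intro borel_measurable_continuous_onI continuous_intros)

lemma real_distribution_scaled_law: "real_distribution (scaled_law \<gamma> \<theta>)"
  unfolding scaled_law_def by (rule prob_space.real_distribution_distr[OF prob_space_measure_pmf]) simp

lemma real_distribution_slope_law: "real_distribution (slope_law \<gamma>)"
  unfolding slope_law_def by (rule circle.real_distribution_distr) measurable

lemma char_scaled_law_tendsto:
  assumes fin: "finite (seq_support \<gamma>)" and X: "filterlim X at_top sequentially"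
  shows "(\<lambda>n. char (scaled_law \<gamma> (X n)) \<xi>) \<longlonglongrightarrow> char (slope_law \<gamma>) \<xi>"
proof (rule Lim_transform_eventually)
  have isCont_cis: "isCont cis x" for x
  proof -
    have "continuous_on UNIV (\<lambda>x::real. cis x)" by (intro continuous_intros)
    thus ?thesis by (simp add: continuous_on_eq_continuous_at)
  qed
  have pos: "\<forall>\<^sub>F n in sequentially. X n > 0"
    using X by (simp add: filterlim_at_top_dense)
  show "\<forall>\<^sub>F n in sequentially. (\<integral>\<phi>. cis (X n * (phase \<gamma> (\<phi> + \<xi> / X n) - phase \<gamma> \<phi>)) \<partial>circle_measure) = char (scaled_law \<gamma> (X n)) \<xi>"
    using pos
  proof eventually_elim
    case (elim n)
    have fin': "finite (seq_support (\<lambda>r. X n * \<gamma> r))" using elim fin by (simp add: seq_support_scale)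
    have "char (scaled_law \<gamma> (X n)) \<xi> = measure_pmf.expectation (law (\<lambda>r. X n * \<gamma> r)) (\<lambda>j. iexp (\<xi> * (of_int j / X n)))"
      unfolding char_def scaled_law_def by (subst integral_distr) auto
    also have "\<dots> = measure_pmf.expectation (law (\<lambda>r. X n * \<gamma> r)) (\<lambda>j. cis (of_int j * (\<xi> / X n)))"
      by (simp add: cis_conv_exp mult_ac)
    also have "\<dots> = (\<integral>\<phi>. cis (X n * (phase \<gamma> (\<phi> + \<xi> / X n) - phase \<gamma> \<phi>)) \<partial>circle_measure)"
      unfolding law_cis[OF fin'] using elim by (simp add: phase_scale right_diff_distrib)
    finally show ?case by simp
  qed
  have "(\<lambda>n. \<integral>\<phi>. cis (X n * (phase \<gamma> (\<phi> + \<xi> / X n) - phase \<gamma> \<phi>)) \<partial>circle_measure) \<longlonglongrightarrow> (\<integral>\<phi>. cis (\<xi> * slope \<gamma> \<phi>) \<partial>circle_measure)"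
  proof (rule integral_dominated_convergence[where w = "\<lambda>_. 1"])
    have m: "(\<lambda>\<phi>. cis (g \<phi>)) \<in> borel_measurable circle_measure" if "continuous_on UNIV g" for g :: "real \<Rightarrow> real"
    proof -
      have "(\<lambda>\<phi>. cis (g \<phi>)) \<in> borel_measurable borel"
        using that by (intro borel_measurable_continuous_onI continuous_intros)
      thus ?thesis by measurable
    qed
    have cont: "continuous_on UNIV (\<lambda>\<phi>. phase \<gamma> (\<phi> + c))" for c
      unfolding phase_def by (intro continuous_intros)
    show "(\<lambda>\<phi>. cis (\<xi> * slope \<gamma> \<phi>)) \<in> borel_measurable circle_measure"
      by (rule m) (intro continuous_intros)
    show "(\<lambda>\<phi>. cis (X n * (phase \<gamma> (\<phi> + \<xi> / X n) - phase \<gamma> \<phi>))) \<in> borel_measurable circle_measure" for n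
      by (rule m) (intro continuous_intros cont)
    show "integrable circle_measure (\<lambda>_. 1 :: real)" by (rule circle.integrable_const)
    show "AE \<phi> in circle_measure. (\<lambda>n. cis (X n * (phase \<gamma> (\<phi> + \<xi> / X n) - phase \<gamma> \<phi>))) \<longlonglongrightarrow> cis (\<xi> * slope \<gamma> \<phi>)"
    proof (rule AE_I2)
      fix \<phi>
      have "(\<lambda>n. X n * (phase \<gamma> (\<phi> + \<xi> / X n) - phase \<gamma> \<phi>)) \<longlonglongrightarrow> \<xi> * slope \<gamma> \<phi>"
      \<comment> \<open>The limit is that of a difference quotient along the increments \<xi> / X n,
        which must be nonzero.\<close>
      proof (cases "\<xi> = 0")
        case False
        have h: "((\<lambda>h. (phase \<gamma> (\<phi> + h) - phase \<gamma> \<phi>) / h) \<longlongrightarrow> slope \<gamma> \<phi>) (at 0)"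
          using phase_has_derivative[of \<gamma> \<phi> UNIV] by (simp add: DERIV_def)
        have "filterlim (\<lambda>n. \<xi> / X n) (at 0) sequentially"
          unfolding filterlim_at
        proof
          show "(\<lambda>n. \<xi> / X n) \<longlonglongrightarrow> 0"
            using X by (intro tendsto_divide_0[OF tendsto_const] filterlim_at_top_imp_at_infinity)
          show "\<forall>\<^sub>F n in sequentially. \<xi> / X n \<in> UNIV \<and> \<xi> / X n \<noteq> 0"
            using pos by eventually_elim (use False in auto)
        qed
        from tendsto_mult[OF tendsto_const[of \<xi>] filterlim_compose[OF h this]]
        have "(\<lambda>n. \<xi> * ((phase \<gamma> (\<phi> + \<xi> / X n) - phase \<gamma> \<phi>) / (\<xi> / X n))) \<longlonglongrightarrow> \<xi> * slope \<gamma> \<phi>" .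
        moreover have "\<xi> * ((phase \<gamma> (\<phi> + \<xi> / X n) - phase \<gamma> \<phi>) / (\<xi> / X n)) = X n * (phase \<gamma> (\<phi> + \<xi> / X n) - phase \<gamma> \<phi>)" for n
          using False by simp
        ultimately show ?thesis by (simp only:)
      qed simp
      thus "(\<lambda>n. cis (X n * (phase \<gamma> (\<phi> + \<xi> / X n) - phase \<gamma> \<phi>))) \<longlonglongrightarrow> cis (\<xi> * slope \<gamma> \<phi>)"
        by (rule isCont_tendsto_compose[OF isCont_cis])
    qed
  qed simp
  also have "(\<integral>\<phi>. cis (\<xi> * slope \<gamma> \<phi>) \<partial>circle_measure) = char (slope_law \<gamma>) \<xi>"
    unfolding char_def slope_law_def by (subst integral_distr) (auto simp: cis_conv_exp)
  finally show "(\<lambda>n. \<integral>\<phi>. cis (X n * (phase \<gamma> (\<phi> + \<xi> / X n) - phase \<gamma> \<phi>)) \<partial>circle_measure) \<longlonglongrightarrow> char (slope_law \<gamma>) \<xi>" .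
qed

lemma truncation_bound:
  fixes y K :: real
  assumes "K > 0"
  shows "0 \<le> \<bar>y\<bar> - min \<bar>y\<bar> K" "\<bar>y\<bar> - min \<bar>y\<bar> K \<le> y\<^sup>2 / K"
proof -
  show "\<bar>y\<bar> - min \<bar>y\<bar> K \<le> y\<^sup>2 / K"
  proof (cases "\<bar>y\<bar> \<le> K")
    case False
    hence "\<bar>y\<bar> * K \<le> \<bar>y\<bar> * \<bar>y\<bar>" by (intro mult_left_mono) auto
    hence "\<bar>y\<bar> \<le> y\<^sup>2 / K" using assms by (simp add: pos_le_divide_eq power2_eq_square)
    thus ?thesis using assms by linarith
  qed (use assms in auto)
qed auto

text \<open>Levy's continuity theorem gives weak convergence, which only tests bounded functions.
  Truncation at K is paid for by the uniformly bounded second moments, since \<bar>y\<bar> exceeds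
  its truncation by at most y^2 / K.\<close>

lemma abs_deviation_tendsto:
  assumes fin: "finite (seq_support \<gamma>)"
  shows "((\<lambda>\<theta>. measure_pmf.expectation (law (\<lambda>r. \<theta> * \<gamma> r)) (\<lambda>j. \<bar>of_int j / \<theta> - x\<bar>)) \<longlongrightarrow>
     (\<integral>\<phi>. \<bar>slope \<gamma> \<phi> - x\<bar> \<partial>circle_measure)) at_top"
proof (rule tendsto_at_topI_sequentially)
  fix X :: "nat \<Rightarrow> real" assume X: "filterlim X at_top sequentially"
  define B where "B = 2 * (\<Sum>r\<in>seq_support \<gamma>. real r * \<bar>\<gamma> r\<bar>)"
  have B: "\<bar>slope \<gamma> \<phi>\<bar> \<le> B" for \<phi> unfolding B_def by (rule slope_bound)
  have B0: "B \<ge> 0" using B[of 0] by simp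
  have pos: "\<forall>\<^sub>F n in sequentially. X n > 0"
    using X by (simp add: filterlim_at_top_dense)
  have wc: "weak_conv_m (\<lambda>n. scaled_law \<gamma> (X n)) (slope_law \<gamma>)"
    by (rule levy_continuity[OF real_distribution_scaled_law real_distribution_slope_law char_scaled_law_tendsto[OF fin X]])
  let ?E = "\<lambda>n f. measure_pmf.expectation (law (\<lambda>r. X n * \<gamma> r)) f"
  have trunc: "(\<lambda>n. ?E n (\<lambda>j. min \<bar>of_int j / X n - x\<bar> K)) \<longlonglongrightarrow> (\<integral>\<phi>. min \<bar>slope \<gamma> \<phi> - x\<bar> K \<partial>circle_measure)" if "K > 0" for K
  proof -
    have [measurable]: "(\<lambda>y. min \<bar>y - x\<bar> K) \<in> borel_measurable borel" by measurable
    have "(\<lambda>n. integral\<^sup>L (scaled_law \<gamma> (X n)) (\<lambda>y. min \<bar>y - x\<bar> K)) \<longlonglongrightarrow> integral\<^sup>L (slope_law \<gamma>) (\<lambda>y. min \<bar>y - x\<bar> K)"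
    proof (rule weak_conv_imp_integral_bdd_continuous_conv[OF real_distribution_scaled_law real_distribution_slope_law wc])
      show "isCont (\<lambda>y. min \<bar>y - x\<bar> K) y" for y by (intro continuous_intros)
      show "norm (min \<bar>y - x\<bar> K) \<le> K" for y using that by simp
    qed
    thus ?thesis unfolding scaled_law_def slope_law_def by (simp add: integral_distr)
  qed
  have tail: "\<bar>?E n (\<lambda>j. \<bar>of_int j / X n - x\<bar>) - ?E n (\<lambda>j. min \<bar>of_int j / X n - x\<bar> K)\<bar> \<le> (B\<^sup>2 + x\<^sup>2) / K"
    if K: "K > 0" and Xn: "X n > 0" for K n
  proof -
    let ?t = "\<lambda>r. X n * \<gamma> r"
    have fin': "finite (seq_support ?t)" using fin Xn by (simp add: seq_support_scale)
    note m1 = law_first_moment[OF fin'] and m2 = law_second_moment[OF fin']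
    have i1: "integrable (measure_pmf (law ?t)) (\<lambda>j. \<bar>of_int j / X n - x\<bar>)"
      by (intro integrable_abs Bochner_Integration.integrable_diff integrable_divide_zero m1(1)) auto
    have i2: "integrable (measure_pmf (law ?t)) (\<lambda>j. min \<bar>of_int j / X n - x\<bar> K)"
      by (rule Bochner_Integration.integrable_bound[OF i1]) (use K in auto)
    have sq: "(of_int j / X n - x)\<^sup>2 = (of_int j)\<^sup>2 / (X n)\<^sup>2 - 2 * x / X n * of_int j + x\<^sup>2" for j
      by (simp add: power2_eq_square algebra_simps)
    have i3: "integrable (measure_pmf (law ?t)) (\<lambda>j. (of_int j / X n - x)\<^sup>2)"
      unfolding sq by (intro Bochner_Integration.integrable_add Bochner_Integration.integrable_diff integrable_divide_zero integrable_mult_right m1(1) m2(1)) auto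
    have "?E n (\<lambda>j. (of_int j / X n - x)\<^sup>2) = ?E n (\<lambda>j. (of_int j)\<^sup>2) / (X n)\<^sup>2 + x\<^sup>2"
      unfolding sq using m1 m2(1) by simp
    also have "?E n (\<lambda>j. (of_int j)\<^sup>2) \<le> (X n * B)\<^sup>2"
      using m2(2) Xn by (simp add: B_def seq_support_scale sum_distrib_left abs_mult mult_ac)
    hence "?E n (\<lambda>j. (of_int j)\<^sup>2) / (X n)\<^sup>2 \<le> B\<^sup>2"
      using Xn by (simp add: divide_le_eq power_mult_distrib mult.commute)
    finally have s: "?E n (\<lambda>j. (of_int j / X n - x)\<^sup>2) \<le> B\<^sup>2 + x\<^sup>2" by simp
    have "?E n (\<lambda>j. \<bar>of_int j / X n - x\<bar>) - ?E n (\<lambda>j. min \<bar>of_int j / X n - x\<bar> K) =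
       ?E n (\<lambda>j. \<bar>of_int j / X n - x\<bar> - min \<bar>of_int j / X n - x\<bar> K)"
      by (rule Bochner_Integration.integral_diff[symmetric, OF i1 i2])
    moreover have "?E n (\<lambda>j. \<bar>of_int j / X n - x\<bar> - min \<bar>of_int j / X n - x\<bar> K) \<le> ?E n (\<lambda>j. (of_int j / X n - x)\<^sup>2 / K)"
      by (intro integral_mono Bochner_Integration.integrable_diff i1 i2 integrable_divide_zero i3 truncation_bound K)
    moreover have "?E n (\<lambda>j. (of_int j / X n - x)\<^sup>2 / K) \<le> (B\<^sup>2 + x\<^sup>2) / K"
      using s K by (simp add: divide_right_mono)
    moreover have "0 \<le> ?E n (\<lambda>j. \<bar>of_int j / X n - x\<bar> - min \<bar>of_int j / X n - x\<bar> K)"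
      by (intro integral_nonneg_AE AE_I2 truncation_bound K)
    ultimately show ?thesis by linarith
  qed
  show "(\<lambda>n. ?E n (\<lambda>j. \<bar>of_int j / X n - x\<bar>)) \<longlonglongrightarrow> (\<integral>\<phi>. \<bar>slope \<gamma> \<phi> - x\<bar> \<partial>circle_measure)"
  proof (rule tendstoI)
    fix \<epsilon> :: real assume eps: "\<epsilon> > 0"
    \<comment> \<open>From B + \<bar>x\<bar> on, the truncation leaves the limit integral unchanged;
      the remaining terms make (B^2 + x^2) / K smaller than \<epsilon> / 2.\<close>
    define K where "K = B + \<bar>x\<bar> + 2 * (B\<^sup>2 + x\<^sup>2) / \<epsilon> + 1"
    have K: "K > 0" "K \<ge> B + \<bar>x\<bar>" "K > 2 * (B\<^sup>2 + x\<^sup>2) / \<epsilon>"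
      using B0 eps by (auto simp: K_def add_nonneg_pos)
    have small: "(B\<^sup>2 + x\<^sup>2) / K < \<epsilon> / 2"
    proof -
      have "2 * (B\<^sup>2 + x\<^sup>2) < K * \<epsilon>" using K(3) eps by (simp add: pos_divide_less_eq)
      thus ?thesis using K(1) by (simp add: pos_divide_less_eq mult_ac)
    qed
    have "min \<bar>slope \<gamma> \<phi> - x\<bar> K = \<bar>slope \<gamma> \<phi> - x\<bar>" for \<phi>
      using B[of \<phi>] K(2) by (intro min_absorb1) linarith
    hence lim: "(\<lambda>n. ?E n (\<lambda>j. min \<bar>of_int j / X n - x\<bar> K)) \<longlonglongrightarrow> (\<integral>\<phi>. \<bar>slope \<gamma> \<phi> - x\<bar> \<partial>circle_measure)"
      using trunc[OF K(1)] by simp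
    have "\<forall>\<^sub>F n in sequentially. dist (?E n (\<lambda>j. min \<bar>of_int j / X n - x\<bar> K)) (\<integral>\<phi>. \<bar>slope \<gamma> \<phi> - x\<bar> \<partial>circle_measure) < \<epsilon> / 2"
      using eps by (intro tendstoD[OF lim]) simp
    with pos show "\<forall>\<^sub>F n in sequentially. dist (?E n (\<lambda>j. \<bar>of_int j / X n - x\<bar>)) (\<integral>\<phi>. \<bar>slope \<gamma> \<phi> - x\<bar> \<partial>circle_measure) < \<epsilon>"
    proof eventually_elim
      case (elim n)
      with tail[OF K(1) elim(1)] small show ?case unfolding dist_real_def by linarith
    qed
  qed
qed

section \<open>Particle counts\<close>

lemma suminf_indicator_card:
  fixes f :: "nat \<Rightarrow> int"
  assumes "inj f" "finite A" "A \<subseteq> range f"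
  shows "(\<Sum>i. indicator A (f i) :: ennreal) = of_nat (card A)"
proof -
  have fin: "finite (f -` A)" using assms by (intro finite_vimageI)
  have "(\<Sum>i. indicator A (f i) :: ennreal) = (\<Sum>i\<in>f -` A. indicator A (f i))"
    by (rule suminf_finite[OF fin]) (auto simp: indicator_def)
  also have "\<dots> = (\<Sum>i\<in>f -` A. 1)" by (rule sum.cong) auto
  also have "\<dots> = of_nat (card (f -` A))" by simp
  also have "card (f -` A) = card A" using assms by (intro card_vimage_inj)
  finally show ?thesis .
qed

lemma range_diff_int: "range (\<lambda>i. b - int i) = {..b}"
  by (auto simp: image_iff) (metis add_diff_cancel_left' diff_ge_0_iff_ge uminus_add_conv_diff zero_le_imp_eq_int diff_add_cancel add.commute)

definition particles :: "nat list \<Rightarrow> int \<Rightarrow> int set" where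
  "particles \<mu> n = {k \<in> range (site \<mu>). k > n}"

definition holes :: "nat list \<Rightarrow> int \<Rightarrow> int set" where
  "holes \<mu> n = {k. k \<le> n \<and> k \<notin> range (site \<mu>)}"

text \<open>From index m on the sites are frozen at -i, so both sets can be read off the first m
  sites and the window from 1 - m to n. There are m such sites, all at least 1 - m, and the window
  has n + m points; removing the common part from both leaves the difference n.\<close>

lemma particles_holes:
  assumes mu: "\<mu> \<in> partitions"
  shows "finite (particles \<mu> n)" "finite (holes \<mu> n)" "int (card (holes \<mu> n)) = int (card (particles \<mu> n)) + n"
proof -
  define m where "m = length \<mu> + nat (- n)"
  have m: "length \<mu> \<le> m" "n \<ge> - int m" by (auto simp: m_def)
  have low: "k \<in> range (site \<mu>)" if "k \<le> - int m" for k
  proof -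
    have "length \<mu> \<le> nat (- k)" "k \<le> 0" using that m(1) by linarith+
    hence "site \<mu> (nat (- k)) = k" by (simp add: site_beyond)
    thus ?thesis by (metis rangeI)
  qed
  have site_ge: "site \<mu> i \<ge> - int i" for i by (simp add: site_def)
  have high: "site \<mu> i \<le> - int m" if "i \<ge> m" for i
    using that m(1) by (simp add: site_beyond)
  have P: "particles \<mu> n = site \<mu> ` {..<m} - {1 - int m..n}"
  proof -
    have "i < m" if "site \<mu> i > n" for i using high[of i] m(2) that by (cases "i < m") auto
    moreover have "site \<mu> i \<ge> 1 - int m" if "i < m" for i using site_ge[of i] that by simp
    ultimately show ?thesis by (force simp: particles_def)
  qed
  have H: "holes \<mu> n = {1 - int m..n} - site \<mu> ` {..<m}"
  proof -
    have "k \<ge> 1 - int m" if "k \<notin> range (site \<mu>)" for k using low[of k] that by (cases "k \<le> - int m") auto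
    moreover have "k \<in> site \<mu> ` {..<m}" if k: "k \<in> range (site \<mu>)" "k \<ge> 1 - int m" for k
    proof -
      from k(1) obtain i where i: "k = site \<mu> i" by blast
      have "i < m" using high[of i] i k(2) by (cases "i < m") auto
      thus ?thesis using i by auto
    qed
    ultimately show ?thesis by (auto simp: holes_def)
  qed
  show "finite (particles \<mu> n)" "finite (holes \<mu> n)" unfolding P H by auto
  have "card (site \<mu> ` {..<m}) = m" using inj_site[OF mu] by (simp add: card_image)
  moreover have "card (site \<mu> ` {..<m}) = card (particles \<mu> n) + card (site \<mu> ` {..<m} \<inter> {1 - int m..n})"
    using card_Int_Diff[of "site \<mu> ` {..<m}" "{1 - int m..n}"] unfolding P by simp
  moreover have "card {1 - int m..n} = card (holes \<mu> n) + card (site \<mu> ` {..<m} \<inter> {1 - int m..n})"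
    using card_Int_Diff[of "{1 - int m..n}" "site \<mu> ` {..<m}"] unfolding H by (simp add: Int_commute)
  moreover have "int (card {1 - int m..n}) = n + int m" by (simp add: m_def)
  ultimately show "int (card (holes \<mu> n)) = int (card (particles \<mu> n)) + n" by linarith
qed

lemma particles_suminf:
  assumes "\<mu> \<in> partitions"
  shows "(\<Sum>i. indicator (range (site \<mu>)) (n + 1 + int i) :: ennreal) = of_nat (card (particles \<mu> n))"
proof -
  have "(\<Sum>i. indicator (range (site \<mu>)) (n + 1 + int i) :: ennreal) = (\<Sum>i. indicator (particles \<mu> n) (n + 1 + int i))"
    by (intro suminf_cong) (auto simp: indicator_def particles_def)
  also have "\<dots> = of_nat (card (particles \<mu> n))"
    by (rule suminf_indicator_card)
       (use particles_holes(1)[OF assms] in \<open>auto simp: inj_def range_add_int particles_def\<close>)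
  finally show ?thesis .
qed

lemma holes_suminf:
  assumes "\<mu> \<in> partitions"
  shows "(\<Sum>i. indicator (- range (site \<mu>)) (n - int i) :: ennreal) = of_nat (card (holes \<mu> n))"
proof -
  have "(\<Sum>i. indicator (- range (site \<mu>)) (n - int i) :: ennreal) = (\<Sum>i. indicator (holes \<mu> n) (n - int i))"
    by (intro suminf_cong) (auto simp: indicator_def holes_def)
  also have "\<dots> = of_nat (card (holes \<mu> n))"
    by (rule suminf_indicator_card)
       (use particles_holes(2)[OF assms] in \<open>auto simp: inj_def range_diff_int holes_def\<close>)
  finally show ?thesis .
qed

text \<open>A layer-cake formula: the number of levels above n that x reaches is the positive part
  of x - n.\<close>

lemma suminf_tail_indicator: "(\<Sum>i. indicator {n + 1 + int i..} x :: ennreal) = of_nat (nat (x - n))"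
proof -
  have "(\<Sum>i. indicator {n + 1 + int i..} x :: ennreal) = (\<Sum>i. indicator {n + 1..x} (n + 1 + int i))"
    by (intro suminf_cong) (auto simp: indicator_def)
  also have "\<dots> = of_nat (card {n + 1..x})"
    by (rule suminf_indicator_card) (auto simp: inj_def range_add_int)
  finally show ?thesis by simp
qed

lemma suminf_head_indicator: "(\<Sum>i. indicator {..<n - int i} x :: ennreal) = of_nat (nat (n - x))"
proof -
  have "(\<Sum>i. indicator {..<n - int i} x :: ennreal) = (\<Sum>i. indicator {x + 1..n} (n - int i))"
    by (intro suminf_cong) (auto simp: indicator_def)
  also have "\<dots> = of_nat (card {x + 1..n})"
    by (rule suminf_indicator_card) (auto simp: inj_def range_diff_int)
  finally show ?thesis by simp
qed

definition particle_count :: "int \<Rightarrow> nat list \<Rightarrow> real" where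
  "particle_count n \<mu> = real (card (particles \<mu> n))"

definition occupied :: "int \<Rightarrow> nat list set" where
  "occupied k = {\<mu> \<in> partitions. k \<in> range (site \<mu>)}"

section \<open>Expectation and variance of the particle count\<close>

context
  fixes \<gamma> :: "nat \<Rightarrow> real" and \<theta> :: real
  assumes fin: "finite (seq_support \<gamma>)" and pos: "\<theta> > 0"
begin

abbreviation (input) "\<tau> \<equiv> (\<lambda>r. \<theta> * \<gamma> r)"

definition norm_const :: real where
  "norm_const = exp (\<Sum>r\<in>seq_support \<tau>. real r * (\<tau> r)\<^sup>2)"

lemma fin_t: "finite (seq_support \<tau>)"
  using fin pos by (simp add: seq_support_scale)

lemma norm_const_pos: "norm_const > 0"
  by (simp add: norm_const_def)

lemma schur_weight_eq: "schur_weight \<gamma> \<theta> \<mu> = (schur \<mu> \<tau>)\<^sup>2 / norm_const"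
proof -
  have "\<theta>\<^sup>2 * (\<Sum>r\<in>seq_support \<gamma>. real r * (\<gamma> r)\<^sup>2) = (\<Sum>r\<in>seq_support \<tau>. real r * (\<tau> r)\<^sup>2)"
    using pos by (simp add: seq_support_scale sum_distrib_left power_mult_distrib mult_ac)
  thus ?thesis unfolding schur_weight_def norm_const_def by (simp add: exp_minus field_simps)
qed

lemma space_schur_measure [simp]: "space (schur_measure \<gamma> \<theta>) = partitions"
  by (simp add: schur_measure_def space_point_measure)

lemma sets_schur_measure [simp]: "sets (schur_measure \<gamma> \<theta>) = Pow partitions"
  by (simp add: schur_measure_def sets_point_measure)

lemma measurable_schur_measure [simp]: "f \<in> measurable (schur_measure \<gamma> \<theta>) N \<longleftrightarrow> f \<in> partitions \<rightarrow> space N"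
  by (simp add: schur_measure_def)

lemma emeasure_schur_measure_finite:
  assumes "finite \<Lambda>" "\<Lambda> \<subseteq> partitions"
  shows "emeasure (schur_measure \<gamma> \<theta>) \<Lambda> = ennreal ((\<Sum>\<mu>\<in>\<Lambda>. (schur \<mu> \<tau>)\<^sup>2) / norm_const)"
proof -
  have "emeasure (schur_measure \<gamma> \<theta>) \<Lambda> = (\<Sum>\<mu>\<in>\<Lambda>. ennreal (schur_weight \<gamma> \<theta> \<mu>))"
    unfolding schur_measure_def using assms by (intro emeasure_point_measure_finite2)
  also have "\<dots> = ennreal (\<Sum>\<mu>\<in>\<Lambda>. schur_weight \<gamma> \<theta> \<mu>)"
    by (rule sum_ennreal) (simp add: schur_weight_def)
  finally show ?thesis by (simp add: schur_weight_eq sum_divide_distrib)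
qed

lemma prob_space_schur_measure: "prob_space (schur_measure \<gamma> \<theta>)"
proof
  define A where "A d = {\<mu> \<in> partitions. int (sum_list \<mu>) = int d}" for d
  have "emeasure (schur_measure \<gamma> \<theta>) (space (schur_measure \<gamma> \<theta>)) = emeasure (schur_measure \<gamma> \<theta>) (\<Union>d. A d)"
    by (auto simp: A_def intro!: arg_cong2[where f = emeasure])
  also have "\<dots> = (\<Sum>d. emeasure (schur_measure \<gamma> \<theta>) (A d))"
    by (rule suminf_emeasure[symmetric]) (auto simp: A_def disjoint_family_on_def)
  also have "\<dots> = (\<Sum>d. ennreal (schur_square_sum \<tau> (int d) / norm_const))"
  proof (rule suminf_cong)
    fix d
    have "emeasure (schur_measure \<gamma> \<theta>) (A d) = ennreal ((\<Sum>\<mu>\<in>A d. (schur \<mu> \<tau>)\<^sup>2) / norm_const)"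
      unfolding A_def by (rule emeasure_schur_measure_finite[OF finite_partitions_of]) auto
    thus "emeasure (schur_measure \<gamma> \<theta>) (A d) = ennreal (schur_square_sum \<tau> (int d) / norm_const)"
      by (simp add: A_def schur_square_sum_def)
  qed
  also have "\<dots> = ennreal (norm_const / norm_const)"
  proof (rule suminf_ennreal_eq)
    show "0 \<le> schur_square_sum \<tau> (int d) / norm_const" for d
      unfolding schur_square_sum_def using norm_const_pos by (intro divide_nonneg_pos sum_nonneg) auto
    show "(\<lambda>d. schur_square_sum \<tau> (int d) / norm_const) sums (norm_const / norm_const)"
      by (rule sums_divide) (use schur_square_sum_sums[OF fin_t] in \<open>simp add: norm_const_def\<close>)
  qed
  finally show "emeasure (schur_measure \<gamma> \<theta>) (space (schur_measure \<gamma> \<theta>)) = 1"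
    using norm_const_pos by simp
qed

interpretation S: prob_space "schur_measure \<gamma> \<theta>" by (rule prob_space_schur_measure)

text \<open>Bounds for finite sets of partitions pass to arbitrary sets by exhaustion according to
  size, as there are finitely many partitions of each size.\<close>

lemma prob_schur_measure_le:
  assumes A: "A \<subseteq> partitions" and B: "\<And>\<Lambda>. finite \<Lambda> \<Longrightarrow> \<Lambda> \<subseteq> A \<Longrightarrow> (\<Sum>\<mu>\<in>\<Lambda>. (schur \<mu> \<tau>)\<^sup>2) \<le> B * norm_const"
  shows "S.prob A \<le> B"
proof -
  define A' where "A' N = {\<mu> \<in> A. sum_list \<mu> < N}" for N
  have finA: "finite (A' N)" for N
  proof (rule finite_subset)
    show "A' N \<subseteq> (\<Union>d<N. {\<mu> \<in> partitions. int (sum_list \<mu>) = int d})" using A by (auto simp: A'_def)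
  qed (intro finite_UN_I finite_partitions_of finite_lessThan)
  have "(\<lambda>N. S.prob (A' N)) \<longlonglongrightarrow> S.prob (\<Union>N. A' N)"
    by (rule S.finite_Lim_measure_incseq) (use A in \<open>auto simp: A'_def incseq_def\<close>)
  also have "(\<Union>N. A' N) = A" by (auto simp: A'_def)
  finally show ?thesis
  proof (rule LIMSEQ_le_const2, intro exI allI impI)
    fix N
    have B0: "B \<ge> 0" using B[of "{}"] norm_const_pos by (simp add: zero_le_mult_iff)
    have "emeasure (schur_measure \<gamma> \<theta>) (A' N) = ennreal ((\<Sum>\<mu>\<in>A' N. (schur \<mu> \<tau>)\<^sup>2) / norm_const)"
      by (rule emeasure_schur_measure_finite[OF finA]) (use A in \<open>auto simp: A'_def\<close>)
    hence "S.prob (A' N) = (\<Sum>\<mu>\<in>A' N. (schur \<mu> \<tau>)\<^sup>2) / norm_const"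
      using norm_const_pos by (simp add: measure_def sum_nonneg)
    also have "\<dots> \<le> B" using B[OF finA[of N]] norm_const_pos by (simp add: A'_def pos_divide_le_eq)
    finally show "S.prob (A' N) \<le> B" .
  qed
qed

lemma occupied_sets [simp]: "occupied k \<subseteq> partitions"
  by (auto simp: occupied_def)

lemma prob_occupied_le: "S.prob (occupied k) \<le> occupation \<tau> k"
proof (rule prob_schur_measure_le[OF occupied_sets])
  fix \<Lambda> assume L: "finite \<Lambda>" "\<Lambda> \<subseteq> occupied k"
  hence "{\<mu>. \<mu> \<in> \<Lambda> \<and> k \<in> range (site \<mu>)} = \<Lambda>" by (auto simp: occupied_def)
  thus "(\<Sum>\<mu>\<in>\<Lambda>. (schur \<mu> \<tau>)\<^sup>2) \<le> occupation \<tau> k * norm_const"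
    using correlation_bounds(1)[OF fin_t L(1), of k] L by (auto simp: norm_const_def occupied_def)
qed

lemma prob_occupied2_le:
  assumes "k \<noteq> l"
  shows "S.prob (occupied k \<inter> occupied l) \<le> occupation \<tau> k * occupation \<tau> l"
proof (rule prob_schur_measure_le)
  fix \<Lambda> assume L: "finite \<Lambda>" "\<Lambda> \<subseteq> occupied k \<inter> occupied l"
  hence "{\<mu>. \<mu> \<in> \<Lambda> \<and> k \<in> range (site \<mu>) \<and> l \<in> range (site \<mu>)} = \<Lambda>" by (auto simp: occupied_def)
  moreover have "\<Lambda> \<subseteq> partitions" using L by (auto simp: occupied_def)
  ultimately show "(\<Sum>\<mu>\<in>\<Lambda>. (schur \<mu> \<tau>)\<^sup>2) \<le> occupation \<tau> k * occupation \<tau> l * norm_const"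
    using correlation_bounds(2)[OF fin_t L(1) _ assms] by (simp add: norm_const_def)
qed (auto simp: occupied_def)

definition mean_excess :: "int \<Rightarrow> real" where
  "mean_excess n = measure_pmf.expectation (law \<tau>) (\<lambda>j. real (nat (j - n)))"

lemma integrable_nat_diff:
  "integrable (measure_pmf (law \<tau>)) (\<lambda>j. real (nat (j - n)))"
  "integrable (measure_pmf (law \<tau>)) (\<lambda>j. real (nat (n - j)))"
proof -
  have *: "integrable (measure_pmf (law \<tau>)) (\<lambda>j. \<bar>real_of_int j\<bar> + \<bar>of_int n\<bar>)"
    by (intro Bochner_Integration.integrable_add integrable_abs law_first_moment(1) fin_t) simp
  show "integrable (measure_pmf (law \<tau>)) (\<lambda>j. real (nat (j - n)))"
    by (rule Bochner_Integration.integrable_bound[OF *]) auto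
  show "integrable (measure_pmf (law \<tau>)) (\<lambda>j. real (nat (n - j)))"
    by (rule Bochner_Integration.integrable_bound[OF *]) auto
qed

lemma mean_excess_nonneg: "mean_excess n \<ge> 0"
  unfolding mean_excess_def by (intro integral_nonneg_AE) simp

lemma occupation_nonneg_t: "occupation \<tau> k \<ge> 0"
  by (rule occupation_nonneg[OF fin_t])

lemma suminf_occupation: "(\<Sum>i. ennreal (occupation \<tau> (n + 1 + int i))) = ennreal (mean_excess n)"
proof -
  have "(\<Sum>i. ennreal (occupation \<tau> (n + 1 + int i))) = (\<Sum>i. \<integral>\<^sup>+j. indicator {n + 1 + int i..} j \<partial>measure_pmf (law \<tau>))"
    by (simp add: law_tail[OF fin_t, symmetric] measure_pmf.emeasure_eq_measure)
  also have "\<dots> = (\<integral>\<^sup>+j. (\<Sum>i. indicator {n + 1 + int i..} j) \<partial>measure_pmf (law \<tau>))"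
    by (rule nn_integral_suminf[symmetric]) simp
  also have "\<dots> = (\<integral>\<^sup>+j. ennreal (real (nat (j - n))) \<partial>measure_pmf (law \<tau>))"
    by (simp add: suminf_tail_indicator ennreal_of_nat_eq_real_of_nat)
  also have "\<dots> = ennreal (mean_excess n)"
    unfolding mean_excess_def by (rule nn_integral_eq_integral[OF integrable_nat_diff(1)]) simp
  finally show ?thesis .
qed

text \<open>The lower tails add up to E (n - X)_+, which is E (X - n)_+ + n because X has mean
  0.\<close>

lemma suminf_not_occupation: "(\<Sum>i. ennreal (1 - occupation \<tau> (n - int i))) = ennreal (mean_excess n + of_int n)"
proof -
  have "(\<Sum>i. ennreal (1 - occupation \<tau> (n - int i))) = (\<Sum>i. \<integral>\<^sup>+j. indicator {..<n - int i} j \<partial>measure_pmf (law \<tau>))"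
  proof (rule suminf_cong)
    fix i
    have "1 - occupation \<tau> (n - int i) = measure_pmf.prob (law \<tau>) (space (measure_pmf (law \<tau>)) - {n - int i..})"
      by (subst measure_pmf.prob_compl) (auto simp: law_tail[OF fin_t])
    also have "space (measure_pmf (law \<tau>)) - {n - int i..} = {..<n - int i}" by auto
    finally show "ennreal (1 - occupation \<tau> (n - int i)) = (\<integral>\<^sup>+j. indicator {..<n - int i} j \<partial>measure_pmf (law \<tau>))"
      by (simp add: measure_pmf.emeasure_eq_measure)
  qed
  also have "\<dots> = (\<integral>\<^sup>+j. (\<Sum>i. indicator {..<n - int i} j) \<partial>measure_pmf (law \<tau>))"
    by (rule nn_integral_suminf[symmetric]) simp
  also have "\<dots> = (\<integral>\<^sup>+j. ennreal (real (nat (n - j))) \<partial>measure_pmf (law \<tau>))"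
    by (simp add: suminf_head_indicator ennreal_of_nat_eq_real_of_nat)
  also have "\<dots> = ennreal (measure_pmf.expectation (law \<tau>) (\<lambda>j. real (nat (n - j))))"
    by (rule nn_integral_eq_integral[OF integrable_nat_diff(2)]) simp
  also have "measure_pmf.expectation (law \<tau>) (\<lambda>j. real (nat (n - j))) = measure_pmf.expectation (law \<tau>) (\<lambda>j. real (nat (j - n)) - (real_of_int j - of_int n))"
    by (intro Bochner_Integration.integral_cong) auto
  also have "\<dots> = mean_excess n - (measure_pmf.expectation (law \<tau>) real_of_int - of_int n)"
    unfolding mean_excess_def using integrable_nat_diff(1) law_first_moment(1)[OF fin_t] by simp
  finally show ?thesis by (simp add: law_first_moment(2)[OF fin_t])
qed

lemma indicator_occupied: "\<mu> \<in> partitions \<Longrightarrow> indicator (range (site \<mu>)) k = indicator (occupied k) \<mu>"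
  by (simp add: occupied_def indicator_def)

lemma nn_integral_count_le: "(\<integral>\<^sup>+\<mu>. ennreal (particle_count n \<mu>) \<partial>schur_measure \<gamma> \<theta>) \<le> ennreal (mean_excess n)"
proof -
  have "(\<integral>\<^sup>+\<mu>. ennreal (particle_count n \<mu>) \<partial>schur_measure \<gamma> \<theta>) = (\<integral>\<^sup>+\<mu>. (\<Sum>i. indicator (occupied (n + 1 + int i)) \<mu>) \<partial>schur_measure \<gamma> \<theta>)"
    by (intro nn_integral_cong) (simp add: particle_count_def ennreal_of_nat_eq_real_of_nat[symmetric] particles_suminf[symmetric] indicator_occupied)
  also have "\<dots> = (\<Sum>i. \<integral>\<^sup>+\<mu>. indicator (occupied (n + 1 + int i)) \<mu> \<partial>schur_measure \<gamma> \<theta>)"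
    by (rule nn_integral_suminf) simp
  also have "\<dots> = (\<Sum>i. ennreal (S.prob (occupied (n + 1 + int i))))"
    by (simp add: S.emeasure_eq_measure)
  also have "\<dots> \<le> (\<Sum>i. ennreal (occupation \<tau> (n + 1 + int i)))"
    by (intro suminf_le ennreal_leI prob_occupied_le) auto
  finally show ?thesis by (simp add: suminf_occupation)
qed

lemma integrable_count: "integrable (schur_measure \<gamma> \<theta>) (particle_count n)"
proof (rule integrableI_bounded)
  show "(\<integral>\<^sup>+\<mu>. ennreal (norm (particle_count n \<mu>)) \<partial>schur_measure \<gamma> \<theta>) < \<infinity>"
    using nn_integral_count_le[of n] by (simp add: particle_count_def) (metis ennreal_less_top le_less_trans)
qed simp

lemma expectation_count: "S.expectation (particle_count n) = mean_excess n"
proof (rule antisym)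
  have "ennreal (S.expectation (particle_count n)) \<le> ennreal (mean_excess n)"
    using nn_integral_count_le[of n] nn_integral_eq_integral[OF integrable_count, of n] by (simp add: particle_count_def)
  thus "S.expectation (particle_count n) \<le> mean_excess n" by (simp add: mean_excess_nonneg)
  have hole_count: "real (card (holes \<mu> n)) = particle_count n \<mu> + of_int n" if "\<mu> \<in> partitions" for \<mu>
    using particles_holes(3)[OF that, of n] unfolding particle_count_def by linarith
  have hole_nonneg: "0 \<le> particle_count n \<mu> + of_int n" if "\<mu> \<in> partitions" for \<mu>
    unfolding hole_count[OF that, symmetric] by simp
  \<comment> \<open>From here on holes are counted: an upper bound for occupation is a lower bound
    for vacancy, and subtracting n returns to particles.\<close>
  have "ennreal (mean_excess n + of_int n) = (\<Sum>i. ennreal (1 - occupation \<tau> (n - int i)))"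
    by (rule suminf_not_occupation[symmetric])
  also have "\<dots> \<le> (\<Sum>i. ennreal (S.prob (partitions - occupied (n - int i))))"
  proof (intro suminf_le ennreal_leI)
    fix i
    have "S.prob (partitions - occupied (n - int i)) = 1 - S.prob (occupied (n - int i))"
      using S.prob_compl[of "occupied (n - int i)"] by simp
    thus "1 - occupation \<tau> (n - int i) \<le> S.prob (partitions - occupied (n - int i))"
      using prob_occupied_le[of "n - int i"] by simp
  qed auto
  also have "\<dots> = (\<Sum>i. \<integral>\<^sup>+\<mu>. indicator (partitions - occupied (n - int i)) \<mu> \<partial>schur_measure \<gamma> \<theta>)"
    by (intro suminf_cong) (subst nn_integral_indicator, auto simp: S.emeasure_eq_measure)
  also have "\<dots> = (\<integral>\<^sup>+\<mu>. (\<Sum>i. indicator (partitions - occupied (n - int i)) \<mu>) \<partial>schur_measure \<gamma> \<theta>)"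
    by (rule nn_integral_suminf[symmetric]) simp
  also have "\<dots> = (\<integral>\<^sup>+\<mu>. ennreal (particle_count n \<mu> + of_int n) \<partial>schur_measure \<gamma> \<theta>)"
  proof (intro nn_integral_cong)
    fix \<mu> assume "\<mu> \<in> space (schur_measure \<gamma> \<theta>)"
    hence mu: "\<mu> \<in> partitions" by simp
    have "(\<Sum>i. indicator (partitions - occupied (n - int i)) \<mu> :: ennreal) = (\<Sum>i. indicator (- range (site \<mu>)) (n - int i))"
      using mu by (intro suminf_cong) (auto simp: indicator_def occupied_def)
    also have "\<dots> = of_nat (card (holes \<mu> n))" by (rule holes_suminf[OF mu])
    finally show "(\<Sum>i. indicator (partitions - occupied (n - int i)) \<mu>) = ennreal (particle_count n \<mu> + of_int n)"
      using hole_count[OF mu] by (simp add: ennreal_of_nat_eq_real_of_nat)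
  qed
  also have "\<dots> = ennreal (S.expectation (\<lambda>\<mu>. particle_count n \<mu> + of_int n))"
  proof (rule nn_integral_eq_integral)
    show "integrable (schur_measure \<gamma> \<theta>) (\<lambda>\<mu>. particle_count n \<mu> + of_int n)"
      using integrable_count by simp
    show "AE \<mu> in schur_measure \<gamma> \<theta>. 0 \<le> particle_count n \<mu> + of_int n"
      by (rule AE_I2) (simp add: hole_nonneg)
  qed
  also have "S.expectation (\<lambda>\<mu>. particle_count n \<mu> + of_int n) = S.expectation (particle_count n) + of_int n"
    using integrable_count by (simp add: S.prob_space[simplified])
  finally have "ennreal (mean_excess n + of_int n) \<le> ennreal (S.expectation (particle_count n) + of_int n)" .
  moreover have "S.expectation (particle_count n) + of_int n \<ge> 0"
  proof -
    have "S.expectation (\<lambda>\<mu>. particle_count n \<mu> + of_int n) \<ge> 0"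
      by (rule integral_nonneg_AE, rule AE_I2) (simp add: hole_nonneg)
    thus ?thesis using integrable_count by (simp add: S.prob_space[simplified])
  qed
  ultimately show "mean_excess n \<le> S.expectation (particle_count n)" by (simp add: ennreal_le_iff)
qed

text \<open>The square counts ordered pairs of occupied sites. Off the diagonal a pair costs at most
  the product of the two bounds, on the diagonal a single bound. Extending the product to the
  diagonal only enlarges the sum, which then factorises.\<close>

lemma nn_integral_count_square_le:
  "(\<integral>\<^sup>+\<mu>. ennreal ((particle_count n \<mu>)\<^sup>2) \<partial>schur_measure \<gamma> \<theta>) \<le> ennreal ((mean_excess n)\<^sup>2 + mean_excess n)"
proof -
  let ?k = "\<lambda>i. n + 1 + int i"
  have "(\<integral>\<^sup>+\<mu>. ennreal ((particle_count n \<mu>)\<^sup>2) \<partial>schur_measure \<gamma> \<theta>) =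
     (\<integral>\<^sup>+\<mu>. (\<Sum>i. \<Sum>j. indicator (occupied (?k i) \<inter> occupied (?k j)) \<mu>) \<partial>schur_measure \<gamma> \<theta>)"
  proof (intro nn_integral_cong)
    fix \<mu> assume "\<mu> \<in> space (schur_measure \<gamma> \<theta>)"
    hence mu: "\<mu> \<in> partitions" by simp
    have "ennreal ((particle_count n \<mu>)\<^sup>2) = (\<Sum>i. indicator (occupied (?k i)) \<mu>) * (\<Sum>j. indicator (occupied (?k j)) \<mu>)"
      using particles_suminf[OF mu, of n] mu
      by (simp add: particle_count_def power2_eq_square ennreal_mult ennreal_of_nat_eq_real_of_nat indicator_occupied)
    also have "\<dots> = (\<Sum>i. \<Sum>j. indicator (occupied (?k i) \<inter> occupied (?k j)) \<mu>)"
      by (simp add: indicator_inter_arith)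
    finally show "ennreal ((particle_count n \<mu>)\<^sup>2) = (\<Sum>i. \<Sum>j. indicator (occupied (?k i) \<inter> occupied (?k j)) \<mu>)" .
  qed
  also have "\<dots> = (\<Sum>i. \<integral>\<^sup>+\<mu>. (\<Sum>j. indicator (occupied (?k i) \<inter> occupied (?k j)) \<mu>) \<partial>schur_measure \<gamma> \<theta>)"
    by (rule nn_integral_suminf) simp
  also have "\<dots> = (\<Sum>i. \<Sum>j. \<integral>\<^sup>+\<mu>. indicator (occupied (?k i) \<inter> occupied (?k j)) \<mu> \<partial>schur_measure \<gamma> \<theta>)"
    by (intro suminf_cong nn_integral_suminf) simp
  also have "\<dots> = (\<Sum>i. \<Sum>j. ennreal (S.prob (occupied (?k i) \<inter> occupied (?k j))))"
    by (intro suminf_cong) (subst nn_integral_indicator, auto simp: S.emeasure_eq_measure occupied_def)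
  also have "\<dots> \<le> (\<Sum>i. \<Sum>j. ennreal (occupation \<tau> (?k i)) * ennreal (occupation \<tau> (?k j)) + ennreal (occupation \<tau> (?k i)) * indicator {i} j)"
  proof (intro suminf_le)
    fix i j
    show "ennreal (S.prob (occupied (?k i) \<inter> occupied (?k j))) \<le> ennreal (occupation \<tau> (?k i)) * ennreal (occupation \<tau> (?k j)) + ennreal (occupation \<tau> (?k i)) * indicator {i} j"
    proof (cases "i = j")
      case True
      have "ennreal (S.prob (occupied (?k i))) \<le> ennreal (occupation \<tau> (?k i))" by (intro ennreal_leI prob_occupied_le)
      thus ?thesis using True by (simp add: add_increasing)
    next
      case False
      hence "ennreal (S.prob (occupied (?k i) \<inter> occupied (?k j))) \<le> ennreal (occupation \<tau> (?k i) * occupation \<tau> (?k j))"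
        by (intro ennreal_leI prob_occupied2_le) simp
      thus ?thesis using False by (simp add: ennreal_mult occupation_nonneg_t)
    qed
  qed auto
  also have "\<dots> = (\<Sum>i. ennreal (occupation \<tau> (?k i)) * (\<Sum>j. ennreal (occupation \<tau> (?k j))) + ennreal (occupation \<tau> (?k i)))"
  proof (rule suminf_cong)
    fix i
    have "(\<Sum>j. indicator {i} j :: ennreal) = 1"
      by (subst suminf_finite[of "{i}"]) auto
    thus "(\<Sum>j. ennreal (occupation \<tau> (?k i)) * ennreal (occupation \<tau> (?k j)) + ennreal (occupation \<tau> (?k i)) * indicator {i} j) =
       ennreal (occupation \<tau> (?k i)) * (\<Sum>j. ennreal (occupation \<tau> (?k j))) + ennreal (occupation \<tau> (?k i))"
      by (simp add: suminf_add[symmetric])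
  qed
  also have "\<dots> = ennreal (mean_excess n) * ennreal (mean_excess n) + ennreal (mean_excess n)"
    by (simp add: suminf_add[symmetric] suminf_occupation)
  also have "\<dots> = ennreal ((mean_excess n)\<^sup>2 + mean_excess n)"
    by (simp add: mean_excess_nonneg ennreal_mult power2_eq_square)
  finally show ?thesis .
qed

lemma count_concentration:
  assumes "a > 0"
  shows "S.prob {\<mu> \<in> partitions. a \<le> \<bar>particle_count n \<mu> - mean_excess n\<bar>} \<le> mean_excess n / a\<^sup>2"
proof -
  have int2: "integrable (schur_measure \<gamma> \<theta>) (\<lambda>\<mu>. (particle_count n \<mu>)\<^sup>2)"
  proof (rule integrableI_bounded)
    show "(\<integral>\<^sup>+\<mu>. ennreal (norm ((particle_count n \<mu>)\<^sup>2)) \<partial>schur_measure \<gamma> \<theta>) < \<infinity>"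
      using nn_integral_count_square_le[of n] by simp (metis ennreal_less_top le_less_trans)
  qed simp
  have "ennreal (S.expectation (\<lambda>\<mu>. (particle_count n \<mu>)\<^sup>2)) \<le> ennreal ((mean_excess n)\<^sup>2 + mean_excess n)"
    using nn_integral_count_square_le[of n] nn_integral_eq_integral[OF int2] by simp
  hence "S.expectation (\<lambda>\<mu>. (particle_count n \<mu>)\<^sup>2) \<le> (mean_excess n)\<^sup>2 + mean_excess n"
    by (subst (asm) ennreal_le_iff) (simp_all add: mean_excess_nonneg)
  \<comment> \<open>The variance is at most M^2 + M minus the squared mean; since the mean is
    exactly M and not merely at most M, the large term M^2 cancels.\<close>
  hence var: "S.variance (particle_count n) \<le> mean_excess n"
    by (subst S.variance_eq[OF integrable_count int2]) (simp add: expectation_count)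
  have "S.prob {\<mu> \<in> space (schur_measure \<gamma> \<theta>). a \<le> \<bar>particle_count n \<mu> - S.expectation (particle_count n)\<bar>} \<le> S.variance (particle_count n) / a\<^sup>2"
    by (rule S.Chebyshev_inequality) (use int2 assms in auto)
  also have "\<dots> \<le> mean_excess n / a\<^sup>2" using var by (simp add: divide_right_mono)
  finally show ?thesis by (simp add: expectation_count)
qed

end

section \<open>The limit shape\<close>

lemma slope_has_derivative:
  "(slope \<gamma> has_real_derivative - 2 * (\<Sum>r\<in>seq_support \<gamma>. real r ^ 2 * \<gamma> r * sin (real r * \<phi>))) (at \<phi> within A)"
  unfolding slope_def
  by (auto intro!: derivative_eq_intros sum.cong simp: sum_distrib_left power2_eq_square sum_negf[symmetric])

lemma slope_0: "slope \<gamma> 0 = right_edge \<gamma>"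
  by (simp add: slope_def right_edge_def)

lemma slope_pi: "slope \<gamma> pi = - left_edge \<gamma>"
  by (simp add: slope_def left_edge_def sum_negf[symmetric] cos_npi mult_ac)

lemma phase_0 [simp]: "phase \<gamma> 0 = 0"
  by (simp add: phase_def)

lemma phase_pi [simp]: "phase \<gamma> pi = 0"
  by (simp add: phase_def)

lemma slope_even: "slope \<gamma> (- \<phi>) = slope \<gamma> \<phi>"
  by (simp add: slope_def)

lemma integral_slope: "a \<le> b \<Longrightarrow> (slope \<gamma> has_integral phase \<gamma> b - phase \<gamma> a) {a..b}"
  by (rule fundamental_theorem_of_calculus)
     (auto intro: phase_has_derivative simp: has_real_derivative_iff_has_vector_derivative[symmetric])

context
  fixes m :: nat and \<gamma> :: "nat \<Rightarrow> real"
  assumes m: "1 \<le> m" and mc: "multicritical m \<gamma>"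
begin

lemma fin_supp: "finite (seq_support \<gamma>)"
  using mc by (simp add: multicritical_def)

text \<open>Taylor expansion of the cosines to order 2 m. The powers 2 p with 1 \<le> p < m vanish
  by multicriticality and the odd ones are absent; the constant term is the right edge, and the
  coefficient at order 2 m is minus \<open>fluct_coeff m \<gamma>\<close>.\<close>

lemma slope_expansion: "\<exists>C. \<forall>\<phi>\<ge>0. \<bar>right_edge \<gamma> - slope \<gamma> \<phi> - fluct_coeff m \<gamma> * \<phi> ^ (2 * m)\<bar> \<le> C * \<phi> ^ (2 * m + 1)"
proof -
  define R where "R y = cos y - (\<Sum>k<2 * m + 1. cos_coeff k * y ^ k)" for y :: real
  have R: "\<bar>R y\<bar> \<le> \<bar>y\<bar> ^ (2 * m + 1)" for y
  proof -
    obtain s where s: "cos y = (\<Sum>k<2 * m + 1. cos_coeff k * y ^ k) + (cos (s + 1/2 * real (2 * m + 1) * pi) / fact (2 * m + 1)) * y ^ (2 * m + 1)"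
      using Maclaurin_cos_expansion[of y "2 * m + 1"] by blast
    have "\<bar>R y\<bar> = \<bar>cos (s + 1/2 * real (2 * m + 1) * pi)\<bar> / fact (2 * m + 1) * \<bar>y\<bar> ^ (2 * m + 1)"
      unfolding R_def s by (simp add: abs_mult power_abs del: power_Suc fact_Suc)
    also have "\<dots> \<le> 1 * \<bar>y\<bar> ^ (2 * m + 1)"
    proof (intro mult_right_mono)
      have "\<bar>c\<bar> / K \<le> 1" if "\<bar>c\<bar> \<le> 1" "1 \<le> K" for c K :: real
        using that by (simp add: divide_le_eq)
      thus "\<bar>cos (s + 1/2 * real (2 * m + 1) * pi)\<bar> / fact (2 * m + 1) \<le> 1"
        using abs_cos_le_one fact_ge_1 by blast
    qed auto
    finally show ?thesis by simp
  qed
  define T where "T k = (\<Sum>r\<in>seq_support \<gamma>. real r ^ (k + 1) * \<gamma> r)" for k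
  have T0: "T (2 * p) = 0" if "1 \<le> p" "p < m" for p
    using mc that by (simp add: multicritical_def T_def)
  have eq: "slope \<gamma> \<phi> = right_edge \<gamma> - fluct_coeff m \<gamma> * \<phi> ^ (2 * m) + 2 * (\<Sum>r\<in>seq_support \<gamma>. real r * \<gamma> r * R (real r * \<phi>))" for \<phi>
  proof -
    have "slope \<gamma> \<phi> = 2 * (\<Sum>r\<in>seq_support \<gamma>. real r * \<gamma> r * ((\<Sum>k<2 * m + 1. cos_coeff k * (real r * \<phi>) ^ k) + R (real r * \<phi>)))"
      unfolding slope_def R_def by simp
    also have "\<dots> = 2 * (\<Sum>r\<in>seq_support \<gamma>. \<Sum>k<2 * m + 1. cos_coeff k * \<phi> ^ k * (real r ^ (k + 1) * \<gamma> r)) + 2 * (\<Sum>r\<in>seq_support \<gamma>. real r * \<gamma> r * R (real r * \<phi>))"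
      by (simp add: ring_distribs sum.distrib sum_distrib_left power_mult_distrib mult_ac)
    also have "(\<Sum>r\<in>seq_support \<gamma>. \<Sum>k<2 * m + 1. cos_coeff k * \<phi> ^ k * (real r ^ (k + 1) * \<gamma> r)) = (\<Sum>k<2 * m + 1. cos_coeff k * \<phi> ^ k * T k)"
      unfolding T_def by (subst sum.swap) (simp only: sum_distrib_left)
    also have "\<dots> = (\<Sum>k\<in>{0, 2 * m}. cos_coeff k * \<phi> ^ k * T k)"
    proof (rule sum.mono_neutral_right)
      show "\<forall>k\<in>{..<2 * m + 1} - {0, 2 * m}. cos_coeff k * \<phi> ^ k * T k = 0"
      proof
        fix k assume k: "k \<in> {..<2 * m + 1} - {0, 2 * m}"
        show "cos_coeff k * \<phi> ^ k * T k = 0"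
        proof (cases "even k")
          case True
          then obtain p where "k = 2 * p" by (rule evenE)
          thus ?thesis using k T0[of p] by auto
        qed (simp add: cos_coeff_def)
      qed
    qed auto
    also have "\<dots> = T 0 + (-1) ^ m / fact (2 * m) * \<phi> ^ (2 * m) * T (2 * m)"
      using m by (simp add: cos_coeff_def)
    also have "2 * (T 0 + (-1) ^ m / fact (2 * m) * \<phi> ^ (2 * m) * T (2 * m)) = right_edge \<gamma> - fluct_coeff m \<gamma> * \<phi> ^ (2 * m)"
      by (simp add: T_def right_edge_def fluct_coeff_def algebra_simps)
    finally show ?thesis .
  qed
  define C where "C = 2 * (\<Sum>r\<in>seq_support \<gamma>. real r * \<bar>\<gamma> r\<bar> * real r ^ (2 * m + 1))"
  have "\<bar>right_edge \<gamma> - slope \<gamma> \<phi> - fluct_coeff m \<gamma> * \<phi> ^ (2 * m)\<bar> \<le> C * \<phi> ^ (2 * m + 1)" if "\<phi> \<ge> 0" for \<phi>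
  proof -
    have "\<bar>right_edge \<gamma> - slope \<gamma> \<phi> - fluct_coeff m \<gamma> * \<phi> ^ (2 * m)\<bar> = 2 * \<bar>\<Sum>r\<in>seq_support \<gamma>. real r * \<gamma> r * R (real r * \<phi>)\<bar>"
      unfolding eq by (simp add: abs_mult)
    also have "\<dots> \<le> 2 * (\<Sum>r\<in>seq_support \<gamma>. \<bar>real r * \<gamma> r * R (real r * \<phi>)\<bar>)"
      by (intro mult_left_mono sum_abs) auto
    also have "\<dots> \<le> 2 * (\<Sum>r\<in>seq_support \<gamma>. real r * \<bar>\<gamma> r\<bar> * (real r * \<phi>) ^ (2 * m + 1))"
    proof (intro mult_left_mono sum_mono)
      fix r
      have "\<bar>R (real r * \<phi>)\<bar> \<le> (real r * \<phi>) ^ (2 * m + 1)" using R[of "real r * \<phi>"] that by (simp del: power_Suc)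
      thus "\<bar>real r * \<gamma> r * R (real r * \<phi>)\<bar> \<le> real r * \<bar>\<gamma> r\<bar> * (real r * \<phi>) ^ (2 * m + 1)"
        by (simp add: abs_mult mult_left_mono del: power_Suc)
    qed auto
    also have "\<dots> = C * \<phi> ^ (2 * m + 1)"
      by (simp add: C_def sum_distrib_left sum_distrib_right power_mult_distrib mult_ac del: power_Suc)
    finally show ?thesis .
  qed
  thus ?thesis by blast
qed

lemma slope_asymp: "((\<lambda>\<phi>. (right_edge \<gamma> - slope \<gamma> \<phi>) / \<phi> ^ (2 * m)) \<longlongrightarrow> fluct_coeff m \<gamma>) (at_right 0)"
proof -
  obtain C where C: "\<And>\<phi>. \<phi> \<ge> 0 \<Longrightarrow> \<bar>right_edge \<gamma> - slope \<gamma> \<phi> - fluct_coeff m \<gamma> * \<phi> ^ (2 * m)\<bar> \<le> C * \<phi> ^ (2 * m + 1)"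
    using slope_expansion by blast
  have "((\<lambda>\<phi>. (right_edge \<gamma> - slope \<gamma> \<phi>) / \<phi> ^ (2 * m) - fluct_coeff m \<gamma>) \<longlongrightarrow> 0) (at_right 0)"
  proof (rule Lim_null_comparison)
    show "\<forall>\<^sub>F \<phi> in at_right 0. norm ((right_edge \<gamma> - slope \<gamma> \<phi>) / \<phi> ^ (2 * m) - fluct_coeff m \<gamma>) \<le> C * \<phi>"
      using eventually_at_right_less[of 0]
    proof eventually_elim
      case (elim \<phi>)
      have "(right_edge \<gamma> - slope \<gamma> \<phi>) / \<phi> ^ (2 * m) - fluct_coeff m \<gamma> = (right_edge \<gamma> - slope \<gamma> \<phi> - fluct_coeff m \<gamma> * \<phi> ^ (2 * m)) / \<phi> ^ (2 * m)"
        using elim by (simp add: field_simps)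
      also have "norm \<dots> \<le> (C * \<phi> ^ (2 * m + 1)) / \<phi> ^ (2 * m)"
        using C[of \<phi>] elim by (simp add: abs_divide divide_right_mono del: power_Suc)
      also have "\<dots> = C * \<phi>" using elim by simp
      finally show ?case .
    qed
    show "((\<lambda>\<phi>. C * \<phi>) \<longlongrightarrow> 0) (at_right 0)"
      by (rule tendsto_eq_intros refl)+ simp
  qed
  thus ?thesis by (simp add: LIM_zero_iff)
qed

lemma fluct_coeff_nonzero: "fluct_coeff m \<gamma> \<noteq> 0"
  using mc by (simp add: multicritical_def fluct_coeff_def)

lemma slope_antimono: "0 \<le> \<phi> \<Longrightarrow> \<phi> \<le> \<phi>' \<Longrightarrow> \<phi>' \<le> pi \<Longrightarrow> slope \<gamma> \<phi>' \<le> slope \<gamma> \<phi>"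
proof -
  assume h: "0 \<le> \<phi>" "\<phi> \<le> \<phi>'" "\<phi>' \<le> pi"
  show ?thesis
  proof (rule DERIV_nonpos_imp_nonincreasing[OF h(2)])
    fix x assume "\<phi> \<le> x" "x \<le> \<phi>'"
    hence "x \<in> {0..pi}" using h by auto
    hence "- 2 * (\<Sum>r\<in>seq_support \<gamma>. real r ^ 2 * \<gamma> r * sin (real r * x)) \<le> 0"
      using mc by (simp add: multicritical_def)
    thus "\<exists>y. (slope \<gamma> has_real_derivative y) (at x) \<and> y \<le> 0" using slope_has_derivative by blast
  qed
qed

text \<open>If the decrease is not strict, \<open>slope \<gamma>\<close> is constant on an interval,
  hence everywhere, being the restriction of an entire function. The limit in
  \<open>slope_asymp\<close> would then be 0, whereas it is the nonzero fluctuation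
  coefficient.\<close>

lemma slope_strict_antimono:
  assumes "0 \<le> \<phi>" "\<phi> < \<phi>'" "\<phi>' \<le> pi"
  shows "slope \<gamma> \<phi>' < slope \<gamma> \<phi>"
proof (rule ccontr)
  assume "\<not> ?thesis"
  hence const: "slope \<gamma> y = slope \<gamma> \<phi>" if "y \<in> {\<phi>..\<phi>'}" for y
    using slope_antimono[of \<phi> y] slope_antimono[of y \<phi>'] that assms by auto
  define G where "G z = 2 * (\<Sum>r\<in>seq_support \<gamma>. of_real (real r * \<gamma> r) * cos (of_nat r * z)) - of_real (slope \<gamma> \<phi>)" for z :: complex
  have G_real: "G (of_real y) = of_real (slope \<gamma> y - slope \<gamma> \<phi>)" for y
    by (simp add: G_def slope_def flip: cos_of_real)
  have "G w = 0" for w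
  proof (rule analytic_continuation[of G UNIV "of_real ` {\<phi>..\<phi>'}" "of_real \<phi>"])
    show "G holomorphic_on UNIV" unfolding G_def by (intro holomorphic_intros)
    show "complex_of_real \<phi> islimpt of_real ` {\<phi>..\<phi>'}"
    proof (rule islimpt_sequential[THEN iffD2], intro exI conjI allI)
      define s where "s n = \<phi> + (\<phi>' - \<phi>) / real (Suc n)" for n
      have s: "\<phi> < s n" "s n \<le> \<phi>'" for n 
      proof -
        have "(\<phi>' - \<phi>) / real (Suc n) \<le> (\<phi>' - \<phi>) / 1" using assms(2) by (intro divide_left_mono) auto
        thus "\<phi> < s n" "s n \<le> \<phi>'" using assms(2) by (auto simp: s_def)
      qed
      show "complex_of_real (s n) \<in> of_real ` {\<phi>..\<phi>'} - {of_real \<phi>}" for n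
      proof -
        have "s n \<in> {\<phi>..\<phi>'}" "s n \<noteq> \<phi>" using s[of n] by auto
        thus ?thesis by (simp only: Diff_iff imageI singleton_iff of_real_eq_iff simp_thms)
      qed
      have "s \<longlonglongrightarrow> \<phi> + 0" unfolding s_def[abs_def]
        by (rule tendsto_add[OF tendsto_const LIMSEQ_Suc[OF lim_const_over_n]])
      thus "(\<lambda>n. complex_of_real (s n)) \<longlonglongrightarrow> of_real \<phi>" by (simp add: tendsto_of_real_iff)
    qed
    show "G z = 0" if z: "z \<in> of_real ` {\<phi>..\<phi>'}" for z
    proof -
      from z obtain y where y: "y \<in> {\<phi>..\<phi>'}" "z = of_real y" by (rule imageE)
      show ?thesis unfolding y(2) G_real const[OF y(1)] by simp
    qed
  qed (simp_all add: connected_UNIV)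
  hence "complex_of_real (slope \<gamma> y - slope \<gamma> \<phi>) = 0" for y unfolding G_real[symmetric] .
  hence "slope \<gamma> y = slope \<gamma> \<phi>" for y by simp
  hence "slope \<gamma> y = slope \<gamma> 0" for y by metis
  hence "(\<lambda>\<phi>. (right_edge \<gamma> - slope \<gamma> \<phi>) / \<phi> ^ (2 * m)) = (\<lambda>_. 0)" by (simp add: slope_0 fun_eq_iff)
  hence "((\<lambda>_. 0) \<longlongrightarrow> fluct_coeff m \<gamma>) (at_right (0::real))" using slope_asymp by simp
  hence "fluct_coeff m \<gamma> = 0" by (simp add: tendsto_const_iff)
  with fluct_coeff_nonzero show False by simp
qed

lemma fluct_coeff_pos: "fluct_coeff m \<gamma> > 0"
proof -
  have "fluct_coeff m \<gamma> \<ge> 0"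
  proof (rule tendsto_lowerbound[OF slope_asymp])
    show "\<forall>\<^sub>F \<phi> in at_right 0. 0 \<le> (right_edge \<gamma> - slope \<gamma> \<phi>) / \<phi> ^ (2 * m)"
      using eventually_at_right_less[of 0] eventually_at_right_real[OF pi_gt_zero]
    proof eventually_elim
      case (elim \<phi>)
      hence "slope \<gamma> \<phi> \<le> right_edge \<gamma>" using slope_antimono[of 0 \<phi>] by (simp add: slope_0)
      thus ?case by simp
    qed
  qed simp
  thus ?thesis using fluct_coeff_nonzero by simp
qed

section \<open>The inverse function of the slope and the limit shape\<close>

abbreviation (input) "bR \<equiv> right_edge \<gamma>"
abbreviation (input) "bL \<equiv> left_edge \<gamma>"

lemma edges_less: "- bL < bR"
  using slope_strict_antimono[of 0 pi] by (simp add: slope_0 slope_pi)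

lemma slope_inj: "\<phi> \<in> {0..pi} \<Longrightarrow> \<phi>' \<in> {0..pi} \<Longrightarrow> slope \<gamma> \<phi> = slope \<gamma> \<phi>' \<Longrightarrow> \<phi> = \<phi>'"
  using slope_strict_antimono[of \<phi> \<phi>'] slope_strict_antimono[of \<phi>' \<phi>] by (cases \<phi> \<phi>' rule: linorder_cases) auto

lemma chi_slope: "\<phi> \<in> {0..pi} \<Longrightarrow> chi \<gamma> (slope \<gamma> \<phi>) = \<phi>"
  unfolding chi_def slope_def[symmetric] by (rule the_equality) (auto intro: slope_inj)

lemma slope_image: "slope \<gamma> ` {0..pi} = {- bL..bR}"
proof (intro equalityI subsetI)
  fix x assume "x \<in> slope \<gamma> ` {0..pi}"
  thus "x \<in> {- bL..bR}" using slope_antimono[of 0] slope_antimono[of _ pi] by (auto simp: slope_0 slope_pi)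
next
  fix x assume "x \<in> {- bL..bR}"
  hence "\<exists>\<phi>\<ge>0. \<phi> \<le> pi \<and> slope \<gamma> \<phi> = x"
    by (intro IVT2') (auto simp: slope_0 slope_pi intro: continuous_intros)
  thus "x \<in> slope \<gamma> ` {0..pi}" by auto
qed

lemma chi_props:
  assumes "x \<in> {- bL..bR}"
  shows "0 \<le> chi \<gamma> x" "chi \<gamma> x \<le> pi" "slope \<gamma> (chi \<gamma> x) = x"
proof -
  obtain \<phi> where "\<phi> \<in> {0..pi}" "x = slope \<gamma> \<phi>" using assms slope_image by blast
  thus "0 \<le> chi \<gamma> x" "chi \<gamma> x \<le> pi" "slope \<gamma> (chi \<gamma> x) = x" using chi_slope by auto
qed

lemma chi_edges: "chi \<gamma> bR = 0" "chi \<gamma> (- bL) = pi"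
  using chi_slope[of 0] chi_slope[of pi] by (simp_all add: slope_0 slope_pi)

lemma continuous_on_chi: "continuous_on {- bL..bR} (chi \<gamma>)"
proof -
  have "continuous_on (slope \<gamma> ` {0..pi}) (chi \<gamma>)"
    by (rule continuous_on_inv) (auto intro: continuous_intros chi_slope)
  thus ?thesis by (simp add: slope_image)
qed

text \<open>The maximum of phase \<phi> - x \<phi> over \<phi> in [0, \<pi>]: its derivative, slope
  \<phi> - x, changes sign at \<open>chi \<gamma> x\<close>. It serves as an antiderivative of minus
  chi.\<close>

definition legendre :: "real \<Rightarrow> real" where
  "legendre x = phase \<gamma> (chi \<gamma> x) - x * chi \<gamma> x"

lemma legendre_ge:
  assumes x: "x \<in> {- bL..bR}" and \<phi>: "\<phi> \<in> {0..pi}"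
  shows "phase \<gamma> \<phi> - x * \<phi> \<le> legendre x"
proof -
  let ?c = "chi \<gamma> x"
  note c = chi_props[OF x]
  have d: "((\<lambda>u. phase \<gamma> u - x * u) has_real_derivative slope \<gamma> u - x) (at u)" for u
    by (auto intro!: derivative_eq_intros phase_has_derivative)
  show ?thesis
  proof (cases "\<phi> \<le> ?c")
    case True
    have "phase \<gamma> \<phi> - x * \<phi> \<le> phase \<gamma> ?c - x * ?c"
    proof (rule DERIV_nonneg_imp_nondecreasing[OF True])
      fix u assume "\<phi> \<le> u" "u \<le> ?c"
      hence "slope \<gamma> u - x \<ge> 0" using slope_antimono[of u ?c] c \<phi> by auto
      thus "\<exists>y. ((\<lambda>u. phase \<gamma> u - x * u) has_real_derivative y) (at u) \<and> y \<ge> 0" using d by blast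
    qed
    thus ?thesis by (simp add: legendre_def)
  next
    case False
    hence le: "?c \<le> \<phi>" by simp
    have "phase \<gamma> \<phi> - x * \<phi> \<le> phase \<gamma> ?c - x * ?c"
    proof (rule DERIV_nonpos_imp_nonincreasing[OF le])
      fix u assume "?c \<le> u" "u \<le> \<phi>"
      hence "slope \<gamma> u - x \<le> 0" using slope_antimono[of ?c u] c \<phi> by auto
      thus "\<exists>y. ((\<lambda>u. phase \<gamma> u - x * u) has_real_derivative y) (at u) \<and> y \<le> 0" using d by blast
    qed
    thus ?thesis by (simp add: legendre_def)
  qed
qed

text \<open>Envelope argument: maximality at x and at y bounds the error of the difference quotient
  by the variation of chi, so continuity of chi suffices. The slope has derivative 0 at 0 and at
  \<pi>, so chi itself is not differentiable at the edges.\<close>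

lemma legendre_derivative:
  assumes x: "x \<in> {- bL..bR}"
  shows "(legendre has_real_derivative - chi \<gamma> x) (at x within {- bL..bR})"
  unfolding has_field_derivative_iff
proof -
  have "((\<lambda>y. (legendre y - legendre x) / (y - x) - (- chi \<gamma> x)) \<longlongrightarrow> 0) (at x within {- bL..bR})"
  proof (rule Lim_null_comparison)
    have "(chi \<gamma> \<longlongrightarrow> chi \<gamma> x) (at x within {- bL..bR})"
      using continuous_on_chi x by (simp add: continuous_on_def)
    hence "((\<lambda>y. \<bar>chi \<gamma> y - chi \<gamma> x\<bar>) \<longlongrightarrow> \<bar>chi \<gamma> x - chi \<gamma> x\<bar>) (at x within {- bL..bR})"
      by (intro tendsto_intros)
    thus "((\<lambda>y. \<bar>chi \<gamma> y - chi \<gamma> x\<bar>) \<longlongrightarrow> 0) (at x within {- bL..bR})" by simp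
    show "\<forall>\<^sub>F y in at x within {- bL..bR}. norm ((legendre y - legendre x) / (y - x) - (- chi \<gamma> x)) \<le> \<bar>chi \<gamma> y - chi \<gamma> x\<bar>"
      unfolding eventually_at_filter
    proof (intro always_eventually allI impI)
      fix y assume ne: "y \<noteq> x" and y: "y \<in> {- bL..bR}"
      have 1: "legendre x - (y - x) * chi \<gamma> x \<le> legendre y"
        using legendre_ge[OF y, of "chi \<gamma> x"] chi_props[OF x] by (auto simp: legendre_def[of x] algebra_simps)
      have 2: "legendre y - (x - y) * chi \<gamma> y \<le> legendre x"
        using legendre_ge[OF x, of "chi \<gamma> y"] chi_props[OF y] by (auto simp: legendre_def[of y] algebra_simps)
      define q where "q = legendre y - legendre x + (y - x) * chi \<gamma> x"
      have q: "0 \<le> q" "q \<le> (y - x) * (chi \<gamma> x - chi \<gamma> y)" using 1 2 by (auto simp: q_def algebra_simps)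
      have "(legendre y - legendre x) / (y - x) - (- chi \<gamma> x) = q / (y - x)"
        using ne by (simp add: q_def field_simps)
      also have "norm \<dots> = q / \<bar>y - x\<bar>" using q by simp
      also have "\<dots> \<le> \<bar>chi \<gamma> y - chi \<gamma> x\<bar>"
      proof -
        have "q \<le> \<bar>(y - x) * (chi \<gamma> x - chi \<gamma> y)\<bar>" using q by linarith
        also have "\<dots> = \<bar>chi \<gamma> y - chi \<gamma> x\<bar> * \<bar>y - x\<bar>" by (simp add: abs_mult abs_minus_commute)
        finally show ?thesis using ne by (simp add: pos_divide_le_eq)
      qed
      finally show "norm ((legendre y - legendre x) / (y - x) - (- chi \<gamma> x)) \<le> \<bar>chi \<gamma> y - chi \<gamma> x\<bar>" .
    qed
  qed
  thus "((\<lambda>y. (legendre y - legendre x) / (y - x)) \<longlongrightarrow> - chi \<gamma> x) (at x within {- bL..bR})"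
    by (subst (asm) LIM_zero_iff)
qed

lemma Omega_eq_legendre:
  assumes x: "x \<in> {- bL..bR}"
  shows "Omega \<gamma> x = x + 2 / pi * legendre x"
proof -
  have "(chi \<gamma> has_integral (- legendre x) - (- legendre (- bL))) {- bL..x}"
  proof (rule fundamental_theorem_of_calculus)
    fix u assume u: "u \<in> {- bL..x}"
    hence "((\<lambda>x. - legendre x) has_real_derivative chi \<gamma> u) (at u within {- bL..bR})"
      using legendre_derivative[of u] x by (auto intro!: derivative_eq_intros)
    hence "((\<lambda>x. - legendre x) has_real_derivative chi \<gamma> u) (at u within {- bL..x})"
      by (rule has_field_derivative_subset) (use x in auto)
    thus "((\<lambda>x. - legendre x) has_vector_derivative chi \<gamma> u) (at u within {- bL..x})"
      by (simp add: has_real_derivative_iff_has_vector_derivative)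
  qed (use x in auto)
  hence "integral {- bL..x} (chi \<gamma>) = legendre (- bL) - legendre x" by (simp add: integral_unique)
  \<comment> \<open>Times 2 / \<pi> this is the term \<open>2 * left_edge \<gamma>\<close> in the
    definition of \<open>Omega\<close>, which thus cancels.\<close>
  moreover have "legendre (- bL) = bL * pi" by (simp add: legendre_def chi_edges)
  ultimately show ?thesis using x by (simp add: Omega_def field_simps)
qed

lemma circle_integral_even:
  fixes f :: "real \<Rightarrow> real"
  assumes "continuous_on UNIV f" "\<And>\<phi>. f (- \<phi>) = f \<phi>"
  shows "(\<integral>\<phi>. f \<phi> \<partial>circle_measure) = integral {0..pi} f / pi"
proof -
  have c: "continuous_on A f" for A using assms(1) by (rule continuous_on_subset) simp
  have "(\<integral>\<phi>. f \<phi> \<partial>circle_measure) = (\<integral>\<phi>. indicator {-pi..pi} \<phi> *\<^sub>R f \<phi> \<partial>lborel) /\<^sub>R (2 * pi)"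
    by (rule integral_circle_measure[OF assms(1)])
  also have "(\<integral>\<phi>. indicator {-pi..pi} \<phi> *\<^sub>R f \<phi> \<partial>lborel) = integral {-pi..pi} f"
    using set_borel_integral_eq_integral(2)[OF borel_integrable_atLeastAtMost'[OF c], of "-pi" pi]
    by (simp add: set_lebesgue_integral_def)
  also have "integral {-pi..pi} f = integral {-pi..0} f + integral {0..pi} f"
    by (rule Henstock_Kurzweil_Integration.integral_combine[symmetric]) (auto intro: integrable_continuous_real c)
  also have "integral {-pi..0} f = integral {0..pi} f"
    using Henstock_Kurzweil_Integration.integral_reflect_real[of pi 0 f] assms(2) by simp
  finally show ?thesis by (simp add: field_simps)
qed

text \<open>The slope has mean 0 over [0, \<pi>], because the phase vanishes at both ends, and it
  lies between its values at \<pi> and 0. The signs show that \<bar>x\<bar> is x beyond the right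
  edge and -x beyond the left one.\<close>

lemma edges_nonneg: "0 \<le> bR" "0 \<le> bL"
proof -
  have I: "(slope \<gamma> has_integral 0) {0..pi}" using integral_slope[of 0 pi \<gamma>] by simp
  have "0 \<le> bR * pi"
  proof (rule has_integral_le[OF I])
    show "((\<lambda>_. bR) has_integral bR * pi) {0..pi}" using has_integral_const_real[of bR 0 pi] by (simp add: mult.commute)
  qed (use slope_antimono[of 0] in \<open>auto simp: slope_0\<close>)
  thus "0 \<le> bR" using pi_gt_zero by (auto simp: zero_le_mult_iff)
  have "- bL * pi \<le> 0"
  proof (rule has_integral_le[OF _ I])
    show "((\<lambda>_. - bL) has_integral - bL * pi) {0..pi}" using has_integral_const_real[of "- bL" 0 pi] by (simp add: mult.commute)
  qed (use slope_antimono[of _ pi] in \<open>auto simp: slope_pi\<close>)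
  thus "0 \<le> bL" using pi_gt_zero by (auto simp: mult_le_0_iff zero_le_mult_iff)
qed

text \<open>The sign of slope \<phi> - x changes only at \<open>chi \<gamma> x\<close>, so both
  pieces of the integral are read off the phase and add up to \<pi> x + 2 legendre x. Beyond the
  edges the sign is constant and the phase terms vanish.\<close>

lemma Omega_eq: "Omega \<gamma> x = (\<integral>\<phi>. \<bar>slope \<gamma> \<phi> - x\<bar> \<partial>circle_measure)"
proof -
  have lin: "((\<lambda>\<phi>. slope \<gamma> \<phi> - x) has_integral (phase \<gamma> v - phase \<gamma> u) - (v - u) * x) {u..v}" if "u \<le> v" for u v
    using has_integral_diff[OF integral_slope[OF that] has_integral_const_real[of x u v]] that by simp
  have "(\<integral>\<phi>. \<bar>slope \<gamma> \<phi> - x\<bar> \<partial>circle_measure) = integral {0..pi} (\<lambda>\<phi>. \<bar>slope \<gamma> \<phi> - x\<bar>) / pi"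
    by (rule circle_integral_even) (auto intro!: continuous_intros simp: slope_even)
  also have "integral {0..pi} (\<lambda>\<phi>. \<bar>slope \<gamma> \<phi> - x\<bar>) = pi * Omega \<gamma> x"
  proof (cases "x \<in> {- bL..bR}")
    case True
    let ?c = "chi \<gamma> x"
    note c = chi_props[OF True]
    have 1: "((\<lambda>\<phi>. \<bar>slope \<gamma> \<phi> - x\<bar>) has_integral (phase \<gamma> ?c - phase \<gamma> 0) - (?c - 0) * x) {0..?c}"
      by (rule has_integral_eq[OF _ lin]) (use c slope_antimono[of _ ?c] in auto)
    have 2: "((\<lambda>\<phi>. \<bar>slope \<gamma> \<phi> - x\<bar>) has_integral - ((phase \<gamma> pi - phase \<gamma> ?c) - (pi - ?c) * x)) {?c..pi}"
      by (rule has_integral_eq[OF _ has_integral_neg[OF lin]]) (use c slope_antimono[of ?c] in auto)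
    have "((\<lambda>\<phi>. \<bar>slope \<gamma> \<phi> - x\<bar>) has_integral pi * x + 2 * legendre x) {0..pi}"
      using has_integral_combine[OF c(1,2) 1 2] by (simp add: legendre_def algebra_simps)
    thus ?thesis by (simp add: integral_unique Omega_eq_legendre[OF True] field_simps)
  next
    case False
    show ?thesis
    proof (cases "x > bR")
      case True
      have "((\<lambda>\<phi>. \<bar>slope \<gamma> \<phi> - x\<bar>) has_integral - ((phase \<gamma> pi - phase \<gamma> 0) - (pi - 0) * x)) {0..pi}"
        by (rule has_integral_eq[OF _ has_integral_neg[OF lin]]) (use True slope_antimono[of 0] in \<open>fastforce simp: slope_0\<close>)+
      thus ?thesis using True False edges_nonneg by (auto simp: integral_unique Omega_def)
    next
      case F2: False
      have "((\<lambda>\<phi>. \<bar>slope \<gamma> \<phi> - x\<bar>) has_integral ((phase \<gamma> pi - phase \<gamma> 0) - (pi - 0) * x)) {0..pi}"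
        by (rule has_integral_eq[OF _ lin]) (use F2 False slope_antimono[of _ pi] in \<open>fastforce simp: slope_pi\<close>)+
      thus ?thesis using F2 False edges_nonneg by (auto simp: integral_unique Omega_def)
    qed
  qed
  finally show ?thesis by simp
qed

section \<open>The exponent at the right edge\<close>

lemma Omega_has_derivative:
  assumes x: "x \<in> {- bL<..<bR}"
  shows "(Omega \<gamma> has_real_derivative 1 - 2 / pi * chi \<gamma> x) (at x)"
proof -
  have "((\<lambda>x. x + 2 / pi * legendre x) has_real_derivative 1 - 2 / pi * chi \<gamma> x) (at x within {- bL<..<bR})"
    by (rule derivative_eq_intros has_field_derivative_subset[OF legendre_derivative] refl)+ (use x in auto)
  hence "((\<lambda>x. x + 2 / pi * legendre x) has_real_derivative 1 - 2 / pi * chi \<gamma> x) (at x)"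
    using x by (simp add: at_within_open[of x "{- bL<..<bR}"])
  thus ?thesis
    by (rule has_field_derivative_transform_within_open[of _ _ _ "{- bL<..<bR}"])
       (use x Omega_eq_legendre in auto)
qed

lemma eventually_inside: "\<forall>\<^sub>F x in at_left bR. x \<in> {- bL<..<bR}"
  using eventually_at_left_real[OF edges_less] by eventually_elim auto

lemma chi_filterlim: "filterlim (chi \<gamma>) (at_right 0) (at_left bR)"
proof (rule tendsto_imp_filterlim_at_right)
  have "(chi \<gamma> \<longlongrightarrow> chi \<gamma> bR) (at bR within {- bL..bR})"
    using continuous_on_chi edges_less by (simp add: continuous_on_def)
  thus "(chi \<gamma> \<longlongrightarrow> 0) (at_left bR)"
    using edges_less by (simp add: chi_edges at_within_Icc_at_left)
  show "\<forall>\<^sub>F x in at_left bR. 0 < chi \<gamma> x"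
    using eventually_inside
  proof eventually_elim
    case (elim x)
    hence "chi \<gamma> x \<noteq> 0" using chi_props(3)[of x] slope_0 by auto
    thus ?case using chi_props(1)[of x] elim by simp
  qed
qed

lemma Omega_edge_asymp:
  "(\<lambda>x. 1 - deriv (Omega \<gamma>) x) \<sim>[at_left bR]
     (\<lambda>x. 2 / pi * ((bR - x) / fluct_coeff m \<gamma>) powr (1 / (2 * real m)))"
proof (rule asymp_equivI')
  \<comment> \<open>As the slope inverts chi, u x is the quotient of \<open>slope_asymp\<close> at
    chi x divided by its limit, so it tends to 1. The ratio of the two sides of the claim is u x to
    the power -1 / (2 m).\<close>
  define u where "u x = (bR - x) / fluct_coeff m \<gamma> / chi \<gamma> x ^ (2 * m)" for x
  have chi_pos: "\<forall>\<^sub>F x in at_left bR. 0 < chi \<gamma> x"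
    using chi_filterlim by (simp add: filterlim_at eventually_conj_iff)
  have "((\<lambda>x. (bR - slope \<gamma> (chi \<gamma> x)) / chi \<gamma> x ^ (2 * m) / fluct_coeff m \<gamma>) \<longlongrightarrow> fluct_coeff m \<gamma> / fluct_coeff m \<gamma>) (at_left bR)"
    using filterlim_compose[OF slope_asymp chi_filterlim] fluct_coeff_nonzero by (intro tendsto_intros)
  hence "((\<lambda>x. (bR - slope \<gamma> (chi \<gamma> x)) / chi \<gamma> x ^ (2 * m) / fluct_coeff m \<gamma>) \<longlongrightarrow> 1) (at_left bR)"
    using fluct_coeff_nonzero by simp
  hence u: "(u \<longlongrightarrow> 1) (at_left bR)"
  proof (rule Lim_transform_eventually)
    show "\<forall>\<^sub>F x in at_left bR. (bR - slope \<gamma> (chi \<gamma> x)) / chi \<gamma> x ^ (2 * m) / fluct_coeff m \<gamma> = u x"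
      using eventually_inside
    proof eventually_elim
      case (elim x)
      hence "slope \<gamma> (chi \<gamma> x) = x" by (intro chi_props) auto
      thus ?case by (simp add: u_def)
    qed
  qed
  have "((\<lambda>x. u x powr (- (1 / (2 * real m)))) \<longlongrightarrow> 1 powr (- (1 / (2 * real m)))) (at_left bR)"
    by (intro tendsto_powr u tendsto_const) auto
  hence "((\<lambda>x. u x powr (- (1 / (2 * real m)))) \<longlongrightarrow> 1) (at_left bR)" by simp
  thus "((\<lambda>x. (1 - deriv (Omega \<gamma>) x) / (2 / pi * ((bR - x) / fluct_coeff m \<gamma>) powr (1 / (2 * real m)))) \<longlongrightarrow> 1) (at_left bR)"
  proof (rule Lim_transform_eventually)
    show "\<forall>\<^sub>F x in at_left bR. u x powr (- (1 / (2 * real m))) = (1 - deriv (Omega \<gamma>) x) / (2 / pi * ((bR - x) / fluct_coeff m \<gamma>) powr (1 / (2 * real m)))"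
      using eventually_inside chi_pos
    proof eventually_elim
      case (elim x)
      let ?a = "1 / (2 * real m)"
      have d: "1 - deriv (Omega \<gamma>) x = 2 / pi * chi \<gamma> x"
        using DERIV_imp_deriv[OF Omega_has_derivative[OF elim(1)]] by simp
      have upos: "u x > 0" unfolding u_def using elim fluct_coeff_pos by simp
      have "(bR - x) / fluct_coeff m \<gamma> = u x * chi \<gamma> x ^ (2 * m)" using elim by (simp add: u_def)
      hence "((bR - x) / fluct_coeff m \<gamma>) powr ?a = u x powr ?a * (chi \<gamma> x ^ (2 * m)) powr ?a"
        using upos elim by (simp add: powr_mult)
      also have "(chi \<gamma> x ^ (2 * m)) powr ?a = chi \<gamma> x"
        using elim m by (simp add: powr_realpow[symmetric] powr_powr)
      finally have e: "((bR - x) / fluct_coeff m \<gamma>) powr ?a = u x powr ?a * chi \<gamma> x" .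
      show ?case unfolding d e using elim upos by (simp add: powr_minus field_simps)
    qed
  qed
qed

end

section \<open>Convergence of the profile\<close>

text \<open>The offset 1/2 between Maya diagram and sites does not affect comparison with an integer
  level: for an integer s, s - 1/2 > n means s > n.\<close>

lemma maya_particles:
  "{k \<in> maya \<mu>. k > of_int n} = (\<lambda>s. real_of_int s - 1 / 2) ` particles \<mu> n"
proof -
  have eq: "real (part \<mu> (Suc i)) - real (Suc i) + 1 / 2 = of_int (site \<mu> i) - 1 / 2" for i
    by (simp add: site_def)
  have gt: "of_int s - 1 / 2 > (of_int n :: real) \<longleftrightarrow> s > n" for s
  proof
    assume "of_int s - 1 / 2 > (of_int n :: real)"
    hence "(of_int n :: real) < of_int s" by linarith
    thus "s > n" by simp
  next
    assume "s > n"
    hence "real_of_int (n + 1) \<le> of_int s" by (simp only: of_int_le_iff)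
    thus "of_int s - 1 / 2 > (of_int n :: real)" by simp
  qed
  have "maya \<mu> = (\<lambda>s. real_of_int s - 1 / 2) ` range (site \<mu>)"
  proof (intro equalityI subsetI)
    fix k assume "k \<in> maya \<mu>"
    then obtain i where i: "1 \<le> i" "k = real (part \<mu> i) - real i + 1 / 2" by (auto simp: maya_def)
    hence "k = of_int (site \<mu> (i - 1)) - 1 / 2" using eq[of "i - 1"] by simp
    thus "k \<in> (\<lambda>s. real_of_int s - 1 / 2) ` range (site \<mu>)" by blast
  next
    fix k assume "k \<in> (\<lambda>s. real_of_int s - 1 / 2) ` range (site \<mu>)"
    then obtain i where "k = real (part \<mu> (Suc i)) - real (Suc i) + 1 / 2" unfolding eq by auto
    thus "k \<in> maya \<mu>" unfolding maya_def by (intro CollectI exI[of _ "Suc i"]) simp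
  qed
  thus ?thesis using gt by (auto simp: particles_def)
qed

lemma profile_node_eq: "profile_node \<mu> \<theta> n = of_int n / \<theta> + 2 / \<theta> * particle_count n \<mu>"
proof -
  have "card {k \<in> maya \<mu>. k > of_int n} = card (particles \<mu> n)"
    unfolding maya_particles by (rule card_image) (auto simp: inj_on_def)
  thus ?thesis by (simp add: profile_node_def particle_count_def)
qed

lemma particle_count_step:
  assumes "\<mu> \<in> partitions"
  shows "particle_count (n + 1) \<mu> \<le> particle_count n \<mu>" "particle_count n \<mu> \<le> particle_count (n + 1) \<mu> + 1"
proof -
  have fin: "finite (particles \<mu> n)" for n using particles_holes(1)[OF assms] .
  have "particles \<mu> (n + 1) \<subseteq> particles \<mu> n" by (auto simp: particles_def)
  thus "particle_count (n + 1) \<mu> \<le> particle_count n \<mu>"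
    unfolding particle_count_def using fin by (simp add: card_mono)
  have "particles \<mu> n \<subseteq> insert (n + 1) (particles \<mu> (n + 1))" by (auto simp: particles_def)
  hence "card (particles \<mu> n) \<le> card (insert (n + 1) (particles \<mu> (n + 1)))" using fin by (intro card_mono) auto
  also have "\<dots> \<le> card (particles \<mu> (n + 1)) + 1" using fin by (simp add: card_insert_if)
  finally show "particle_count n \<mu> \<le> particle_count (n + 1) \<mu> + 1" unfolding particle_count_def by linarith
qed

text \<open>As the level rises, the number of particles above it decreases, and the number of holes
  up to it, which is the particle count plus the level, increases.\<close>

lemma particle_count_antimono:
  assumes "\<mu> \<in> partitions" "n \<le> k"
  shows "particle_count k \<mu> \<le> particle_count n \<mu>" "particle_count n \<mu> + of_int n \<le> particle_count k \<mu> + of_int k"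
  using assms(2)
proof (induction k rule: int_ge_induct)
  case (step k)
  { case 1 show ?case using step(2) particle_count_step(1)[OF assms(1), of k] by linarith }
  { case 2 show ?case using step(3) particle_count_step(2)[OF assms(1), of k] by simp }
qed simp_all

lemma particle_count_bounds:
  assumes "\<mu> \<in> partitions"
  shows "0 \<le> particle_count n \<mu>" "0 \<le> particle_count n \<mu> + of_int n"
proof -
  show "0 \<le> particle_count n \<mu>" by (simp add: particle_count_def)
  have "0 \<le> int (card (particles \<mu> n)) + n" using particles_holes(3)[OF assms, of n] by simp
  thus "0 \<le> particle_count n \<mu> + of_int n" unfolding particle_count_def by linarith
qed

text \<open>A node is the number of particles plus the number of holes, divided by \<theta>. The
  former decreases and the latter increases, and their difference changes by exactly 1 per
  step.\<close>

lemma profile_node_lipschitz: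
  assumes mu: "\<mu> \<in> partitions" and pos: "\<theta> > 0"
  shows "\<bar>profile_node \<mu> \<theta> n - profile_node \<mu> \<theta> k\<bar> \<le> \<bar>of_int n - of_int k\<bar> / \<theta>"
proof -
  have *: "\<bar>profile_node \<mu> \<theta> n - profile_node \<mu> \<theta> k\<bar> \<le> \<bar>of_int n - of_int k\<bar> / \<theta>" if "n \<le> k" for n k
  proof -
    let ?c = "\<lambda>n. particle_count n \<mu>"
    have "profile_node \<mu> \<theta> n - profile_node \<mu> \<theta> k = (of_int n - of_int k + 2 * (?c n - ?c k)) / \<theta>"
      unfolding profile_node_eq by (simp add: add_divide_distrib diff_divide_distrib)
    hence "\<bar>profile_node \<mu> \<theta> n - profile_node \<mu> \<theta> k\<bar> = \<bar>of_int n - of_int k + 2 * (?c n - ?c k)\<bar> / \<theta>"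
      using pos by (simp add: abs_divide)
    also have "\<dots> \<le> \<bar>of_int n - of_int k\<bar> / \<theta>"
    proof (rule divide_right_mono)
      have nk: "\<bar>of_int n - of_int k\<bar> = (of_int k - of_int n :: real)" using that by simp
      show "\<bar>of_int n - of_int k + 2 * (?c n - ?c k)\<bar> \<le> \<bar>of_int n - of_int k\<bar>"
        unfolding nk by (rule abs_leI) (use particle_count_antimono[OF mu that] in \<open>simp_all add: algebra_simps\<close>)
    qed (use pos in simp)
    finally show ?thesis .
  qed
  show ?thesis using *[of n k] *[of k n] by (cases "n \<le> k") (auto simp: abs_minus_commute)
qed

lemma profile_near_node:
  assumes mu: "\<mu> \<in> partitions" and pos: "\<theta> > 0"
  shows "\<bar>profile \<mu> \<theta> x - profile_node \<mu> \<theta> \<lfloor>\<theta> * x\<rfloor>\<bar> \<le> 1 / \<theta>"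
proof -
  let ?n = "\<lfloor>\<theta> * x\<rfloor>"
  have "profile \<mu> \<theta> x - profile_node \<mu> \<theta> ?n = frac (\<theta> * x) * (profile_node \<mu> \<theta> (?n + 1) - profile_node \<mu> \<theta> ?n)"
    by (simp add: profile_def algebra_simps)
  hence "\<bar>profile \<mu> \<theta> x - profile_node \<mu> \<theta> ?n\<bar> = frac (\<theta> * x) * \<bar>profile_node \<mu> \<theta> (?n + 1) - profile_node \<mu> \<theta> ?n\<bar>"
    by (simp add: abs_mult)
  also have "\<dots> \<le> 1 * (1 / \<theta>)"
    by (rule mult_mono) (use profile_node_lipschitz[OF mu pos, of "?n + 1" ?n] frac_lt_1[of "\<theta> * x"] in auto)
  finally show ?thesis by simp
qed

lemma floor_scaled:
  assumes "\<theta> > 0"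
  shows "of_int \<lfloor>\<theta> * x\<rfloor> / \<theta> \<le> x" "x < of_int \<lfloor>\<theta> * x\<rfloor> / \<theta> + 1 / \<theta>"
proof -
  have "of_int \<lfloor>\<theta> * x\<rfloor> \<le> \<theta> * x" "\<theta> * x < of_int \<lfloor>\<theta> * x\<rfloor> + 1" by linarith+
  thus "of_int \<lfloor>\<theta> * x\<rfloor> / \<theta> \<le> x" "x < of_int \<lfloor>\<theta> * x\<rfloor> / \<theta> + 1 / \<theta>"
    using assms by (simp_all add: field_simps)
qed

text \<open>To the right of b, profile minus x is 2 / \<theta> times an interpolated particle count,
  nonnegative and at most the count at the node of b. One node thus controls a half-line; 1 /
  \<theta> accounts for rounding b.\<close>

lemma profile_above:
  assumes mu: "\<mu> \<in> partitions" and pos: "\<theta> > 0" and x: "b \<le> x"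
  shows "\<bar>profile \<mu> \<theta> x - x\<bar> \<le> \<bar>profile_node \<mu> \<theta> \<lfloor>\<theta> * b\<rfloor> - b\<bar> + 1 / \<theta>"
proof -
  let ?n = "\<lfloor>\<theta> * x\<rfloor>" and ?f = "frac (\<theta> * x)" and ?c = "\<lambda>n. particle_count n \<mu>" and ?k = "\<lfloor>\<theta> * b\<rfloor>"
  have "of_int ?n + ?f = \<theta> * x" by (simp add: frac_def)
  hence x_eq: "x = of_int ?n / \<theta> + ?f / \<theta>" using pos by (simp add: field_simps)
  have "profile \<mu> \<theta> x = (1 - ?f) * (of_int ?n / \<theta> + 2 / \<theta> * ?c ?n) + ?f * (of_int (?n + 1) / \<theta> + 2 / \<theta> * ?c (?n + 1))"
    by (simp only: profile_def profile_node_eq)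
  also have "\<dots> = (of_int ?n / \<theta> + ?f / \<theta>) + 2 / \<theta> * ((1 - ?f) * ?c ?n + ?f * ?c (?n + 1))"
    using pos by (simp add: field_simps)
  finally have p: "profile \<mu> \<theta> x - x = 2 / \<theta> * ((1 - ?f) * ?c ?n + ?f * ?c (?n + 1))" using x_eq by linarith
  have f: "0 \<le> ?f" "?f \<le> 1" using frac_lt_1[of "\<theta> * x"] by auto
  have kn: "?k \<le> ?n" using x pos by (intro floor_mono mult_left_mono) auto
  have c: "0 \<le> ?c ?n" "0 \<le> ?c (?n + 1)" "?c (?n + 1) \<le> ?c ?n" "?c ?n \<le> ?c ?k"
    using particle_count_bounds(1)[OF mu] particle_count_antimono(1)[OF mu] kn by auto
  have "(1 - ?f) * ?c ?n + ?f * ?c (?n + 1) \<le> (1 - ?f) * ?c ?n + ?f * ?c ?n"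
    using f c by (intro add_left_mono mult_left_mono)
  also have "\<dots> = ?c ?n" by (simp add: algebra_simps)
  finally have "2 / \<theta> * ((1 - ?f) * ?c ?n + ?f * ?c (?n + 1)) \<le> 2 / \<theta> * ?c ?k"
    using c pos by (intro mult_left_mono) auto
  moreover have "0 \<le> 2 / \<theta> * ((1 - ?f) * ?c ?n + ?f * ?c (?n + 1))"
    using f c pos by (intro mult_nonneg_nonneg add_nonneg_nonneg) auto
  moreover have "2 / \<theta> * ?c ?k = profile_node \<mu> \<theta> ?k - of_int ?k / \<theta>" by (simp add: profile_node_eq)
  ultimately show ?thesis using floor_scaled[OF pos, of b] unfolding p by linarith
qed

text \<open>Mirror image, with holes in place of particles. Interpolation at x may involve the node
  after that of a, where there can be one hole more; this adds 2 / \<theta>.\<close>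

lemma profile_below:
  assumes mu: "\<mu> \<in> partitions" and pos: "\<theta> > 0" and x: "x \<le> a"
  shows "\<bar>profile \<mu> \<theta> x + x\<bar> \<le> \<bar>profile_node \<mu> \<theta> \<lfloor>\<theta> * a\<rfloor> + a\<bar> + 2 / \<theta>"
proof -
  let ?n = "\<lfloor>\<theta> * x\<rfloor>" and ?f = "frac (\<theta> * x)" and ?k = "\<lfloor>\<theta> * a\<rfloor>"
  let ?c = "\<lambda>n. particle_count n \<mu> + of_int n"
  have "of_int ?n + ?f = \<theta> * x" by (simp add: frac_def)
  hence x_eq: "x = of_int ?n / \<theta> + ?f / \<theta>" using pos by (simp add: field_simps)
  have "profile \<mu> \<theta> x = (1 - ?f) * (of_int ?n / \<theta> + 2 / \<theta> * particle_count ?n \<mu>) + ?f * (of_int (?n + 1) / \<theta> + 2 / \<theta> * particle_count (?n + 1) \<mu>)"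
    by (simp only: profile_def profile_node_eq)
  also have "\<dots> = - (of_int ?n / \<theta> + ?f / \<theta>) + 2 / \<theta> * ((1 - ?f) * ?c ?n + ?f * ?c (?n + 1))"
    using pos by (simp add: field_simps)
  finally have p: "profile \<mu> \<theta> x + x = 2 / \<theta> * ((1 - ?f) * ?c ?n + ?f * ?c (?n + 1))" using x_eq by linarith
  have f: "0 \<le> ?f" "?f \<le> 1" using frac_lt_1[of "\<theta> * x"] by auto
  have kn: "?n \<le> ?k" using x pos by (intro floor_mono mult_left_mono) auto
  have c: "0 \<le> ?c ?n" "0 \<le> ?c (?n + 1)" "?c ?n \<le> ?c (?n + 1)" "?c (?n + 1) \<le> ?c (?k + 1)"
    using particle_count_bounds(2)[OF mu, of ?n] particle_count_bounds(2)[OF mu, of "?n + 1"] particle_count_antimono(2)[OF mu, of ?n "?n + 1"]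
      particle_count_antimono(2)[OF mu, of "?n + 1" "?k + 1"] kn by auto
  have c': "?c (?k + 1) \<le> ?c ?k + 1" using particle_count_step(1)[OF mu, of ?k] by simp
  have "(1 - ?f) * ?c ?n + ?f * ?c (?n + 1) \<le> (1 - ?f) * ?c (?n + 1) + ?f * ?c (?n + 1)"
    using f c by (intro add_right_mono mult_left_mono) auto
  also have "\<dots> = ?c (?n + 1)" by (simp add: algebra_simps)
  also have "\<dots> \<le> ?c ?k + 1" using c c' by linarith
  finally have "2 / \<theta> * ((1 - ?f) * ?c ?n + ?f * ?c (?n + 1)) \<le> 2 / \<theta> * (?c ?k + 1)"
    using pos by (intro mult_left_mono) auto
  moreover have "0 \<le> 2 / \<theta> * ((1 - ?f) * ?c ?n + ?f * ?c (?n + 1))"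
  proof -
    have "0 \<le> (1 - ?f) * ?c ?n" "0 \<le> ?f * ?c (?n + 1)" using f c by (simp_all only: mult_nonneg_nonneg diff_ge_0_iff_ge)
    thus ?thesis using pos by (intro mult_nonneg_nonneg) auto
  qed
  moreover have "2 / \<theta> * (?c ?k + 1) = profile_node \<mu> \<theta> ?k + of_int ?k / \<theta> + 2 / \<theta>"
    using pos by (simp add: profile_node_eq field_simps)
  ultimately show ?thesis using floor_scaled[OF pos, of a] unfolding p by linarith
qed

section \<open>Concentration at a single node\<close>

lemma mean_excess_eq:
  assumes fin: "finite (seq_support \<gamma>)" and pos: "\<theta> > 0"
  shows "of_int n / \<theta> + 2 / \<theta> * mean_excess \<gamma> \<theta> n =
    measure_pmf.expectation (law (\<lambda>r. \<theta> * \<gamma> r)) (\<lambda>j. \<bar>of_int j / \<theta> - of_int n / \<theta>\<bar>)"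
proof -
  let ?E = "measure_pmf.expectation (law (\<lambda>r. \<theta> * \<gamma> r))"
  have fin': "finite (seq_support (\<lambda>r. \<theta> * \<gamma> r))" using fin pos by (simp add: seq_support_scale)
  have eq: "\<bar>of_int j / \<theta> - of_int n / \<theta>\<bar> = 2 / \<theta> * real (nat (j - n)) - (1 / \<theta> * of_int j - of_int n / \<theta>)" for j
  proof -
    have "\<bar>of_int j / \<theta> - of_int n / \<theta>\<bar> = \<bar>real_of_int (j - n)\<bar> / \<theta>" using pos by (simp add: diff_divide_distrib[symmetric] abs_divide)
    also have "\<bar>real_of_int (j - n)\<bar> = 2 * real (nat (j - n)) - (of_int j - of_int n)" by (cases "j \<ge> n") auto
    finally show ?thesis by (simp add: add_divide_distrib diff_divide_distrib)
  qed
  have "?E (\<lambda>j. \<bar>of_int j / \<theta> - of_int n / \<theta>\<bar>) = 2 / \<theta> * ?E (\<lambda>j. real (nat (j - n))) - (1 / \<theta> * ?E real_of_int - of_int n / \<theta>)"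
    unfolding eq using integrable_nat_diff(1)[OF fin pos, of n] law_first_moment(1)[OF fin'] by simp
  thus ?thesis by (simp add: mean_excess_def[OF fin pos] law_first_moment(2)[OF fin'])
qed

lemma mean_node_tendsto:
  assumes m: "1 \<le> m" and mc: "multicritical m \<gamma>"
  shows "((\<lambda>\<theta>. of_int \<lfloor>\<theta> * g\<rfloor> / \<theta> + 2 / \<theta> * mean_excess \<gamma> \<theta> \<lfloor>\<theta> * g\<rfloor>) \<longlongrightarrow> Omega \<gamma> g) at_top"
proof -
  have fin: "finite (seq_support \<gamma>)" by (rule fin_supp[OF m mc])
  let ?E = "\<lambda>\<theta>. measure_pmf.expectation (law (\<lambda>r. \<theta> * \<gamma> r))"
  let ?e = "\<lambda>\<theta>. ?E \<theta> (\<lambda>j. \<bar>of_int j / \<theta> - g\<bar>)"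
  let ?f = "\<lambda>\<theta>. of_int \<lfloor>\<theta> * g\<rfloor> / \<theta> + 2 / \<theta> * mean_excess \<gamma> \<theta> \<lfloor>\<theta> * g\<rfloor>"
  have lim: "(?e \<longlongrightarrow> Omega \<gamma> g) at_top"
    unfolding Omega_eq[OF m mc] by (rule abs_deviation_tendsto[OF fin])
  \<comment> \<open>Rounding g down to a multiple of 1 / \<theta> changes the absolute deviation by
    at most 1 / \<theta>.\<close>
  have "((\<lambda>\<theta>. ?f \<theta> - ?e \<theta>) \<longlongrightarrow> 0) at_top"
  proof (rule Lim_null_comparison)
    show "((\<lambda>\<theta>::real. 1 / \<theta>) \<longlongrightarrow> 0) at_top"
      by (intro tendsto_divide_0[OF tendsto_const] filterlim_at_top_imp_at_infinity filterlim_ident)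
    show "\<forall>\<^sub>F \<theta> in at_top. norm (?f \<theta> - ?e \<theta>) \<le> 1 / \<theta>"
      using eventually_gt_at_top[of 0]
    proof eventually_elim
      case (elim \<theta>)
      have fin': "finite (seq_support (\<lambda>r. \<theta> * \<gamma> r))" using fin elim by (simp add: seq_support_scale)
      have int: "integrable (measure_pmf (law (\<lambda>r. \<theta> * \<gamma> r))) (\<lambda>j. \<bar>of_int j / \<theta> - c\<bar>)" for c
        by (intro integrable_abs Bochner_Integration.integrable_diff integrable_divide_zero law_first_moment(1) fin') auto
      let ?c = "of_int \<lfloor>\<theta> * g\<rfloor> / \<theta>"
      have eq: "?f \<theta> - ?e \<theta> = ?E \<theta> (\<lambda>j. \<bar>of_int j / \<theta> - ?c\<bar> - \<bar>of_int j / \<theta> - g\<bar>)"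
        unfolding mean_excess_eq[OF fin elim] by (rule Bochner_Integration.integral_diff[symmetric, OF int int])
      have "norm (?f \<theta> - ?e \<theta>) \<le> ?E \<theta> (\<lambda>j. norm (\<bar>of_int j / \<theta> - ?c\<bar> - \<bar>of_int j / \<theta> - g\<bar>))"
        unfolding eq by (rule integral_norm_bound)
      also have "\<dots> \<le> ?E \<theta> (\<lambda>j. 1 / \<theta>)"
      proof (rule integral_mono)
        show "integrable (measure_pmf (law (\<lambda>r. \<theta> * \<gamma> r))) (\<lambda>j. norm (\<bar>of_int j / \<theta> - ?c\<bar> - \<bar>of_int j / \<theta> - g\<bar>))"
          by (rule Bochner_Integration.integrable_norm, rule Bochner_Integration.integrable_diff) (rule int)+
        fix j :: int
        show "norm (\<bar>of_int j / \<theta> - ?c\<bar> - \<bar>of_int j / \<theta> - g\<bar>) \<le> 1 / \<theta>"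
          using floor_scaled[OF elim, of g] unfolding real_norm_def by linarith
      qed simp
      finally show ?case by simp
    qed
  qed
  from tendsto_add[OF this lim] show ?thesis by simp
qed

lemma node_deviation_tendsto:
  assumes m: "1 \<le> m" and mc: "multicritical m \<gamma>" and \<delta>: "\<delta> > 0"
  shows "((\<lambda>\<theta>. measure (schur_measure \<gamma> \<theta>) {\<mu> \<in> partitions. \<delta> < \<bar>profile_node \<mu> \<theta> \<lfloor>\<theta> * g\<rfloor> - Omega \<gamma> g\<bar>}) \<longlongrightarrow> 0) at_top"
proof (rule tendsto_sandwich[OF _ _ tendsto_const])
  have fin: "finite (seq_support \<gamma>)" by (rule fin_supp[OF m mc])
  let ?f = "\<lambda>\<theta>. of_int \<lfloor>\<theta> * g\<rfloor> / \<theta> + 2 / \<theta> * mean_excess \<gamma> \<theta> \<lfloor>\<theta> * g\<rfloor>"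
  \<comment> \<open>A bound for 2 M / \<theta>, M being the mean count: this is the expected node
    minus the rounded g, where the former is within \<delta> / 2 of \<Omega>(g) and the latter
    within 1 of g for \<theta> \<ge> 1.\<close>
  define K where "K = \<bar>Omega \<gamma> g\<bar> + \<delta> + \<bar>g\<bar> + 1"
  have "K \<ge> 0" using \<delta> by (simp add: K_def)
  show "((\<lambda>\<theta>. (8 * K / \<delta>\<^sup>2) / \<theta>) \<longlongrightarrow> 0) at_top"
    by (intro tendsto_divide_0[OF tendsto_const] filterlim_at_top_imp_at_infinity filterlim_ident)
  have near: "\<forall>\<^sub>F \<theta> in at_top. dist (?f \<theta>) (Omega \<gamma> g) < \<delta> / 2"
    by (rule tendstoD[OF mean_node_tendsto[OF m mc]]) (use \<delta> in simp)
  show "\<forall>\<^sub>F \<theta> in at_top. measure (schur_measure \<gamma> \<theta>) {\<mu> \<in> partitions. \<delta> < \<bar>profile_node \<mu> \<theta> \<lfloor>\<theta> * g\<rfloor> - Omega \<gamma> g\<bar>} \<le> (8 * K / \<delta>\<^sup>2) / \<theta>"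
    using near eventually_ge_at_top[of 1]
  proof eventually_elim
    case (elim \<theta>)
    hence pos: "\<theta> > 0" by simp
    interpret S: prob_space "schur_measure \<gamma> \<theta>" by (rule prob_space_schur_measure[OF fin pos])
    let ?n = "\<lfloor>\<theta> * g\<rfloor>" and ?M = "mean_excess \<gamma> \<theta> \<lfloor>\<theta> * g\<rfloor>"
    \<comment> \<open>Half of \<delta> is used up by the expected node. The other half, divided by
      the factor 2 / \<theta> between counts and nodes, is \<theta> \<delta> / 4. Chebyshev then
      gives 16 M / (\<theta> \<delta>)^2, of order 1 / \<theta>.\<close>
    let ?a = "\<theta> * \<delta> / 4"
    have f: "\<bar>?f \<theta> - Omega \<gamma> g\<bar> < \<delta> / 2" using elim by (simp add: dist_real_def)
    have sub: "{\<mu> \<in> partitions. \<delta> < \<bar>profile_node \<mu> \<theta> ?n - Omega \<gamma> g\<bar>} \<subseteq> {\<mu> \<in> partitions. ?a \<le> \<bar>particle_count ?n \<mu> - ?M\<bar>}"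
    proof safe
      fix \<mu> assume d: "\<delta> < \<bar>profile_node \<mu> \<theta> ?n - Omega \<gamma> g\<bar>"
      have "profile_node \<mu> \<theta> ?n - ?f \<theta> = 2 / \<theta> * (particle_count ?n \<mu> - ?M)"
        by (simp add: profile_node_eq algebra_simps)
      hence e: "\<bar>profile_node \<mu> \<theta> ?n - ?f \<theta>\<bar> = 2 / \<theta> * \<bar>particle_count ?n \<mu> - ?M\<bar>"
        using pos by (simp only: abs_mult) simp
      have "\<delta> / 2 \<le> \<bar>profile_node \<mu> \<theta> ?n - ?f \<theta>\<bar>" using f d by linarith
      thus "?a \<le> \<bar>particle_count ?n \<mu> - ?M\<bar>" unfolding e using pos by (simp add: field_simps)
    qed
    have "S.prob {\<mu> \<in> partitions. \<delta> < \<bar>profile_node \<mu> \<theta> ?n - Omega \<gamma> g\<bar>} \<le> S.prob {\<mu> \<in> partitions. ?a \<le> \<bar>particle_count ?n \<mu> - ?M\<bar>}"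
      by (rule S.finite_measure_mono[OF sub]) (auto simp: sets_schur_measure[OF fin pos])
    also have "\<dots> \<le> ?M / ?a\<^sup>2"
      by (rule count_concentration[OF fin pos]) (use pos \<delta> in simp)
    also have "\<dots> \<le> (\<theta> * K / 2) / ?a\<^sup>2"
    proof (rule divide_right_mono)
      have "1 / \<theta> \<le> 1" using elim by simp
      hence "?f \<theta> - of_int ?n / \<theta> \<le> K"
        using f floor_scaled[OF pos, of g] \<delta> unfolding K_def by linarith
      hence "2 / \<theta> * ?M \<le> K" by simp
      thus "?M \<le> \<theta> * K / 2" using pos by (simp add: field_simps)
    qed simp
    also have "\<dots> = (8 * K / \<delta>\<^sup>2) / \<theta>"
      using pos \<delta> by (simp add: field_simps power2_eq_square)
    finally show ?case .
  qed
qed (auto intro: always_eventually)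

section \<open>From finitely many nodes to the whole line\<close>

lemma Omega_lipschitz:
  assumes m: "1 \<le> m" and mc: "multicritical m \<gamma>"
  shows "\<bar>Omega \<gamma> x - Omega \<gamma> y\<bar> \<le> \<bar>x - y\<bar>"
proof -
  have int: "integrable circle_measure (\<lambda>\<phi>. \<bar>slope \<gamma> \<phi> - x\<bar>)" for x
    by (rule circle_integrable[of _ "2 * (\<Sum>r\<in>seq_support \<gamma>. real r * \<bar>\<gamma> r\<bar>) + \<bar>x\<bar>"])
       (use slope_bound[of \<gamma>] in \<open>auto intro!: continuous_intros order_trans[OF abs_triangle_ineq4] add_right_mono\<close>)
  have eq: "Omega \<gamma> x - Omega \<gamma> y = (\<integral>\<phi>. \<bar>slope \<gamma> \<phi> - x\<bar> - \<bar>slope \<gamma> \<phi> - y\<bar> \<partial>circle_measure)"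
    unfolding Omega_eq[OF m mc] by (rule Bochner_Integration.integral_diff[symmetric, OF int int])
  have "\<bar>Omega \<gamma> x - Omega \<gamma> y\<bar> \<le> (\<integral>\<phi>. \<bar>\<bar>slope \<gamma> \<phi> - x\<bar> - \<bar>slope \<gamma> \<phi> - y\<bar>\<bar> \<partial>circle_measure)"
    unfolding eq by (rule integral_abs_bound)
  also have "\<dots> \<le> (\<integral>\<phi>. \<bar>x - y\<bar> \<partial>circle_measure)"
    by (intro integral_mono integrable_abs Bochner_Integration.integrable_diff int circle.integrable_const) linarith
  finally show ?thesis by (simp add: circle.prob_space[simplified])
qed

text \<open>Inside, an error \<delta> occurs three times, at the grid node and when the profile and
  \<Omega> are moved from x to it, besides the rounding errors. Outside, the half-line bounds reduce
  everything to the node at the edge, where \<Omega> is the absolute value; hence both edges belong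
  to G.\<close>

lemma profile_uniform_bound:
  assumes m: "1 \<le> m" and mc: "multicritical m \<gamma>" and mu: "\<mu> \<in> partitions" and pos: "\<theta> > 0"
    and grid: "\<And>x. x \<in> {- left_edge \<gamma>..right_edge \<gamma>} \<Longrightarrow> \<exists>g\<in>G. \<bar>x - g\<bar> \<le> \<delta>"
    and edges: "right_edge \<gamma> \<in> G" "- left_edge \<gamma> \<in> G"
    and G: "\<And>g. g \<in> G \<Longrightarrow> \<bar>profile_node \<mu> \<theta> \<lfloor>\<theta> * g\<rfloor> - Omega \<gamma> g\<bar> \<le> \<delta>"
  shows "\<bar>profile \<mu> \<theta> x - Omega \<gamma> x\<bar> \<le> 3 * \<delta> + 3 / \<theta>"
proof -
  have \<delta>: "\<delta> \<ge> 0" using G[OF edges(1)] by linarith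
  have th: "1 / \<theta> > 0" "2 / \<theta> = 2 * (1 / \<theta>)" "3 / \<theta> = 3 * (1 / \<theta>)" using pos by auto
  note nn = edges_nonneg[OF m mc] and lt = edges_less[OF m mc]
  consider "x \<in> {- left_edge \<gamma>..right_edge \<gamma>}" | "x > right_edge \<gamma>" | "x < - left_edge \<gamma>" by fastforce
  thus ?thesis
  proof cases
    case 1
    then obtain g where g: "g \<in> G" "\<bar>x - g\<bar> \<le> \<delta>" using grid by blast
    have "\<bar>of_int \<lfloor>\<theta> * x\<rfloor> - of_int \<lfloor>\<theta> * g\<rfloor>\<bar> / \<theta> = \<bar>of_int \<lfloor>\<theta> * x\<rfloor> / \<theta> - of_int \<lfloor>\<theta> * g\<rfloor> / \<theta>\<bar>"
      using pos by (simp add: diff_divide_distrib[symmetric] abs_divide)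
    also have "\<dots> \<le> \<delta> + 1 / \<theta>"
      using floor_scaled[OF pos, of x] floor_scaled[OF pos, of g] g by linarith
    finally have "\<bar>profile_node \<mu> \<theta> \<lfloor>\<theta> * x\<rfloor> - profile_node \<mu> \<theta> \<lfloor>\<theta> * g\<rfloor>\<bar> \<le> \<delta> + 1 / \<theta>"
      using profile_node_lipschitz[OF mu pos, of "\<lfloor>\<theta> * x\<rfloor>" "\<lfloor>\<theta> * g\<rfloor>"] by linarith
    with profile_near_node[OF mu pos, of x] G[OF g(1)] Omega_lipschitz[OF m mc, of x g] g(2) th
    show ?thesis by linarith
  next
    case 2
    have "Omega \<gamma> x = x" "Omega \<gamma> (right_edge \<gamma>) = right_edge \<gamma>"
      using 2 nn lt Omega_eq_legendre[OF m mc, of "right_edge \<gamma>"]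
      by (auto simp: Omega_def[of \<gamma> x] legendre_def[OF m mc] chi_edges[OF m mc])
    moreover have "\<bar>profile \<mu> \<theta> x - x\<bar> \<le> \<bar>profile_node \<mu> \<theta> \<lfloor>\<theta> * right_edge \<gamma>\<rfloor> - right_edge \<gamma>\<bar> + 1 / \<theta>"
      by (rule profile_above[OF mu pos]) (use 2 in simp)
    ultimately show ?thesis using G[OF edges(1)] \<delta> th by linarith
  next
    case 3
    have "legendre \<gamma> (- left_edge \<gamma>) = left_edge \<gamma> * pi"
      by (simp add: legendre_def[OF m mc] chi_edges[OF m mc])
    hence "Omega \<gamma> x = - x" "Omega \<gamma> (- left_edge \<gamma>) = left_edge \<gamma>"
      using 3 nn lt Omega_eq_legendre[OF m mc, of "- left_edge \<gamma>"] by (auto simp: Omega_def[of \<gamma> x])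
    moreover have "\<bar>profile \<mu> \<theta> x + x\<bar> \<le> \<bar>profile_node \<mu> \<theta> \<lfloor>\<theta> * - left_edge \<gamma>\<rfloor> + - left_edge \<gamma>\<bar> + 2 / \<theta>"
      by (rule profile_below[OF mu pos]) (use 3 in simp)
    ultimately show ?thesis using G[OF edges(2)] \<delta> th by linarith
  qed
qed

lemma finite_grid:
  fixes a b \<delta> :: real
  assumes "\<delta> > 0"
  shows "\<exists>G. finite G \<and> a \<in> G \<and> b \<in> G \<and> (\<forall>x\<in>{a..b}. \<exists>g\<in>G. \<bar>x - g\<bar> \<le> \<delta>)"
proof -
  define G where "G = insert b ((\<lambda>i. a + real i * \<delta>) ` {..nat \<lfloor>(b - a) / \<delta>\<rfloor>})"
  have "\<exists>g\<in>G. \<bar>x - g\<bar> \<le> \<delta>" if x: "x \<in> {a..b}" for x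
  proof -
    define i where "i = nat \<lfloor>(x - a) / \<delta>\<rfloor>"
    have "(x - a) / \<delta> \<ge> 0" using x assms by simp
    hence i: "real i \<le> (x - a) / \<delta>" "(x - a) / \<delta> < real i + 1" unfolding i_def by linarith+
    have "i \<le> nat \<lfloor>(b - a) / \<delta>\<rfloor>"
      unfolding i_def using x assms by (intro nat_mono floor_mono divide_right_mono) auto
    hence "a + real i * \<delta> \<in> G" by (auto simp: G_def)
    moreover have "\<bar>x - (a + real i * \<delta>)\<bar> \<le> \<delta>" using i assms by (simp add: field_simps)
    ultimately show ?thesis by blast
  qed
  moreover have "a \<in> G" unfolding G_def by (intro insertI2 image_eqI[of _ _ 0]) auto
  moreover have "finite G" "b \<in> G" unfolding G_def by auto
  ultimately show ?thesis by blast
qed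

lemma profile_convergence:
  assumes m: "1 \<le> m" and mc: "multicritical m \<gamma>" and eps: "\<epsilon> > 0"
  shows "((\<lambda>\<theta>. \<P>(\<mu> in schur_measure \<gamma> \<theta>. ereal \<epsilon> < (SUP x. ereal \<bar>profile \<mu> \<theta> x - Omega \<gamma> x\<bar>))) \<longlongrightarrow> 0) at_top"
proof -
  have fin: "finite (seq_support \<gamma>)" by (rule fin_supp[OF m mc])
  \<comment> \<open>Then 3 \<delta> is half of \<epsilon>, and \<theta> \<ge> 6 / \<epsilon> makes 3
    / \<theta> at most the other half.\<close>
  define \<delta> where "\<delta> = \<epsilon> / 6"
  have \<delta>: "\<delta> > 0" using eps by (simp add: \<delta>_def)
  obtain G where G: "finite G" "- left_edge \<gamma> \<in> G" "right_edge \<gamma> \<in> G"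
    "\<And>x. x \<in> {- left_edge \<gamma>..right_edge \<gamma>} \<Longrightarrow> \<exists>g\<in>G. \<bar>x - g\<bar> \<le> \<delta>"
    using finite_grid[OF \<delta>, of "- left_edge \<gamma>" "right_edge \<gamma>"] by blast
  define B where "B \<theta> g = {\<mu> \<in> partitions. \<delta> < \<bar>profile_node \<mu> \<theta> \<lfloor>\<theta> * g\<rfloor> - Omega \<gamma> g\<bar>}" for \<theta> g
  show ?thesis
  proof (rule tendsto_sandwich[OF _ _ tendsto_const])
    have "((\<lambda>\<theta>. \<Sum>g\<in>G. measure (schur_measure \<gamma> \<theta>) (B \<theta> g)) \<longlongrightarrow> (\<Sum>g\<in>G. 0)) at_top"
      unfolding B_def by (intro tendsto_sum node_deviation_tendsto[OF m mc \<delta>])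
    thus "((\<lambda>\<theta>. \<Sum>g\<in>G. measure (schur_measure \<gamma> \<theta>) (B \<theta> g)) \<longlongrightarrow> 0) at_top" by simp
    show "\<forall>\<^sub>F \<theta> in at_top. \<P>(\<mu> in schur_measure \<gamma> \<theta>. ereal \<epsilon> < (SUP x. ereal \<bar>profile \<mu> \<theta> x - Omega \<gamma> x\<bar>)) \<le>
        (\<Sum>g\<in>G. measure (schur_measure \<gamma> \<theta>) (B \<theta> g))"
      using eventually_ge_at_top[of "6 / \<epsilon>"] eventually_gt_at_top[of 0]
    proof eventually_elim
      case (elim \<theta>)
      interpret S: prob_space "schur_measure \<gamma> \<theta>" by (rule prob_space_schur_measure[OF fin elim(2)])
      have sets: "sets (schur_measure \<gamma> \<theta>) = Pow partitions" by (rule sets_schur_measure[OF fin elim(2)])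
      have B: "B \<theta> g \<in> sets (schur_measure \<gamma> \<theta>)" for g unfolding sets by (auto simp: B_def)
      have "{\<mu> \<in> space (schur_measure \<gamma> \<theta>). ereal \<epsilon> < (SUP x. ereal \<bar>profile \<mu> \<theta> x - Omega \<gamma> x\<bar>)} \<subseteq> (\<Union>g\<in>G. B \<theta> g)"
      proof
        fix \<mu> assume "\<mu> \<in> {\<mu> \<in> space (schur_measure \<gamma> \<theta>). ereal \<epsilon> < (SUP x. ereal \<bar>profile \<mu> \<theta> x - Omega \<gamma> x\<bar>)}"
        hence mu: "\<mu> \<in> partitions" and gt: "ereal \<epsilon> < (SUP x. ereal \<bar>profile \<mu> \<theta> x - Omega \<gamma> x\<bar>)"
          by (auto simp: space_schur_measure[OF fin elim(2)])
        show "\<mu> \<in> (\<Union>g\<in>G. B \<theta> g)"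
        proof (rule ccontr)
          assume "\<mu> \<notin> (\<Union>g\<in>G. B \<theta> g)"
          hence dev: "\<bar>profile_node \<mu> \<theta> \<lfloor>\<theta> * g\<rfloor> - Omega \<gamma> g\<bar> \<le> \<delta>" if "g \<in> G" for g
            using that mu by (auto simp: B_def not_less)
          have "3 / \<theta> \<le> \<epsilon> / 2" using elim eps by (simp add: field_simps)
          hence "\<bar>profile \<mu> \<theta> x - Omega \<gamma> x\<bar> \<le> \<epsilon>" for x
            using profile_uniform_bound[OF m mc mu elim(2) G(4) G(3) G(2) dev, of x] by (simp add: \<delta>_def)
          hence "(SUP x. ereal \<bar>profile \<mu> \<theta> x - Omega \<gamma> x\<bar>) \<le> ereal \<epsilon>" by (intro SUP_least) simp
          with gt show False by simp
        qed
      qed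
      hence "\<P>(\<mu> in schur_measure \<gamma> \<theta>. ereal \<epsilon> < (SUP x. ereal \<bar>profile \<mu> \<theta> x - Omega \<gamma> x\<bar>)) \<le> S.prob (\<Union>g\<in>G. B \<theta> g)"
        by (rule S.finite_measure_mono) (use B G(1) in auto)
      also have "\<dots> \<le> (\<Sum>g\<in>G. S.prob (B \<theta> g))"
        using S.finite_measure_subadditive_finite[OF G(1), of "B \<theta>"] B by auto
      finally show ?case .
    qed
  qed (auto intro: always_eventually)
qed

theorem theorem3:
  fixes m :: nat and \<gamma> :: "nat \<Rightarrow> real"
  assumes "1 \<le> m" and "multicritical m \<gamma>"
  shows "(\<forall>\<epsilon>>0. ((\<lambda>\<theta>. \<P>(\<mu> in schur_measure \<gamma> \<theta>.
            ereal \<epsilon> < (SUP x. ereal \<bar>profile \<mu> \<theta> x - Omega \<gamma> x\<bar>))) \<longlongrightarrow> 0) at_top) \<and>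
    (\<forall>\<^sub>F x in at_left (right_edge \<gamma>). Omega \<gamma> differentiable at x) \<and>
    (\<lambda>x. 1 - deriv (Omega \<gamma>) x) \<sim>[at_left (right_edge \<gamma>)]
           (\<lambda>x. 2 / pi * ((right_edge \<gamma> - x) / fluct_coeff m \<gamma>) powr (1 / (2 * real m)))"
proof (intro conjI allI impI)
  show "\<forall>\<^sub>F x in at_left (right_edge \<gamma>). Omega \<gamma> differentiable at x"
    using eventually_inside[OF assms]
  proof eventually_elim
    case (elim x)
    from Omega_has_derivative[OF assms elim] show ?case
      unfolding real_differentiable_def by blast
  qed
qed (use profile_convergence[OF assms] Omega_edge_asymp[OF assms] in auto)
end
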